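(* If $f_n:\{0,1\}^{V_n}\to\{-1,1\}$, $n\in\mathbb{N}$, are monotone and the sequence $\{f_n\}_{n\in\mathbb{N}}$ is CGXStable, then the sequence is NStable.
   Context: $\{V_n\}$ is an increasing sequence of finite sets. $f_n$ is monotone if $f_n(\omega)\le f_n(\omega')$ whenever $\omega_i\le\omega'_i$ for every $i$. Let $\omega$ be uniform on $\{0,1\}^{V_n}$; for $\epsilon\in(0,1)$, $\omega^\epsilon$ is obtained from $\omega$ by resampling each coordinate (as a fair bit) independently with probability $\epsilon$. NStable (noise stable): for every $\delta>0$ there is $\epsilon>0$ such that for every $n$, $\mathbb{P}[f_n(\omega)\ne f_n(\omega^\epsilon)]\le\delta$. Complete graph exclusion process on $V_n$: to every unordered pair of distinct elements of $V_n$ associate an independent Poisson clock of rate $1/|V_n|$; when it rings, the two elements are interchanged. $\pi^n_t$ is the random permutation of $V_n$ obtained by composing, in order, all transpositions up to time $t$. With $\eta^n_0$ uniform on $\{0,1\}^{V_n}$ and independent of the clocks, $\eta^n_t(x)=\eta^n_0((\pi^n_t)^{-1}(x))$. CGXStable (complete graph exclusion stable): for every $\delta>0$ there is $t>0$ such that for every $n$, $\mathbb{P}[f_n(\eta^n_0)\ne f_n(\eta^n_t)]\le\delta$. *)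

theory Defs
  imports "HOL-Probability.Probability"
begin

definition cube :: "'a set \<Rightarrow> ('a \<Rightarrow> nat) set" where
  "cube V = (V \<rightarrow>\<^sub>E {0, 1})"

definition monotone_on_cube :: "'a set \<Rightarrow> (('a \<Rightarrow> nat) \<Rightarrow> real) \<Rightarrow> bool" where
  "monotone_on_cube V f \<longleftrightarrow>
     (\<forall>\<omega>\<in>cube V. \<forall>\<omega>'\<in>cube V. (\<forall>i\<in>V. \<omega> i \<le> \<omega>' i) \<longrightarrow> f \<omega> \<le> f \<omega>')"


section \<open>Noise stability\<close>

text \<open>The joint law of a uniform configuration and its noisy version, in which every coordinate
  is replaced, independently with probability \<open>\<epsilon>\<close>, by a fresh fair bit.\<close>

definition noise_pair :: "'a set \<Rightarrow> real \<Rightarrow> (('a \<Rightarrow> nat) \<times> ('a \<Rightarrow> nat)) pmf" where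
  "noise_pair V \<epsilon> =
     do {
       \<omega> \<leftarrow> pmf_of_set (cube V);
       resampled \<leftarrow> Pi_pmf V False (\<lambda>_. bernoulli_pmf \<epsilon>);
       fresh \<leftarrow> pmf_of_set (cube V);
       return_pmf (\<omega>, \<lambda>x\<in>V. if resampled x then fresh x else \<omega> x)
     }"

definition NStable :: "(nat \<Rightarrow> 'a set) \<Rightarrow> (nat \<Rightarrow> ('a \<Rightarrow> nat) \<Rightarrow> real) \<Rightarrow> bool" where
  "NStable V f \<longleftrightarrow>
     (\<forall>\<delta>>0. \<exists>\<epsilon>\<in>{0<..<1}. \<forall>n.
        measure_pmf.prob (noise_pair (V n) \<epsilon>) {(\<omega>, \<omega>'). f n \<omega> \<noteq> f n \<omega>'} \<le> \<delta>)"


section \<open>The complete graph exclusion process\<close>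

definition pairs :: "'a set \<Rightarrow> 'a set set" where
  "pairs V = {e. e \<subseteq> V \<and> card e = 2}"

text \<open>The interchange of the two elements of an unordered pair.\<close>

definition swap_pair :: "'a set \<Rightarrow> 'a \<Rightarrow> 'a" where
  "swap_pair e = (\<lambda>z. if z \<in> e then the_elem (e - {z}) else z)"

text \<open>Independent Poisson clocks of rate \<open>1 / |V|\<close>, one for each unordered pair, are realised through
  their independent exponential waiting times: at a sample point \<open>w\<close>, the clock of \<open>e\<close> first rings
  at time \<open>w (e, 0)\<close>, and then after further waiting times \<open>w (e, 1)\<close>, \<open>w (e, 2)\<close>, and so on.\<close>

definition clocks :: "'a set \<Rightarrow> ('a set \<times> nat \<Rightarrow> real) measure" where
  "clocks V =
     PiM (pairs V \<times> UNIV) (\<lambda>_. density lborel (exponential_density (1 / real (card V))))"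

definition ring_time :: "('a set \<times> nat \<Rightarrow> real) \<Rightarrow> 'a set \<Rightarrow> nat \<Rightarrow> real" where
  "ring_time w e k = (\<Sum>j\<le>k. w (e, j))"

definition ring_times_upto :: "'a set \<Rightarrow> ('a set \<times> nat \<Rightarrow> real) \<Rightarrow> real \<Rightarrow> real set" where
  "ring_times_upto V w t = {s. s \<le> t \<and> (\<exists>e\<in>pairs V. \<exists>k. s = ring_time w e k)}"

text \<open>Almost surely no two clocks ring simultaneously and only finitely many rings occur up to
  time \<open>t\<close>; so the choice in \<open>ringing_pair\<close> is unique and the list in \<open>cgx_perm\<close> enumerates
  all rings up to time \<open>t\<close>.\<close>

definition ringing_pair :: "'a set \<Rightarrow> ('a set \<times> nat \<Rightarrow> real) \<Rightarrow> real \<Rightarrow> 'a set" where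
  "ringing_pair V w s = (SOME e. e \<in> pairs V \<and> (\<exists>k. s = ring_time w e k))"

definition cgx_perm :: "'a set \<Rightarrow> ('a set \<times> nat \<Rightarrow> real) \<Rightarrow> real \<Rightarrow> 'a \<Rightarrow> 'a" where
  "cgx_perm V w t =
     fold (\<lambda>s \<pi>. swap_pair (ringing_pair V w s) \<circ> \<pi>)
       (sorted_list_of_set (ring_times_upto V w t)) id"

definition cgx_config ::
    "'a set \<Rightarrow> ('a \<Rightarrow> nat) \<Rightarrow> ('a set \<times> nat \<Rightarrow> real) \<Rightarrow> real \<Rightarrow> 'a \<Rightarrow> nat" where
  "cgx_config V \<eta> w t = (\<lambda>x\<in>V. \<eta> (inv (cgx_perm V w t) x))"

definition cgx_space :: "'a set \<Rightarrow> (('a \<Rightarrow> nat) \<times> ('a set \<times> nat \<Rightarrow> real)) measure" where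
  "cgx_space V = measure_pmf (pmf_of_set (cube V)) \<Otimes>\<^sub>M clocks V"

definition CGXStable :: "(nat \<Rightarrow> 'a set) \<Rightarrow> (nat \<Rightarrow> ('a \<Rightarrow> nat) \<Rightarrow> real) \<Rightarrow> bool" where
  "CGXStable V f \<longleftrightarrow>
     (\<forall>\<delta>>0. \<exists>t>0. \<forall>n.
        measure (cgx_space (V n))
          {(\<eta>, w) \<in> space (cgx_space (V n)). f n \<eta> \<noteq> f n (cgx_config (V n) \<eta> w t)} \<le> \<delta>)"

end

(* Identify configurations with subsets of V and let d(S, T) be the probability that f separates the
   images of S and T under a uniform random permutation of V. Exclusion stability is about the mean
   of d(S, pS) over uniform S and the random permutation p of the process, whose law is invariant
   under conjugation; noise stability is about the mean of d(S, T), where T is S with noise.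

   For monotone f, d(S, T) depends essentially only on the numbers of sites that are switched on and
   off: if the pairs (S, T) and (S, T') have these numbers within L of each other, then d(S, T) and
   d(S, T') differ by at most the increase of the level means of f over a window of width 4L around
   |S|. These means are monotone in the level and a binomial has no atom above 1 / sqrt n, so the
   expected increase is O(L / sqrt n), which is small for L = eta sqrt n. It remains to find a fixed
   permutation k for which d(S, kS) is small on average and which moves about epsilon n points, with
   epsilon much smaller than eta^2: then the numbers of switched sites under k and under the noise
   are both concentrated up to eta sqrt n around epsilon n / 4.

   A second moment computation for the pairs that ring exactly once, and whose neighbours do not
   ring, shows that p moves at least theta(t) n points with probability at least 1/2. Hence some p
   with this property has small mean d(S, pS). Since p may move too many points, take a set R of the
   desired size with R and pR disjoint, and a derangement r of R: the commutator of p and r moves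
   exactly 2 |R| points, and its mean displacement is at most twice that of p. *)

theory Submission
  imports Defs "HOL-Combinatorics.Permutations"
begin

section \<open>Distances averaged over permutations\<close>

text \<open>Monotonicity is indispensable: exclusion preserves \<open>|S|\<close>, so the parity of
  \<open>|S|\<close> is perfectly stable under it, yet far from noise stable. The proof must
  therefore pay for the change of level caused by noise. This is cheap because the change is of
  order sqrt (\<epsilon> n), while the level itself fluctuates at order sqrt n.

  Averaging over permutations loses nothing, as both laws are invariant under relabelling, and it
  yields an invariant pseudometric on subsets.

  The obstacle is the order of the constants. The error \<delta> fixes \<eta>, and only then does
  exclusion stability supply a time t. The process up to t may move far more than \<eta>^2 n points,
  and then its number of switched sites fluctuates by more than \<eta> sqrt n. Restricting p to some
  of its cycles gives no control of the displacement. The commutator, in contrast, is p times a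
  conjugate of its inverse, so the triangle inequality bounds its displacement whatever r is, and
  the size of the support can be chosen freely. Hence only a lower bound on the number of points
  moved by p is needed.\<close>

definition perm_dist :: "'a set \<Rightarrow> ('a set \<Rightarrow> bool) \<Rightarrow> 'a set \<Rightarrow> 'a set \<Rightarrow> real" where
  "perm_dist V F S T = real (card {p. p permutes V \<and> F (p ` S) \<noteq> F (p ` T)}) / fact (card V)"

definition perm_mean :: "'a set \<Rightarrow> ('a set \<Rightarrow> bool) \<Rightarrow> 'a set \<Rightarrow> real" where
  "perm_mean V F S = real (card {p. p permutes V \<and> F (p ` S)}) / fact (card V)"

lemma finite_perms: "finite V \<Longrightarrow> finite {p. p permutes V \<and> Q p}"
  using finite_permutations[of V] by (rule finite_subset[rotated]) auto

lemma perm_dist_nonneg: "0 \<le> perm_dist V F S T"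
  by (simp add: perm_dist_def)

lemma card_perms_le: "finite V \<Longrightarrow> card {p. p permutes V \<and> Q p} \<le> fact (card V)"
  using card_permutations[of V "card V"] finite_permutations[of V]
  by (metis (mono_tags, lifting) card_mono mem_Collect_eq subsetI)

lemma perm_dist_le_1: "finite V \<Longrightarrow> perm_dist V F S T \<le> 1"
  unfolding perm_dist_def using of_nat_mono[OF card_perms_le, of V _, where 'a = real]
  by (simp add: divide_le_eq_1)

lemma perm_mean_nonneg: "0 \<le> perm_mean V F S"
  by (simp add: perm_mean_def)

lemma perm_mean_le_1: "finite V \<Longrightarrow> perm_mean V F S \<le> 1"
  unfolding perm_mean_def using of_nat_mono[OF card_perms_le, of V _, where 'a = real]
  by (simp add: divide_le_eq_1)

lemma perm_dist_commute: "perm_dist V F S T = perm_dist V F T S"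
  by (simp add: perm_dist_def eq_commute)

lemma perm_dist_triangle:
  assumes "finite V"
  shows "perm_dist V F S U \<le> perm_dist V F S T + perm_dist V F T U"
proof -
  let ?A = "\<lambda>S T. {p. p permutes V \<and> F (p ` S) \<noteq> F (p ` T)}"
  have "card (?A S U) \<le> card (?A S T \<union> ?A T U)"
    using finite_perms[OF assms] by (intro card_mono) auto
  also have "\<dots> \<le> card (?A S T) + card (?A T U)"
    by (rule card_Un_le)
  finally have "real (card (?A S U)) \<le> real (card (?A S T)) + real (card (?A T U))"
    by linarith
  then show ?thesis
    unfolding perm_dist_def add_divide_distrib[symmetric] by (intro divide_right_mono) auto
qed

text \<open>Right translation by \<open>q\<close> is a bijection of the symmetric group. The
  invariance of \<open>perm_dist\<close> and \<open>perm_mean\<close> under relabelling comes from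
  here.\<close>

lemma card_perms_compose:
  assumes "q permutes V"
  shows "card {p. p permutes V \<and> Q (p \<circ> q)} = card {p. p permutes V \<and> Q p}"
proof (rule bij_betw_same_card[of "\<lambda>p. p \<circ> q"])
  have q: "p \<circ> q permutes V" "p \<circ> inv q permutes V" if "p permutes V" for p
    using permutes_compose[OF assms that] permutes_compose[OF permutes_inv[OF assms] that] .
  have inv: "(p \<circ> q) \<circ> inv q = p" "(p \<circ> inv q) \<circ> q = p" for p :: "'a \<Rightarrow> 'b"
    by (simp_all add: comp_assoc permutes_inv_o[OF assms])
  show "bij_betw (\<lambda>p. p \<circ> q) {p. p permutes V \<and> Q (p \<circ> q)} {p. p permutes V \<and> Q p}"
    by (rule bij_betwI[of _ _ _ "\<lambda>p. p \<circ> inv q"]) (simp_all add: q inv Pi_iff)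
qed

lemma perm_dist_image:
  assumes "q permutes V"
  shows "perm_dist V F (q ` S) (q ` T) = perm_dist V F S T"
  using card_perms_compose[OF assms, of "\<lambda>p. F (p ` S) \<noteq> F (p ` T)"]
  by (simp add: perm_dist_def image_comp)

lemma perm_mean_image:
  assumes "q permutes V"
  shows "perm_mean V F (q ` S) = perm_mean V F S"
  using card_perms_compose[OF assms, of "\<lambda>p. F (p ` S)"]
  by (simp add: perm_mean_def image_comp)

definition mono_on_subsets :: "'a set \<Rightarrow> ('a set \<Rightarrow> bool) \<Rightarrow> bool" where
  "mono_on_subsets V F \<longleftrightarrow> (\<forall>S T. S \<subseteq> T \<longrightarrow> T \<subseteq> V \<longrightarrow> F S \<longrightarrow> F T)"

lemma mono_on_subsets_image:
  assumes "mono_on_subsets V F" "p permutes V" "S \<subseteq> T" "T \<subseteq> V" "F (p ` S)"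
  shows "F (p ` T)"
proof -
  have "p ` T \<subseteq> V"
    using image_mono[OF assms(4), of p] permutes_image[OF assms(2)] by simp
  then show ?thesis
    using assms(1,5) image_mono[OF assms(3), of p] unfolding mono_on_subsets_def by blast
qed

lemma perm_mean_mono:
  assumes "finite V" "mono_on_subsets V F" "S \<subseteq> T" "T \<subseteq> V"
  shows "perm_mean V F S \<le> perm_mean V F T"
  unfolding perm_mean_def
  using finite_perms[OF assms(1)] mono_on_subsets_image[OF assms(2) _ assms(3,4)]
  by (intro divide_right_mono of_nat_mono card_mono) auto

text \<open>Here monotonicity enters. If the images of \<open>S\<close> and \<open>T\<close> are
  separated, then \<open>F\<close> holds on the image of \<open>B\<close> and fails on that of
  \<open>A\<close>; these two events are nested, so the probability is a difference of
  means.\<close>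

lemma perm_dist_sandwich:
  assumes "finite V" "mono_on_subsets V F" "A \<subseteq> S" "A \<subseteq> T" "S \<subseteq> B" "T \<subseteq> B" "B \<subseteq> V"
  shows "perm_dist V F S T \<le> perm_mean V F B - perm_mean V F A"
proof -
  let ?P = "\<lambda>S. {p. p permutes V \<and> F (p ` S)}"
  have fin: "finite (?P S)" for S
    by (rule finite_perms[OF assms(1)])
  note m = mono_on_subsets_image[OF assms(2)]
  have "A \<subseteq> B"
    using assms by blast
  have sub: "{p. p permutes V \<and> F (p ` S) \<noteq> F (p ` T)} \<subseteq> ?P B - ?P A"
  proof
    fix p assume "p \<in> {p. p permutes V \<and> F (p ` S) \<noteq> F (p ` T)}"
    then have p: "p permutes V" "F (p ` S) \<noteq> F (p ` T)" by auto
    have "F (p ` A) \<Longrightarrow> F (p ` S)" "F (p ` A) \<Longrightarrow> F (p ` T)"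
      using m[OF p(1), of A S] m[OF p(1), of A T] assms by blast+
    moreover have "F (p ` S) \<Longrightarrow> F (p ` B)" "F (p ` T) \<Longrightarrow> F (p ` B)"
      using m[OF p(1), of S B] m[OF p(1), of T B] assms by blast+
    ultimately show "p \<in> ?P B - ?P A"
      using p by blast
  qed
  have "?P A \<subseteq> ?P B"
    using m[of _ A B] \<open>A \<subseteq> B\<close> assms by blast
  then have "real (card (?P B - ?P A)) = real (card (?P B)) - real (card (?P A))"
    using fin by (simp add: card_Diff_subset of_nat_diff card_mono)
  moreover have "card {p. p permutes V \<and> F (p ` S) \<noteq> F (p ` T)} \<le> card (?P B - ?P A)"
    using sub fin by (intro card_mono) auto
  ultimately have "real (card {p. p permutes V \<and> F (p ` S) \<noteq> F (p ` T)})
      \<le> real (card (?P B)) - real (card (?P A))"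
    by linarith
  then show ?thesis
    unfolding perm_dist_def perm_mean_def diff_divide_distrib[symmetric]
    by (intro divide_right_mono) auto
qed

section \<open>Comparing pairs of sets with similar numbers of switched sites\<close>

lemma exists_bij_nested:
  fixes S S' :: "'a set"
  assumes "finite S" "finite S'" "card S = card S'" "D \<subseteq> S" "D' \<subseteq> S'"
  shows "\<exists>h. bij_betw h S' S \<and> (h ` D' \<subseteq> D \<or> D \<subseteq> h ` D')"
proof -
  have small: "\<exists>h. bij_betw h S' S \<and> h ` D' \<subseteq> D"
    if "finite S" "finite S'" "card S = card S'" "D \<subseteq> S" "D' \<subseteq> S'" and le: "card D' \<le> card D"
    for S S' D D' :: "'a set"
  proof -
    obtain E where E: "E \<subseteq> D" "card E = card D'"
      by (rule obtain_subset_with_card_n[OF le])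
    have fin: "finite E" "finite D'"
      using finite_subset[OF E(1) finite_subset[OF that(4,1)]] finite_subset[OF that(5,2)] .
    obtain g where g: "bij_betw g D' E"
      using finite_same_card_bij[OF fin(2,1)] E by auto
    have "card (S' - D') = card (S - E)"
      using card_Diff_subset[OF fin(2) that(5)] card_Diff_subset[OF fin(1) subset_trans[OF E(1) that(4)]]
        E(2) that(3) by simp
    then obtain k where k: "bij_betw k (S' - D') (S - E)"
      using finite_same_card_bij[of "S' - D'" "S - E"] \<open>finite S\<close> \<open>finite S'\<close> by blast
    have "bij_betw (\<lambda>x. if x \<in> D' then g x else k x) (D' \<union> (S' - D')) (E \<union> (S - E))"
      by (rule bij_betw_disjoint_Un[OF g k]) auto
    moreover have "D' \<union> (S' - D') = S'" "E \<union> (S - E) = S"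
      using that(4,5) E(1) by blast+
    moreover have "(\<lambda>x. if x \<in> D' then g x else k x) ` D' \<subseteq> D"
      using g E by (auto simp: bij_betw_def)
    ultimately show ?thesis
      by metis
  qed
  show ?thesis
  proof (cases "card D' \<le> card D")
    case True
    then show ?thesis using small[OF assms] by blast
  next
    case False
    \<comment> \<open>Now \<open>D\<close> is the smaller set: the roles are exchanged and the
      bijection is inverted.\<close>
    then obtain h where h: "bij_betw h S S'" "h ` D \<subseteq> D'"
      using small[of S' S D' D] assms by auto
    have "D \<subseteq> inv_into S h ` D'"
    proof
      fix x assume "x \<in> D"
      then have "h x \<in> D'" "inv_into S h (h x) = x"
        using h assms(4) by (auto simp: bij_betw_def)
      then show "x \<in> inv_into S h ` D'"
        by force
    qed
    then show ?thesis
      using bij_betw_inv_into[OF h(1)] by blast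
  qed
qed

text \<open>In the application \<open>D\<close>, \<open>D'\<close> are the sites switched off and \<open>U\<close>, \<open>U'\<close> the sites switched on.\<close>

lemma exists_perm_nested:
  assumes "finite V" "S \<subseteq> V" "S' \<subseteq> V" "card S = card S'" "D \<subseteq> S" "D' \<subseteq> S'"
    "U \<subseteq> V - S" "U' \<subseteq> V - S'"
  obtains q where "q permutes V" "q ` S' = S" "q ` D' \<subseteq> D \<or> D \<subseteq> q ` D'"
    "q ` U' \<subseteq> U \<or> U \<subseteq> q ` U'"
proof -
  have fin: "finite S" "finite S'"
    using assms by (meson finite_subset)+
  obtain g where g: "bij_betw g S' S" "g ` D' \<subseteq> D \<or> D \<subseteq> g ` D'"
    using exists_bij_nested[OF fin assms(4-6)] by blast
  have "card (V - S) = card (V - S')"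
    using assms fin by (simp add: card_Diff_subset)
  then obtain k where k: "bij_betw k (V - S') (V - S)" "k ` U' \<subseteq> U \<or> U \<subseteq> k ` U'"
    using exists_bij_nested[of "V - S" "V - S'" U U'] assms by auto
  define q where "q x = (if x \<in> S' then g x else if x \<in> V then k x else x)" for x
  have q1: "\<And>x. x \<in> S' \<Longrightarrow> q x = g x" and q2: "\<And>x. x \<in> V - S' \<Longrightarrow> q x = k x"
    by (auto simp: q_def)
  have b1: "bij_betw q S' S" and b2: "bij_betw q (V - S') (V - S)"
    using bij_betw_cong[of S' q g S] bij_betw_cong[of "V - S'" q k "V - S"] g(1) k(1) q1 q2 by blast+
  have "bij_betw q (S' \<union> (V - S')) (S \<union> (V - S))"
    by (rule bij_betw_combine[OF b1 b2]) auto
  then have "bij_betw q V V"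
    using assms by (simp add: Un_absorb1)
  then have "q permutes V"
    by (rule bij_imp_permutes) (use assms(3) in \<open>auto simp: q_def\<close>)
  moreover have "q ` S' = S"
    using b1 by (simp add: bij_betw_def)
  moreover have "q ` D' = g ` D'"
    using assms q1 by (intro image_cong) auto
  moreover have "q ` U' = k ` U'"
    using assms q2 by (intro image_cong) auto
  ultimately show ?thesis
    using that[of q] g(2) k(2) by simp
qed

text \<open>A fixed increasing chain of subsets of \<open>V\<close>, one for each cardinality; it is constant beyond
  \<open>card V\<close>. Along it, the monotonicity of the level means is immediate.\<close>

definition chain_set :: "'a set \<Rightarrow> nat \<Rightarrow> 'a set" where
  "chain_set V k = (SOME h. bij_betw h {..<card V} V) ` ({..<card V} \<inter> {..<k})"

lemma chain_set_props:
  assumes "finite V"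
  shows "chain_set V k \<subseteq> V" "card (chain_set V k) = min (card V) k"
    "k \<le> l \<Longrightarrow> chain_set V k \<subseteq> chain_set V l"
proof -
  define h where "h = (SOME h. bij_betw h {..<card V} V)"
  have "\<exists>h. bij_betw h {..<card V} V"
    using ex_bij_betw_nat_finite[OF assms] by (simp add: atLeast0LessThan)
  then have h: "bij_betw h {..<card V} V"
    unfolding h_def by (rule someI_ex)
  have eq: "chain_set V k = h ` ({..<card V} \<inter> {..<k})" for k
    by (simp add: chain_set_def h_def)
  show "chain_set V k \<subseteq> V"
    using h by (auto simp: eq bij_betw_def)
  have ivl: "{..<card V} \<inter> {..<k} = {..<min (card V) k}"
    by auto
  have "inj_on h ({..<card V} \<inter> {..<k})"
    using h by (auto simp: bij_betw_def inj_on_def)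
  then show "card (chain_set V k) = min (card V) k"
    by (simp add: eq card_image ivl)
  show "k \<le> l \<Longrightarrow> chain_set V k \<subseteq> chain_set V l"
    by (auto simp: eq)
qed

definition level_mean :: "'a set \<Rightarrow> ('a set \<Rightarrow> bool) \<Rightarrow> nat \<Rightarrow> real" where
  "level_mean V F k = perm_mean V F (chain_set V k)"

lemma level_mean_mono:
  assumes "finite V" "mono_on_subsets V F"
  shows "mono (level_mean V F)"
  unfolding level_mean_def
  by (intro monoI perm_mean_mono[OF assms] chain_set_props[OF assms(1)])

lemma perm_mean_eq_level_mean:
  assumes "finite V" "S \<subseteq> V"
  shows "perm_mean V F S = level_mean V F (card S)"
proof -
  have "card S \<le> card V"
    using assms by (rule card_mono)
  then have "card S = card (chain_set V (card S))"
    by (simp add: chain_set_props(2)[OF assms(1)])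
  \<comment> \<open>With empty sets of switched sites the nesting is void; what remains is
    transitivity on the subsets of one size.\<close>
  then obtain q where "q permutes V" "q ` chain_set V (card S) = S"
    by (rule exists_perm_nested[OF assms chain_set_props(1)[OF assms(1)],
        of "card S" "{}" "{}" "{}" "{}"]) simp_all
  then show ?thesis
    using perm_mean_image[of q V F "chain_set V (card S)"] by (simp add: level_mean_def)
qed

text \<open>\<open>q\<close> carries \<open>(S', T')\<close> to a pair \<open>(S, Y)\<close> with
  \<open>Y\<close> as close to \<open>T\<close> as the cardinalities permit: among the sites
  switched off, and likewise among those switched on, one set contains the other. Then
  \<open>T\<close> and \<open>Y\<close> lie between their intersection and their union, both of size
  within \<open>2 * L\<close> of \<open>card S\<close>, although \<open>d\<close> may be far larger
  than \<open>L\<close>. Without nesting these sizes could be off by the order of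
  \<open>d\<close>.\<close>

lemma perm_dist_compare:
  fixes L d :: nat
  assumes V: "finite V" and F: "mono_on_subsets V F"
    and sub: "S \<subseteq> V" "T \<subseteq> V" "S' \<subseteq> V" "T' \<subseteq> V" and card_eq: "card S = card S'"
    and d: "card (S' - T') = d" "card (T' - S') = d"
    and a: "card (T - S) \<le> d + L" "d \<le> card (T - S) + L"
    and b: "card (S - T) \<le> d + L" "d \<le> card (S - T) + L"
  shows "perm_dist V F S T \<le> perm_dist V F S' T'
    + (level_mean V F (card S + 2 * L) - level_mean V F (card S - 2 * L))"
proof -
  have fin: "finite S" "finite T" "finite S'" "finite T'"
    using V sub by (meson finite_subset)+
  obtain q where q: "q permutes V" "q ` S' = S"
    "q ` (S' - T') \<subseteq> S - T \<or> S - T \<subseteq> q ` (S' - T')"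
    "q ` (T' - S') \<subseteq> T - S \<or> T - S \<subseteq> q ` (T' - S')"
    by (rule exists_perm_nested[OF V sub(1,3) card_eq, of "S - T" "S' - T'" "T - S" "T' - S'"])
       (use sub in auto)
  define Y where "Y = q ` T'"
  have inj: "inj q"
    using q(1) by (rule permutes_inj)
  have Y: "q ` (S' - T') = S - Y" "q ` (T' - S') = Y - S"
    using q(2) by (simp_all add: Y_def image_set_diff[OF inj])
  have cY: "card (S - Y) = d" "card (Y - S) = d"
    using d card_image[of q] inj Y by (metis inj_on_subset subset_UNIV)+
  have YV: "Y \<subseteq> V"
    using sub(4) q(1) unfolding Y_def by (metis image_mono permutes_image)
  have finY: "finite Y"
    using YV V by (rule finite_subset)
  have nest: "S - Y \<subseteq> S - T \<or> S - T \<subseteq> S - Y" "Y - S \<subseteq> T - S \<or> T - S \<subseteq> Y - S"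
    using q(3,4) Y by simp_all
  define k where "k = card S"
  have split: "card (A \<inter> S) + card (A - S) = card A" "card (A \<inter> S) + card (S - A) = k"
    if "finite A" for A
    using card_Int_Diff[OF that, of S] card_Int_Diff[OF fin(1), of A]
    by (simp_all add: k_def Int_commute)
  \<comment> \<open>By nesting, passing from \<open>S\<close> to the union switches off the smaller
    of two sets, at least \<open>d - L\<close> sites, and switches on the larger, at most
    \<open>d + L\<close> sites. For the intersection it is the other way round.\<close>
  have up: "card (T \<union> Y) \<le> k + 2 * L"
  proof -
    have "card (T \<union> Y) = card ((T \<union> Y) \<inter> S) + card ((T \<union> Y) - S)"
      using split(1)[of "T \<union> Y"] fin finY by simp
    moreover have "card ((T \<union> Y) \<inter> S) + card (S - (T \<union> Y)) = k"
      using split(2)[of "T \<union> Y"] fin finY by simp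
    moreover have "S - (T \<union> Y) = S - T \<or> S - (T \<union> Y) = S - Y"
      using nest(1) by auto
    then have "d \<le> card (S - (T \<union> Y)) + L"
      using b(2) cY(1) by auto
    moreover have "(T \<union> Y) - S = T - S \<or> (T \<union> Y) - S = Y - S"
      using nest(2) by auto
    then have "card ((T \<union> Y) - S) \<le> d + L"
      using a(1) cY(2) by auto
    ultimately show ?thesis by linarith
  qed
  have low: "k - 2 * L \<le> card (T \<inter> Y)"
  proof -
    have "card (T \<inter> Y) = card ((T \<inter> Y) \<inter> S) + card ((T \<inter> Y) - S)"
      using split(1)[of "T \<inter> Y"] fin finY by simp
    moreover have "card ((T \<inter> Y) \<inter> S) + card (S - (T \<inter> Y)) = k"
      using split(2)[of "T \<inter> Y"] fin finY by simp
    moreover have "S - (T \<inter> Y) = S - T \<or> S - (T \<inter> Y) = S - Y"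
      using nest(1) by auto
    then have "card (S - (T \<inter> Y)) \<le> d + L"
      using b(1) cY(1) by auto
    moreover have "(T \<inter> Y) - S = T - S \<or> (T \<inter> Y) - S = Y - S"
      using nest(2) by auto
    then have "d \<le> card ((T \<inter> Y) - S) + L"
      using a(2) cY(2) by auto
    ultimately show ?thesis by linarith
  qed
  have "perm_dist V F S T \<le> perm_dist V F S Y + perm_dist V F Y T"
    by (rule perm_dist_triangle[OF V])
  also have "perm_dist V F S Y = perm_dist V F S' T'"
    using perm_dist_image[OF q(1), of F S' T'] q(2) by (simp add: Y_def)
  also have "perm_dist V F Y T \<le> perm_mean V F (T \<union> Y) - perm_mean V F (T \<inter> Y)"
    by (rule perm_dist_sandwich[OF V F]) (use sub YV in auto)
  also have "\<dots> = level_mean V F (card (T \<union> Y)) - level_mean V F (card (T \<inter> Y))"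
    using perm_mean_eq_level_mean[OF V, of "T \<union> Y"] perm_mean_eq_level_mean[OF V, of "T \<inter> Y"] sub YV
    by auto
  also have "\<dots> \<le> level_mean V F (k + 2 * L) - level_mean V F (k - 2 * L)"
    using up low level_mean_mono[OF V F] by (intro diff_mono) (auto simp: mono_def)
  finally show ?thesis
    by (simp add: k_def)
qed

section \<open>Random subsets\<close>

text \<open>The probability that independent sites of \<open>V\<close>, each occupied with
  probability \<open>p\<close>, are occupied exactly on \<open>S\<close>.\<close>

definition bern_weight :: "'a set \<Rightarrow> real \<Rightarrow> 'a set \<Rightarrow> real" where
  "bern_weight V p S = p ^ card S * (1 - p) ^ card (V - S)"

lemma bern_weight_nonneg: "0 \<le> p \<Longrightarrow> p \<le> 1 \<Longrightarrow> 0 \<le> bern_weight V p S"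
  by (simp add: bern_weight_def)

text \<open>Independence in algebraic form: expanding a product of two-term factors gives one
  summand for each subset. Indicator factors then produce the probabilities that are needed.\<close>

lemma sum_bern_weight_prod:
  assumes "finite V"
  shows "(\<Sum>S\<in>Pow V. bern_weight V p S * (\<Prod>i\<in>V. if i \<in> S then a i else b i))
    = (\<Prod>i\<in>V. p * a i + (1 - p) * b i)"
proof -
  have "(\<Prod>i\<in>V. p * a i + (1 - p) * b i)
      = (\<Sum>S\<in>Pow V. (\<Prod>i\<in>S. p * a i) * (\<Prod>i\<in>V - S. (1 - p) * b i))"
    by (rule prod_add[OF assms])
  also have "\<dots> = (\<Sum>S\<in>Pow V. bern_weight V p S * (\<Prod>i\<in>V. if i \<in> S then a i else b i))"
  proof (rule sum.cong[OF refl])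
    fix S assume "S \<in> Pow V"
    then have S: "V \<inter> {x. x \<in> S} = S" "V \<inter> - {x. x \<in> S} = V - S"
      by auto
    show "(\<Prod>i\<in>S. p * a i) * (\<Prod>i\<in>V - S. (1 - p) * b i)
        = bern_weight V p S * (\<Prod>i\<in>V. if i \<in> S then a i else b i)"
      unfolding prod.If_cases[OF assms] S
      by (simp add: bern_weight_def prod.distrib)
  qed
  finally show ?thesis ..
qed

lemma sum_bern_weight:
  assumes "finite V"
  shows "(\<Sum>S\<in>Pow V. bern_weight V p S) = 1"
  using sum_bern_weight_prod[OF assms, of p "\<lambda>_. 1" "\<lambda>_. 1"] by simp

lemma sum_bern_weight_superset:
  assumes "finite V" "B \<subseteq> V"
  shows "(\<Sum>S\<in>Pow V. bern_weight V p S * of_bool (B \<subseteq> S)) = p ^ card B"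
proof -
  have "(\<Prod>i\<in>V. if i \<in> S then 1 else of_bool (i \<notin> B)) = (of_bool (B \<subseteq> S) :: real)" for S
  proof (cases "B \<subseteq> S")
    case True
    then show ?thesis by (auto intro!: prod.neutral)
  next
    case False
    then show ?thesis using assms by (auto intro!: prod_zero)
  qed
  moreover have "(\<Prod>i\<in>V. p * 1 + (1 - p) * of_bool (i \<notin> B)) = p ^ card B"
  proof -
    have "(\<Prod>i\<in>V. p * 1 + (1 - p) * of_bool (i \<notin> B)) = (\<Prod>i\<in>B. p)"
      using assms by (intro prod.mono_neutral_cong_right) auto
    then show ?thesis by simp
  qed
  ultimately show ?thesis
    using sum_bern_weight_prod[OF assms(1), of p "\<lambda>_. 1" "\<lambda>i. of_bool (i \<notin> B)"] by simp
qed

lemma sum_bern_weight_disjoint: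
  assumes "finite V" "B \<subseteq> V"
  shows "(\<Sum>S\<in>Pow V. bern_weight V p S * of_bool (B \<inter> S = {})) = (1 - p) ^ card B"
proof -
  have "(\<Prod>i\<in>V. if i \<in> S then of_bool (i \<notin> B) else 1) = (of_bool (B \<inter> S = {}) :: real)" for S
  proof (cases "B \<inter> S = {}")
    case True
    then show ?thesis by (auto intro!: prod.neutral)
  next
    case False
    then show ?thesis using assms by (auto intro!: prod_zero)
  qed
  moreover have "(\<Prod>i\<in>V. p * of_bool (i \<notin> B) + (1 - p) * 1) = (1 - p) ^ card B"
  proof -
    have "(\<Prod>i\<in>V. p * of_bool (i \<notin> B) + (1 - p) * 1) = (\<Prod>i\<in>B. 1 - p)"
      using assms by (intro prod.mono_neutral_cong_right) auto
    then show ?thesis by simp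
  qed
  ultimately show ?thesis
    using sum_bern_weight_prod[OF assms(1), of p "\<lambda>i. of_bool (i \<notin> B)" "\<lambda>_. 1"] by simp
qed

lemma permutes_Pow_bij:
  assumes "q permutes V"
  shows "bij_betw ((`) q) (Pow V) (Pow V)"
  using permutes_imp_bij[OF assms] by (rule bij_betw_Pow)

lemma bern_weight_image:
  assumes "q permutes V"
  shows "bern_weight V p (q ` S) = bern_weight V p S"
proof -
  have inj: "inj q"
    by (rule permutes_inj[OF assms])
  have "V - q ` S = q ` (V - S)"
    by (simp add: image_set_diff[OF inj] permutes_image[OF assms])
  then show ?thesis
    using inj by (simp add: bern_weight_def card_image inj_on_subset[OF inj])
qed

definition cube_mean :: "'a set \<Rightarrow> ('a set \<Rightarrow> real) \<Rightarrow> real" where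
  "cube_mean V h = (\<Sum>S\<in>Pow V. h S) / 2 ^ card V"

lemma bern_weight_half:
  assumes "finite V" "S \<subseteq> V"
  shows "bern_weight V (1/2) S = 1 / 2 ^ card V"
proof -
  have "card S + card (V - S) = card V"
    using assms by (simp add: card_Diff_subset card_mono finite_subset)
  then have "(1/2::real) ^ card S * (1/2) ^ card (V - S) = (1/2) ^ card V"
    by (metis power_add)
  then show ?thesis
    by (simp add: bern_weight_def power_one_over)
qed

lemma cube_mean_eq_bern:
  assumes "finite V"
  shows "cube_mean V h = (\<Sum>S\<in>Pow V. bern_weight V (1/2) S * h S)"
  by (simp add: cube_mean_def bern_weight_half[OF assms] sum_divide_distrib)

lemma cube_mean_image:
  assumes "q permutes V"
  shows "cube_mean V (\<lambda>S. h (q ` S)) = cube_mean V h"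
  using sum.reindex_bij_betw[OF permutes_Pow_bij[OF assms], of h] by (simp add: cube_mean_def)

lemma cube_mean_mono: "(\<And>S. S \<subseteq> V \<Longrightarrow> g S \<le> h S) \<Longrightarrow> cube_mean V g \<le> cube_mean V h"
  unfolding cube_mean_def by (intro divide_right_mono sum_mono) auto

lemma cube_mean_add: "cube_mean V (\<lambda>S. g S + h S) = cube_mean V g + cube_mean V h"
  by (simp add: cube_mean_def sum.distrib add_divide_distrib)

lemma cube_mean_sum: "cube_mean V (\<lambda>S. \<Sum>i\<in>I. h i S) = (\<Sum>i\<in>I. cube_mean V (h i))"
  by (simp add: cube_mean_def sum_divide_distrib sum.swap[of _ I])

lemma cube_mean_const: "finite V \<Longrightarrow> cube_mean V (\<lambda>S. c) = c"
  by (simp add: cube_mean_def card_Pow)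

text \<open>Switching \<open>y\<close> is an involution of the cube that reverses the sign of
  \<open>h\<close>. It serves for products of spins in which one site occurs exactly once.\<close>

lemma cube_mean_flip:
  assumes y: "y \<in> V" and h: "\<And>S. S \<subseteq> V \<Longrightarrow> y \<notin> S \<Longrightarrow> h (insert y S) = - h S"
  shows "cube_mean V h = 0"
proof -
  define \<phi> where "\<phi> S = (if y \<in> S then S - {y} else insert y S)" for S
  have bij: "bij_betw \<phi> (Pow V) (Pow V)"
    by (rule bij_betwI[of _ _ _ \<phi>]) (use y in \<open>auto simp: \<phi>_def split: if_splits\<close>)
  have "h (\<phi> S) = - h S" if "S \<in> Pow V" for S
  proof (cases "y \<in> S")
    case True
    then show ?thesis
      using h[of "S - {y}"] that subset_trans[OF Diff_subset, of S V "{y}"]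
      by (simp add: \<phi>_def insert_absorb)
  next
    case False
    then show ?thesis
      using h[of S] that by (auto simp: \<phi>_def)
  qed
  then have "(\<Sum>S\<in>Pow V. h S) = (\<Sum>S\<in>Pow V. - h S)"
    using sum.reindex_bij_betw[OF bij, of h] by simp
  then show ?thesis
    by (simp add: cube_mean_def sum_negf)
qed

lemma cube_mean_card:
  assumes "finite V"
  shows "cube_mean V (\<lambda>S. g (card S)) = (\<Sum>k\<le>card V. real (card V choose k) * g k) / 2 ^ card V"
proof -
  have "(\<Sum>S\<in>Pow V. g (card S)) = (\<Sum>k\<le>card V. \<Sum>S\<in>{S\<in>Pow V. card S = k}. g (card S))"
    using assms by (intro sum.group[symmetric]) (auto intro: card_mono)
  also have "\<dots> = (\<Sum>k\<le>card V. real (card V choose k) * g k)"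
  proof (rule sum.cong[OF refl])
    fix k
    have "(\<Sum>S\<in>{S\<in>Pow V. card S = k}. g (card S)) = (\<Sum>S\<in>{S\<in>Pow V. card S = k}. g k)"
      by (intro sum.cong) auto
    also have "\<dots> = real (card V choose k) * g k"
      using n_subsets[OF assms, of k] by (simp add: Pow_def)
    finally show "(\<Sum>S\<in>{S\<in>Pow V. card S = k}. g (card S)) = real (card V choose k) * g k" .
  qed
  finally show ?thesis
    by (simp add: cube_mean_def)
qed

section \<open>Fluctuations of the level\<close>

text \<open>Consecutive central coefficients have ratio \<open>2 * (2 * m + 1) / (m + 1)\<close>.
  The induction closes because of the \<open>2 * m + 1\<close> under the root, through
  \<open>(2 * m + 1) * (2 * m + 3) \<le> (2 * m + 2)\<^sup>2\<close>.\<close>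

lemma central_binomial_upper_bound: "real ((2 * m) choose m) \<le> 4 ^ m / sqrt (2 * real m + 1)"
proof (induction m)
  case 0
  then show ?case by simp
next
  case (Suc m)
  have "Suc m * ((2 * Suc m) choose Suc m) = 2 * Suc m * ((2 * m + 1) choose m)"
    using Suc_times_binomial[of m "2 * m + 1"] by simp
  then have "(2 * Suc m) choose Suc m = 2 * ((2 * m + 1) choose m)"
    by (metis mult.assoc mult.left_commute mult_cancel_left nat.distinct(1))
  moreover have "Suc m * ((2 * m + 1) choose m) = (2 * m + 1) * ((2 * m) choose m)"
  proof -
    have "(2 * m + 1) choose m = (2 * m + 1) choose Suc m"
      using binomial_symmetric[of m "2 * m + 1"] by simp
    then show ?thesis
      using Suc_times_binomial[of m "2 * m"] by simp
  qed
  ultimately have "Suc m * ((2 * Suc m) choose Suc m) = 2 * ((2 * m + 1) * ((2 * m) choose m))"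
    by (metis mult.left_commute)
  then have "real (Suc m) * real ((2 * Suc m) choose Suc m)
      = 2 * ((2 * real m + 1) * real ((2 * m) choose m))"
    by (metis (mono_tags, opaque_lifting) of_nat_1 of_nat_add of_nat_mult of_nat_numeral)
  also have "\<dots> \<le> 2 * ((2 * real m + 1) * (4 ^ m / sqrt (2 * real m + 1)))"
    by (intro mult_left_mono Suc.IH) auto
  also have "\<dots> = 2 * 4 ^ m * sqrt (2 * real m + 1)"
    using real_div_sqrt[of "2 * real m + 1"] by (simp add: field_simps)
  also have "\<dots> \<le> 2 * 4 ^ m * ((2 * real m + 2) / sqrt (2 * real m + 3))"
  proof (intro mult_left_mono)
    have "sqrt (2 * real m + 1) * sqrt (2 * real m + 3) \<le> sqrt ((2 * real m + 2)\<^sup>2)"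
      unfolding real_sqrt_mult[symmetric]
      by (rule real_sqrt_le_mono) (simp add: power2_eq_square algebra_simps)
    then show "sqrt (2 * real m + 1) \<le> (2 * real m + 2) / sqrt (2 * real m + 3)"
      by (simp add: pos_le_divide_eq)
  qed auto
  also have "\<dots> = real (Suc m) * (4 ^ Suc m / sqrt (2 * real (Suc m) + 1))"
    by (simp add: field_simps)
  finally show ?case
    by (rule mult_left_le_imp_le) simp
qed

lemma binomial_le_two_power_div_sqrt:
  assumes "n > 0"
  shows "real (n choose k) \<le> 2 ^ n / sqrt (real n)"
proof -
  have *: "real (n choose k) \<le> real (n choose (n div 2))"
    using binomial_maximum[of n k] by simp
  show ?thesis
  proof (cases "even n")
    case True
    then obtain m where n: "n = 2 * m" by (rule evenE)
    have "real (n choose (n div 2)) \<le> 4 ^ m / sqrt (2 * real m + 1)"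
      using central_binomial_upper_bound[of m] by (simp add: n)
    also have "\<dots> \<le> 4 ^ m / sqrt (real n)"
      using assms by (intro divide_left_mono) (auto simp: n)
    finally show ?thesis
      using * by (simp add: n power_mult)
  next
    case False
    then obtain m where n: "n = 2 * m + 1" by (rule oddE)
    \<comment> \<open>A middle coefficient of an odd row is half of the central one in the next
      row.\<close>
    have "Suc m * ((2 * Suc m) choose Suc m) = 2 * Suc m * ((2 * m + 1) choose m)"
      using Suc_times_binomial[of m "2 * m + 1"] by simp
    then have "(2 * Suc m) choose Suc m = 2 * ((2 * m + 1) choose m)"
      by (metis mult.assoc mult.left_commute mult_cancel_left nat.distinct(1))
    then have "2 * real (n choose (n div 2)) = real ((2 * Suc m) choose Suc m)"
      by (simp add: n)
    also have "\<dots> \<le> 4 ^ Suc m / sqrt (2 * real (Suc m) + 1)"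
      by (rule central_binomial_upper_bound)
    also have "\<dots> \<le> 4 ^ Suc m / sqrt (real n)"
      using assms by (intro divide_left_mono) (auto simp: n)
    also have "\<dots> = 2 * (2 ^ n / sqrt (real n))"
      by (simp add: n power_mult)
    finally show ?thesis
      using * by linarith
  qed
qed

lemma sum_shift_up_le:
  fixes g :: "nat \<Rightarrow> real"
  assumes "\<And>k. 0 \<le> g k" "\<And>k. g k \<le> 1"
  shows "(\<Sum>k\<le>n. g (k + m) - g k) \<le> real m"
proof (induction m)
  case (Suc m)
  have "(\<Sum>k\<le>n. g (k + Suc m) - g k) = (\<Sum>k\<le>n. g (k + m) - g k) + (\<Sum>k\<le>n. g (Suc k + m) - g (k + m))"
    by (simp add: sum.distrib[symmetric])
  also have "(\<Sum>k\<le>n. g (Suc k + m) - g (k + m)) = g (Suc n + m) - g m"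
    using sum_telescope[of "\<lambda>k. - g (k + m)" n] by simp
  finally show ?case
    using Suc.IH assms(1)[of m] assms(2)[of "Suc n + m"] by simp
qed simp

lemma sum_shift_down_le:
  fixes g :: "nat \<Rightarrow> real"
  assumes "\<And>k. 0 \<le> g k" "\<And>k. g k \<le> 1"
  shows "(\<Sum>k\<le>n. g k - g (k - m)) \<le> real m"
proof (induction m)
  case (Suc m)
  have "(\<Sum>k\<le>n. g k - g (k - Suc m)) = (\<Sum>k\<le>n. g k - g (k - m)) + (\<Sum>k\<le>n. g (k - m) - g (k - Suc m))"
    by (simp add: sum.distrib[symmetric])
  \<comment> \<open>For \<open>k \<le> m\<close> both arguments are truncated to 0 and the summand
    vanishes, so the sum telescopes down to \<open>g 0\<close>.\<close>
  also have "(\<Sum>k\<le>n. g (k - m) - g (k - Suc m)) = g (n - m) - g 0"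
  proof (induction n)
    case (Suc n)
    then show ?case by simp
  qed simp
  finally show ?case
    using Suc.IH assms(1)[of 0] assms(2)[of "n - m"] by simp
qed simp

text \<open>Monotonicity makes every gap nonnegative, so each binomial weight may be replaced by its
  bound \<open>1 / sqrt n\<close>. The unweighted sum telescopes, and as \<open>g\<close> stays in
  [0, 1] each of the two shifts costs at most \<open>m\<close>.\<close>

lemma level_gap_mean_le:
  assumes V: "finite V" "card V > 0" and g: "mono g" "\<And>k. 0 \<le> g k" "\<And>k. g k \<le> (1::real)"
  shows "cube_mean V (\<lambda>S. g (card S + m) - g (card S - m)) \<le> 2 * real m / sqrt (card V)"
proof -
  let ?n = "card V"
  have "cube_mean V (\<lambda>S. g (card S + m) - g (card S - m))
      = (\<Sum>k\<le>?n. real (?n choose k) / 2 ^ ?n * (g (k + m) - g (k - m)))"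
    using cube_mean_card[OF V(1), of "\<lambda>k. g (k + m) - g (k - m)"]
    by (simp add: sum_divide_distrib)
  also have "\<dots> \<le> (\<Sum>k\<le>?n. 1 / sqrt ?n * (g (k + m) - g (k - m)))"
  proof (intro sum_mono mult_right_mono)
    fix k
    show "real (?n choose k) / 2 ^ ?n \<le> 1 / sqrt ?n"
      using binomial_le_two_power_div_sqrt[OF V(2), of k] by (simp add: divide_le_eq)
    have "g (k - m) \<le> g (k + m)"
      using g(1) by (rule monoD) simp
    then show "0 \<le> g (k + m) - g (k - m)" by simp
  qed
  also have "\<dots> = 1 / sqrt ?n * ((\<Sum>k\<le>?n. g (k + m) - g k) + (\<Sum>k\<le>?n. g k - g (k - m)))"
    by (simp add: sum_distrib_left[symmetric] sum.distrib[symmetric] sum_divide_distrib[symmetric])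
  also have "\<dots> \<le> 1 / sqrt ?n * (real m + real m)"
    by (intro mult_left_mono add_mono sum_shift_up_le sum_shift_down_le g) auto
  finally show ?thesis by (simp add: field_simps)
qed

lemma weighted_chebyshev:
  fixes w X :: "'b \<Rightarrow> real"
  assumes w: "\<And>\<omega>. \<omega> \<in> \<Omega> \<Longrightarrow> 0 \<le> w \<omega>" and l: "l > 0"
  shows "(\<Sum>\<omega>\<in>\<Omega>. w \<omega> * of_bool (l \<le> \<bar>X \<omega>\<bar>)) \<le> (\<Sum>\<omega>\<in>\<Omega>. w \<omega> * (X \<omega>)\<^sup>2) / l\<^sup>2"
proof -
  have "w \<omega> * of_bool (l \<le> \<bar>X \<omega>\<bar>) \<le> w \<omega> * ((X \<omega>)\<^sup>2 / l\<^sup>2)" if "\<omega> \<in> \<Omega>" for \<omega>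
  proof (intro mult_left_mono w that)
    show "of_bool (l \<le> \<bar>X \<omega>\<bar>) \<le> (X \<omega>)\<^sup>2 / l\<^sup>2"
    proof (cases "l \<le> \<bar>X \<omega>\<bar>")
      case True
      then have "l\<^sup>2 \<le> (X \<omega>)\<^sup>2"
        using l by (metis abs_le_square_iff abs_of_pos)
      then show ?thesis using l by simp
    qed simp
  qed
  then have "(\<Sum>\<omega>\<in>\<Omega>. w \<omega> * of_bool (l \<le> \<bar>X \<omega>\<bar>)) \<le> (\<Sum>\<omega>\<in>\<Omega>. w \<omega> * ((X \<omega>)\<^sup>2 / l\<^sup>2))"
    by (rule sum_mono)
  then show ?thesis
    by (simp add: sum_divide_distrib)
qed

text \<open>The hypotheses describe pairwise uncorrelated variables with the moments of an
  indicator, so only the diagonal covariances \<open>m - m\<^sup>2\<close> survive.\<close>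

lemma weighted_second_moment:
  fixes w :: "'b \<Rightarrow> real" and x :: "'i \<Rightarrow> 'b \<Rightarrow> real" and m :: real
  assumes I: "finite I" and tot: "(\<Sum>\<omega>\<in>\<Omega>. w \<omega>) = 1"
    and one: "\<And>i. i \<in> I \<Longrightarrow> (\<Sum>\<omega>\<in>\<Omega>. w \<omega> * x i \<omega>) = m"
    and sq: "\<And>i. i \<in> I \<Longrightarrow> (\<Sum>\<omega>\<in>\<Omega>. w \<omega> * (x i \<omega> * x i \<omega>)) = m"
    and two: "\<And>i j. i \<in> I \<Longrightarrow> j \<in> I \<Longrightarrow> i \<noteq> j \<Longrightarrow> (\<Sum>\<omega>\<in>\<Omega>. w \<omega> * (x i \<omega> * x j \<omega>)) = m\<^sup>2"
  shows "(\<Sum>\<omega>\<in>\<Omega>. w \<omega> * ((\<Sum>i\<in>I. x i \<omega>) - card I * m)\<^sup>2) \<le> card I * m"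
proof -
  have cov: "(\<Sum>\<omega>\<in>\<Omega>. w \<omega> * ((x i \<omega> - m) * (x j \<omega> - m))) = (if i = j then m - m\<^sup>2 else 0)"
    if "i \<in> I" "j \<in> I" for i j
  proof -
    have "(\<Sum>\<omega>\<in>\<Omega>. w \<omega> * ((x i \<omega> - m) * (x j \<omega> - m)))
        = (\<Sum>\<omega>\<in>\<Omega>. w \<omega> * (x i \<omega> * x j \<omega>) - m * (w \<omega> * x i \<omega>) - m * (w \<omega> * x j \<omega>) + m\<^sup>2 * w \<omega>)"
      by (intro sum.cong) (auto simp: algebra_simps power2_eq_square)
    also have "\<dots> = (\<Sum>\<omega>\<in>\<Omega>. w \<omega> * (x i \<omega> * x j \<omega>)) - m * m - m * m + m\<^sup>2"
      by (simp only: sum.distrib sum_subtractf sum_distrib_left[symmetric] one that tot mult_1_right)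
    also have "\<dots> = (if i = j then m - m\<^sup>2 else 0)"
      using that by (auto simp: sq two power2_eq_square)
    finally show ?thesis .
  qed
  have "((\<Sum>i\<in>I. x i \<omega>) - card I * m)\<^sup>2 = (\<Sum>i\<in>I. \<Sum>j\<in>I. (x i \<omega> - m) * (x j \<omega> - m))" for \<omega>
    by (simp add: power2_eq_square sum_product[symmetric] sum_subtractf)
  then have "(\<Sum>\<omega>\<in>\<Omega>. w \<omega> * ((\<Sum>i\<in>I. x i \<omega>) - card I * m)\<^sup>2)
      = (\<Sum>\<omega>\<in>\<Omega>. \<Sum>i\<in>I. \<Sum>j\<in>I. w \<omega> * ((x i \<omega> - m) * (x j \<omega> - m)))"
    by (simp add: sum_distrib_left)
  also have "\<dots> = (\<Sum>i\<in>I. \<Sum>\<omega>\<in>\<Omega>. \<Sum>j\<in>I. w \<omega> * ((x i \<omega> - m) * (x j \<omega> - m)))"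
    by (rule sum.swap)
  also have "\<dots> = (\<Sum>i\<in>I. \<Sum>j\<in>I. \<Sum>\<omega>\<in>\<Omega>. w \<omega> * ((x i \<omega> - m) * (x j \<omega> - m)))"
    by (intro sum.cong refl sum.swap)
  also have "\<dots> = (\<Sum>i\<in>I. \<Sum>j\<in>I. if i = j then m - m\<^sup>2 else 0)"
    by (intro sum.cong refl cov)
  also have "\<dots> = card I * (m - m\<^sup>2)"
    using I by simp
  also have "\<dots> \<le> card I * m"
    by (intro mult_left_mono) auto
  finally show ?thesis .
qed

section \<open>The noise bound\<close>

text \<open>A triple \<open>(S, R, U)\<close> consists of the initial configuration, the set of resampled sites and the
  fresh configuration.\<close>

definition noise_space :: "'a set \<Rightarrow> ('a set \<times> 'a set \<times> 'a set) set" where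
  "noise_space V = Pow V \<times> Pow V \<times> Pow V"

definition noise_weight :: "'a set \<Rightarrow> real \<Rightarrow> 'a set \<times> 'a set \<times> 'a set \<Rightarrow> real" where
  "noise_weight V \<epsilon> = (\<lambda>(S, R, U). bern_weight V (1/2) S * (bern_weight V \<epsilon> R * bern_weight V (1/2) U))"

definition noisy :: "'a set \<times> 'a set \<times> 'a set \<Rightarrow> 'a set" where
  "noisy = (\<lambda>(S, R, U). (S - R) \<union> (U \<inter> R))"

definition noise_disagree :: "'a set \<Rightarrow> real \<Rightarrow> ('a set \<Rightarrow> bool) \<Rightarrow> real" where
  "noise_disagree V \<epsilon> F =
     (\<Sum>\<omega>\<in>noise_space V. noise_weight V \<epsilon> \<omega> * of_bool (F (fst \<omega>) \<noteq> F (noisy \<omega>)))"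

lemma noise_weight_nonneg: "0 \<le> \<epsilon> \<Longrightarrow> \<epsilon> \<le> 1 \<Longrightarrow> 0 \<le> noise_weight V \<epsilon> \<omega>"
  by (cases \<omega>) (simp add: noise_weight_def bern_weight_nonneg)

lemma sum_noise_factor:
  "(\<Sum>\<omega>\<in>noise_space V. noise_weight V \<epsilon> \<omega> * (case \<omega> of (S, R, U) \<Rightarrow> a S * (b R * c U)))
    = (\<Sum>S\<in>Pow V. bern_weight V (1/2) S * a S) *
      ((\<Sum>R\<in>Pow V. bern_weight V \<epsilon> R * b R) * (\<Sum>U\<in>Pow V. bern_weight V (1/2) U * c U))"
  unfolding noise_space_def sum_product sum.cartesian_product
  by (intro sum.cong) (auto simp: noise_weight_def ac_simps)

lemma sum_noise_fst:
  assumes "finite V"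
  shows "(\<Sum>\<omega>\<in>noise_space V. noise_weight V \<epsilon> \<omega> * h (fst \<omega>)) = cube_mean V h"
  using sum_noise_factor[of V \<epsilon> h "\<lambda>_. 1" "\<lambda>_. 1"]
  by (simp add: sum_bern_weight[OF assms] cube_mean_eq_bern[OF assms] case_prod_beta)

lemma sum_noise_weight:
  assumes "finite V"
  shows "(\<Sum>\<omega>\<in>noise_space V. noise_weight V \<epsilon> \<omega>) = 1"
  using sum_noise_fst[OF assms, of \<epsilon> "\<lambda>_. 1"] cube_mean_const[OF assms] by simp

lemma noise_disagree_image:
  assumes "finite V" "q permutes V"
  shows "noise_disagree V \<epsilon> (\<lambda>S. F (q ` S)) = noise_disagree V \<epsilon> F"
proof -
  let ?q = "map_prod ((`) q) (map_prod ((`) q) ((`) q))"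
  have inj: "inj q"
    by (rule permutes_inj[OF assms(2)])
  have b: "bij_betw ((`) q) (Pow V) (Pow V)"
    by (rule permutes_Pow_bij[OF assms(2)])
  have bij: "bij_betw ?q (noise_space V) (noise_space V)"
    unfolding noise_space_def by (intro bij_betw_map_prod b)
  have w: "noise_weight V \<epsilon> (?q \<omega>) = noise_weight V \<epsilon> \<omega>" for \<omega>
    by (cases \<omega>) (simp add: noise_weight_def bern_weight_image[OF assms(2)])
  have n: "noisy (?q \<omega>) = q ` noisy \<omega>" "fst (?q \<omega>) = q ` fst \<omega>" for \<omega>
    by (cases \<omega>; simp add: noisy_def image_Un image_set_diff[OF inj] image_Int[OF inj])+
  show ?thesis
    using sum.reindex_bij_betw[OF bij,
        of "\<lambda>\<omega>. noise_weight V \<epsilon> \<omega> * of_bool (F (fst \<omega>) \<noteq> F (noisy \<omega>))"]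
    unfolding noise_disagree_def w n by simp
qed

text \<open>Composing \<open>F\<close> with a permutation does not change the left side, since the
  noise law is invariant; summing over all permutations and exchanging the sums gives the right
  side.\<close>

lemma noise_disagree_eq_perm_dist:
  assumes "finite V"
  shows "noise_disagree V \<epsilon> F =
    (\<Sum>\<omega>\<in>noise_space V. noise_weight V \<epsilon> \<omega> * perm_dist V F (fst \<omega>) (noisy \<omega>))"
proof -
  let ?P = "{p. p permutes V}"
  have fin: "finite ?P"
    using finite_permutations[OF assms] .
  have "fact (card V) * noise_disagree V \<epsilon> F = (\<Sum>p\<in>?P. noise_disagree V \<epsilon> (\<lambda>S. F (p ` S)))"
    using card_permutations[OF refl assms] by (simp add: noise_disagree_image[OF assms])
  also have "\<dots> = (\<Sum>\<omega>\<in>noise_space V. noise_weight V \<epsilon> \<omega>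
      * (\<Sum>p\<in>?P. of_bool (F (p ` fst \<omega>) \<noteq> F (p ` noisy \<omega>))))"
    unfolding noise_disagree_def by (subst sum.swap) (simp add: sum_distrib_left)
  also have "\<dots> = (\<Sum>\<omega>\<in>noise_space V. noise_weight V \<epsilon> \<omega>
      * (fact (card V) * perm_dist V F (fst \<omega>) (noisy \<omega>)))"
    using fin by (simp add: perm_dist_def Collect_conj_eq)
  also have "\<dots> = fact (card V) *
      (\<Sum>\<omega>\<in>noise_space V. noise_weight V \<epsilon> \<omega> * perm_dist V F (fst \<omega>) (noisy \<omega>))"
    by (simp add: sum_distrib_left ac_simps)
  finally show ?thesis
    by simp
qed

text \<open>The flags \<open>s\<close> and \<open>u\<close> treat the sites switched on
  (\<open>False\<close>, \<open>True\<close>) and off (\<open>True\<close>, \<open>False\<close>)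
  together. A site is counted with probability \<open>1/2 * \<epsilon> * 1/2\<close>, independently
  of the others.\<close>

lemma noise_count_chebyshev:
  assumes V: "finite V" and e: "0 \<le> \<epsilon>" "\<epsilon> \<le> 1" and l: "l > 0"
  shows "(\<Sum>\<omega>\<in>noise_space V. noise_weight V \<epsilon> \<omega> * of_bool (l \<le> \<bar>real (card {i\<in>V.
      (i \<in> fst \<omega>) = s \<and> i \<in> fst (snd \<omega>) \<and> (i \<in> snd (snd \<omega>)) = u}) - card V * (\<epsilon> / 4)\<bar>))
    \<le> card V * (\<epsilon> / 4) / l\<^sup>2"
proof -
  define x :: "'a \<Rightarrow> 'a set \<times> 'a set \<times> 'a set \<Rightarrow> real" where
    "x i \<omega> = of_bool ((i \<in> fst \<omega>) = s \<and> i \<in> fst (snd \<omega>) \<and> (i \<in> snd (snd \<omega>)) = u)" for i \<omega>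
  have half: "(\<Sum>S\<in>Pow V. bern_weight V (1/2) S * of_bool (\<forall>i\<in>B. (i \<in> S) = v)) = (1/2) ^ card B"
    if "B \<subseteq> V" for B v
  proof (cases v)
    case True
    then show ?thesis
      using sum_bern_weight_superset[OF V that, of "1/2"] by (simp add: subset_eq)
  next
    case False
    have "(B \<inter> S = {}) = (\<forall>i\<in>B. (i \<in> S) = False)" for S
      by auto
    then show ?thesis
      using sum_bern_weight_disjoint[OF V that, of "1/2"] False by simp
  qed
  \<comment> \<open>The exponent \<open>card {i, j}\<close> covers the diagonal and the off-diagonal
    case at once.\<close>
  have joint: "(\<Sum>\<omega>\<in>noise_space V. noise_weight V \<epsilon> \<omega> * (x i \<omega> * x j \<omega>)) = (\<epsilon> / 4) ^ card {i, j}"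
    if "i \<in> V" "j \<in> V" for i j
  proof -
    have sub: "{i, j} \<subseteq> V"
      using that by simp
    have "x i \<omega> * x j \<omega> = (case \<omega> of (S, R, U) \<Rightarrow> of_bool (\<forall>k\<in>{i,j}. (k \<in> S) = s)
        * (of_bool ({i,j} \<subseteq> R) * of_bool (\<forall>k\<in>{i,j}. (k \<in> U) = u)))" for \<omega>
      by (cases \<omega>) (auto simp: x_def)
    then have "(\<Sum>\<omega>\<in>noise_space V. noise_weight V \<epsilon> \<omega> * (x i \<omega> * x j \<omega>))
        = (1/2) ^ card {i, j} * (\<epsilon> ^ card {i, j} * (1/2) ^ card {i, j})"
      using sum_noise_factor[of V \<epsilon> "\<lambda>S. of_bool (\<forall>k\<in>{i,j}. (k \<in> S) = s)"
          "\<lambda>R. of_bool ({i,j} \<subseteq> R)" "\<lambda>U. of_bool (\<forall>k\<in>{i,j}. (k \<in> U) = u)"]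
      by (simp only: half[OF sub] sum_bern_weight_superset[OF V sub])
    also have "\<dots> = (1/2 * (\<epsilon> * (1/2))) ^ card {i, j}"
      by (simp only: power_mult_distrib)
    finally show ?thesis by simp
  qed
  have diag: "x i \<omega> * x i \<omega> = x i \<omega>" for i \<omega>
    by (auto simp: x_def)
  have one: "(\<Sum>\<omega>\<in>noise_space V. noise_weight V \<epsilon> \<omega> * x i \<omega>) = \<epsilon> / 4" if "i \<in> V" for i
    using joint[OF that that] by (simp add: diag)
  have "(\<Sum>i\<in>V. x i \<omega>)
      = card {i\<in>V. (i \<in> fst \<omega>) = s \<and> i \<in> fst (snd \<omega>) \<and> (i \<in> snd (snd \<omega>)) = u}" for \<omega>
    using V by (simp add: x_def Int_def)
  then have "(\<Sum>\<omega>\<in>noise_space V. noise_weight V \<epsilon> \<omega> * of_bool (l \<le> \<bar>real (card {i\<in>V.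
      (i \<in> fst \<omega>) = s \<and> i \<in> fst (snd \<omega>) \<and> (i \<in> snd (snd \<omega>)) = u}) - card V * (\<epsilon> / 4)\<bar>))
    = (\<Sum>\<omega>\<in>noise_space V. noise_weight V \<epsilon> \<omega> * of_bool (l \<le> \<bar>(\<Sum>i\<in>V. x i \<omega>) - card V * (\<epsilon> / 4)\<bar>))"
    by simp
  also have "\<dots> \<le> (\<Sum>\<omega>\<in>noise_space V. noise_weight V \<epsilon> \<omega> * ((\<Sum>i\<in>V. x i \<omega>) - card V * (\<epsilon> / 4))\<^sup>2) / l\<^sup>2"
    by (rule weighted_chebyshev[OF noise_weight_nonneg[OF e] l])
  also have "\<dots> \<le> card V * (\<epsilon> / 4) / l\<^sup>2"
  proof (intro divide_right_mono weighted_second_moment[OF V sum_noise_weight[OF V]])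
    show "(\<Sum>\<omega>\<in>noise_space V. noise_weight V \<epsilon> \<omega> * (x i \<omega> * x j \<omega>)) = (\<epsilon> / 4)\<^sup>2"
      if "i \<in> V" "j \<in> V" "i \<noteq> j" for i j
      using joint[OF that(1,2)] that(3) by (simp add: power2_eq_square)
  qed (simp_all only: one diag zero_le_power2)
  finally show ?thesis .
qed

text \<open>Along a cycle of \<open>\<kappa>\<close> the switches are dependent, so the count is
  expressed by the spin products \<open>\<sigma> S x * \<sigma> S (\<rho> x)\<close>. The products
  at \<open>x\<close> and \<open>y\<close> are uncorrelated unless \<open>y\<close> is
  \<open>x\<close> or \<open>\<rho> x\<close>, so their sum has second moment at most twice the
  number of moved points. The factor 1/4 in the count turns 2 into 1/8.\<close>

lemma perm_count_chebyshev:
  assumes V: "finite V" and k: "\<kappa> permutes V" and l: "l > 0"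
  shows "cube_mean V (\<lambda>S. of_bool (l \<le> \<bar>real (card (S - \<kappa> ` S)) - real (card {x. \<kappa> x \<noteq> x}) / 4\<bar>))
    \<le> real (card {x. \<kappa> x \<noteq> x}) / (8 * l\<^sup>2)"
proof -
  define \<rho> where "\<rho> = inv \<kappa>"
  define M where "M = {x. \<kappa> x \<noteq> x}"
  define \<sigma> :: "'a set \<Rightarrow> 'a \<Rightarrow> real" where "\<sigma> S x = (if x \<in> S then -1 else 1)" for S x
  have rho: "\<rho> permutes V"
    unfolding \<rho>_def by (rule permutes_inv[OF k])
  have M: "M = {x. \<rho> x \<noteq> x}"
    unfolding M_def \<rho>_def using permutes_inv_eq[OF k] by metis
  have MV: "M \<subseteq> V"
    using k by (auto simp: M_def permutes_def)
  have finM: "finite M"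
    by (rule finite_subset[OF MV V])
  have mem: "x \<in> \<kappa> ` S \<longleftrightarrow> \<rho> x \<in> S" for x S
    unfolding \<rho>_def using permutes_inverses[OF k] by (metis image_iff)
  \<comment> \<open>As \<open>\<kappa>\<close> preserves cardinality, equally many sites are
    switched off and on. The count is thus half the number of disagreeing spins, and
    \<open>(1 - a * b) / 2\<close> indicates disagreement of two spins.\<close>
  have count: "real (card (S - \<kappa> ` S)) - card M / 4 = - (\<Sum>x\<in>M. \<sigma> S x * \<sigma> S (\<rho> x)) / 4"
    if "S \<subseteq> V" for S
  proof -
    have fin: "finite S" "finite (\<kappa> ` S)"
      using that V finite_subset by auto
    have cc: "card (\<kappa> ` S) = card S"
      using permutes_inj_on[OF k] by (rule card_image)
    have "card (S - \<kappa> ` S) = card (\<kappa> ` S - S)"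
      using card_Int_Diff[OF fin(1), of "\<kappa> ` S"] card_Int_Diff[OF fin(2), of S] cc
      by (simp add: Int_commute)
    moreover have "card ((S - \<kappa> ` S) \<union> (\<kappa> ` S - S)) = card (S - \<kappa> ` S) + card (\<kappa> ` S - S)"
      using fin by (intro card_Un_disjoint) auto
    moreover have "(S - \<kappa> ` S) \<union> (\<kappa> ` S - S) = {x\<in>M. \<sigma> S x \<noteq> \<sigma> S (\<rho> x)}"
    proof -
      have "(S - \<kappa> ` S) \<union> (\<kappa> ` S - S) = {x. (x \<in> S) \<noteq> (x \<in> \<kappa> ` S)}"
        by blast
      also have "\<dots> = {x\<in>M. \<sigma> S x \<noteq> \<sigma> S (\<rho> x)}"
        unfolding mem by (auto simp: \<sigma>_def M)
      finally show ?thesis .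
    qed
    ultimately have "2 * real (card (S - \<kappa> ` S)) = card {x\<in>M. \<sigma> S x \<noteq> \<sigma> S (\<rho> x)}"
      by simp
    also have "\<dots> = (\<Sum>x\<in>M. of_bool (\<sigma> S x \<noteq> \<sigma> S (\<rho> x)))"
      using finM by (simp add: Int_def)
    also have "\<dots> = (\<Sum>x\<in>M. (1 - \<sigma> S x * \<sigma> S (\<rho> x)) / 2)"
      by (intro sum.cong) (auto simp: \<sigma>_def)
    also have "\<dots> = (card M - (\<Sum>x\<in>M. \<sigma> S x * \<sigma> S (\<rho> x))) / 2"
      by (simp add: sum_divide_distrib[symmetric] sum_subtractf)
    finally show ?thesis by simp
  qed
  \<comment> \<open>If \<open>y\<close> is neither \<open>x\<close> nor \<open>\<rho> x\<close>, then the spin at \<open>y\<close> occurs exactly once in the product.\<close>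
  have pair: "cube_mean V (\<lambda>S. \<sigma> S x * \<sigma> S (\<rho> x) * (\<sigma> S y * \<sigma> S (\<rho> y))) \<le> of_bool (y \<in> {x, \<rho> x})"
    if "x \<in> M" "y \<in> M" for x y
  proof (cases "y \<in> {x, \<rho> x}")
    case True
    have "cube_mean V (\<lambda>S. \<sigma> S x * \<sigma> S (\<rho> x) * (\<sigma> S y * \<sigma> S (\<rho> y))) \<le> cube_mean V (\<lambda>S. 1)"
      by (rule cube_mean_mono) (auto simp: \<sigma>_def)
    then show ?thesis
      using True by (simp add: cube_mean_const[OF V])
  next
    case False
    have "\<rho> y \<noteq> y"
      using that by (simp add: M)
    then have "cube_mean V (\<lambda>S. \<sigma> S x * \<sigma> S (\<rho> x) * (\<sigma> S y * \<sigma> S (\<rho> y))) = 0"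
      using False that MV by (intro cube_mean_flip[of y]) (auto simp: \<sigma>_def)
    then show ?thesis by simp
  qed
  have "cube_mean V (\<lambda>S. (\<Sum>x\<in>M. \<sigma> S x * \<sigma> S (\<rho> x))\<^sup>2)
      = (\<Sum>x\<in>M. \<Sum>y\<in>M. cube_mean V (\<lambda>S. \<sigma> S x * \<sigma> S (\<rho> x) * (\<sigma> S y * \<sigma> S (\<rho> y))))"
    by (simp add: power2_eq_square sum_product cube_mean_sum)
  also have "\<dots> \<le> (\<Sum>x\<in>M. \<Sum>y\<in>M. of_bool (y \<in> {x, \<rho> x}))"
    by (intro sum_mono pair)
  also have "\<dots> \<le> (\<Sum>x\<in>M. 2)"
  proof (intro sum_mono)
    fix x
    have "card (M \<inter> {x, \<rho> x}) \<le> card {x, \<rho> x}"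
      by (intro card_mono) auto
    also have "\<dots> \<le> 2"
      by (cases "x = \<rho> x") auto
    finally show "(\<Sum>y\<in>M. of_bool (y \<in> {x, \<rho> x})) \<le> (2::real)"
      using finM by (simp add: Int_def del: insert_iff)
  qed
  finally have second: "cube_mean V (\<lambda>S. (\<Sum>x\<in>M. \<sigma> S x * \<sigma> S (\<rho> x))\<^sup>2) \<le> 2 * card M"
    by simp
  have "cube_mean V (\<lambda>S. of_bool (l \<le> \<bar>real (card (S - \<kappa> ` S)) - card M / 4\<bar>))
      = (\<Sum>S\<in>Pow V. (1 / 2 ^ card V) * of_bool (l \<le> \<bar>real (card (S - \<kappa> ` S)) - card M / 4\<bar>))"
    by (simp add: cube_mean_def sum_divide_distrib)
  also have "\<dots> \<le> (\<Sum>S\<in>Pow V. (1 / 2 ^ card V) * (real (card (S - \<kappa> ` S)) - card M / 4)\<^sup>2) / l\<^sup>2"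
    by (rule weighted_chebyshev[OF _ l]) simp
  also have "(\<Sum>S\<in>Pow V. (1 / 2 ^ card V) * (real (card (S - \<kappa> ` S)) - card M / 4)\<^sup>2)
      = (\<Sum>S\<in>Pow V. (1 / 2 ^ card V) * ((\<Sum>x\<in>M. \<sigma> S x * \<sigma> S (\<rho> x))\<^sup>2 / 16))"
    by (intro sum.cong refl) (simp add: count power_divide)
  also have "\<dots> = cube_mean V (\<lambda>S. (\<Sum>x\<in>M. \<sigma> S x * \<sigma> S (\<rho> x))\<^sup>2) / 16"
    by (simp add: cube_mean_def sum_divide_distrib ac_simps)
  also have "\<dots> / l\<^sup>2 \<le> 2 * card M / 16 / l\<^sup>2"
    by (intro divide_right_mono second) auto
  finally show ?thesis
    by (simp add: M_def field_simps)
qed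

lemma noise_disagree_le:
  fixes \<epsilon> l :: real and L :: nat
  assumes V: "finite V" "card V > 0" and F: "mono_on_subsets V F" and k: "\<kappa> permutes V"
    and e: "0 \<le> \<epsilon>" "\<epsilon> \<le> 1" and l: "l > 0" and L: "2 * l + 1 \<le> real L"
    and close: "\<bar>real (card {x. \<kappa> x \<noteq> x}) / 4 - card V * (\<epsilon> / 4)\<bar> \<le> 1"
  shows "noise_disagree V \<epsilon> F \<le> cube_mean V (\<lambda>S. perm_dist V F S (\<kappa> ` S))
    + 4 * real L / sqrt (card V) + real (card {x. \<kappa> x \<noteq> x}) / (8 * l\<^sup>2) + card V * \<epsilon> / (2 * l\<^sup>2)"
proof -
  let ?M = "real (card {x. \<kappa> x \<noteq> x})"
  let ?g = "level_mean V F"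
  let ?c = "card V * (\<epsilon> / 4)"
  define X :: "bool \<Rightarrow> bool \<Rightarrow> _ \<Rightarrow> real" where "X s u \<omega> = of_bool (l \<le> \<bar>real (card {i\<in>V.
      (i \<in> fst \<omega>) = s \<and> i \<in> fst (snd \<omega>) \<and> (i \<in> snd (snd \<omega>)) = u}) - ?c\<bar>)"
    for s u and \<omega> :: "'a set \<times> 'a set \<times> 'a set"
  define Y :: "'a set \<Rightarrow> real" where "Y S = of_bool (l \<le> \<bar>real (card (S - \<kappa> ` S)) - ?M / 4\<bar>)" for S
  define G where "G S = ?g (card S + 2 * L) - ?g (card S - 2 * L)" for S :: "'a set"
  have gm: "mono ?g"
    by (rule level_mean_mono[OF V(1) F])
  \<comment> \<open>Either one of the three deviations occurs and the trivial bound 1 suffices, or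
    all counts are near their centres and the noisy pair is comparable with the pair given by
    \<open>\<kappa>\<close>.\<close>
  have pt: "perm_dist V F (fst \<omega>) (noisy \<omega>)
      \<le> perm_dist V F (fst \<omega>) (\<kappa> ` fst \<omega>) + G (fst \<omega>) + Y (fst \<omega>) + X False True \<omega> + X True False \<omega>"
    if "\<omega> \<in> noise_space V" for \<omega>
  proof -
    obtain S R U where w: "\<omega> = (S, R, U)" by (cases \<omega>)
    have sub: "S \<subseteq> V" "R \<subseteq> V" "U \<subseteq> V"
      using that by (auto simp: w noise_space_def)
    define T where "T = noisy \<omega>"
    have T: "T = (S - R) \<union> (U \<inter> R)" "T \<subseteq> V"
      using sub by (auto simp: T_def noisy_def w)
    have up: "{i\<in>V. (i \<in> S) = False \<and> i \<in> R \<and> (i \<in> U) = True} = T - S"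
      and down: "{i\<in>V. (i \<in> S) = True \<and> i \<in> R \<and> (i \<in> U) = False} = S - T"
      using sub by (auto simp: T(1))
    have G0: "0 \<le> G S"
      using monoD[OF gm, of "card S - 2 * L" "card S + 2 * L"] by (simp add: G_def)
    have nn: "0 \<le> Y S" "0 \<le> X False True \<omega>" "0 \<le> X True False \<omega>"
      by (simp_all add: X_def Y_def)
    show ?thesis
    proof (cases "Y S = 0 \<and> X False True \<omega> = 0 \<and> X True False \<omega> = 0")
      case False
      then have "1 \<le> Y S + X False True \<omega> + X True False \<omega>"
        using nn by (auto simp: X_def Y_def split: if_splits)
      then show ?thesis
        using perm_dist_le_1[OF V(1), of F S "noisy \<omega>"] perm_dist_nonneg[of V F S "\<kappa> ` S"] G0
        by (simp add: w)
    next
      case True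
      then have b: "\<bar>real (card (S - \<kappa> ` S)) - ?M / 4\<bar> < l" "\<bar>real (card (T - S)) - ?c\<bar> < l"
        "\<bar>real (card (S - T)) - ?c\<bar> < l"
        unfolding X_def Y_def w fst_conv snd_conv up down by (auto simp: not_le)
      have "card (S - \<kappa> ` S) = card (\<kappa> ` S - S)"
      proof -
        have fin: "finite S" "finite (\<kappa> ` S)"
          using finite_subset[OF sub(1) V(1)] by auto
        have "card (\<kappa> ` S) = card S"
          using permutes_inj_on[OF k] by (rule card_image)
        then show ?thesis
          using card_Int_Diff[OF fin(1), of "\<kappa> ` S"] card_Int_Diff[OF fin(2), of S]
          by (simp add: Int_commute)
      qed
      moreover have "\<kappa> ` S \<subseteq> V"
        using sub(1) permutes_image[OF k] by blast
      \<comment> \<open>Two deviations below \<open>l\<close> and a distance of at most 1 between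
        the centres add up to at most \<open>2 * l + 1\<close>.\<close>
      moreover have "real (card (T - S)) \<le> real (card (S - \<kappa> ` S)) + real L"
        "real (card (S - \<kappa> ` S)) \<le> real (card (T - S)) + real L"
        "real (card (S - T)) \<le> real (card (S - \<kappa> ` S)) + real L"
        "real (card (S - \<kappa> ` S)) \<le> real (card (S - T)) + real L"
        using b close L by linarith+
      ultimately have "perm_dist V F S T \<le> perm_dist V F S (\<kappa> ` S) + G S"
        unfolding G_def
        by (intro perm_dist_compare[OF V(1) F sub(1) T(2) sub(1), of _ "card (S - \<kappa> ` S)"]) auto
      then show ?thesis
        using nn by (simp add: w T_def)
    qed
  qed
  have w0: "0 \<le> noise_weight V \<epsilon> \<omega>" for \<omega> :: "'a set \<times> 'a set \<times> 'a set"
    by (rule noise_weight_nonneg[OF e])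
  let ?E = "\<lambda>h. \<Sum>\<omega>\<in>noise_space V. noise_weight V \<epsilon> \<omega> * h \<omega>"
  have "noise_disagree V \<epsilon> F \<le> ?E (\<lambda>\<omega>. perm_dist V F (fst \<omega>) (\<kappa> ` fst \<omega>) + G (fst \<omega>) + Y (fst \<omega>)
      + X False True \<omega> + X True False \<omega>)"
    unfolding noise_disagree_eq_perm_dist[OF V(1)] by (intro sum_mono mult_left_mono pt w0)
  also have "\<dots> = ?E (\<lambda>\<omega>. perm_dist V F (fst \<omega>) (\<kappa> ` fst \<omega>)) + ?E (\<lambda>\<omega>. G (fst \<omega>))
      + ?E (\<lambda>\<omega>. Y (fst \<omega>)) + ?E (X False True) + ?E (X True False)"
    by (simp only: distrib_left sum.distrib)
  also have "\<dots> = cube_mean V (\<lambda>S. perm_dist V F S (\<kappa> ` S)) + cube_mean V G + cube_mean V Y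
      + ?E (X False True) + ?E (X True False)"
    using sum_noise_fst[OF V(1), of \<epsilon> "\<lambda>S. perm_dist V F S (\<kappa> ` S)"]
    by (simp only: sum_noise_fst[OF V(1)])
  also have "\<dots> \<le> cube_mean V (\<lambda>S. perm_dist V F S (\<kappa> ` S)) + 2 * real (2 * L) / sqrt (card V)
      + ?M / (8 * l\<^sup>2) + ?c / l\<^sup>2 + ?c / l\<^sup>2"
  proof (intro add_mono order_refl)
    show "cube_mean V G \<le> 2 * real (2 * L) / sqrt (card V)"
      unfolding G_def
      by (rule level_gap_mean_le[OF V gm]) (simp_all add: level_mean_def perm_mean_nonneg perm_mean_le_1[OF V(1)])
    show "cube_mean V Y \<le> ?M / (8 * l\<^sup>2)"
      unfolding Y_def by (rule perm_count_chebyshev[OF V(1) k l])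
    have X: "?E (X s u) \<le> ?c / l\<^sup>2" for s u
      unfolding X_def by (rule noise_count_chebyshev[OF V(1) e l])
    show "?E (X False True) \<le> ?c / l\<^sup>2" "?E (X True False) \<le> ?c / l\<^sup>2"
      by (rule X)+
  qed
  finally show ?thesis
    by (simp add: algebra_simps)
qed

section \<open>Commutators\<close>

text \<open>Composing with a transposition inserts \<open>a\<close> into the cycle of
  \<open>b\<close>. The induction would pass through a singleton, which has no derangement, so two
  points are treated directly.\<close>

lemma exists_derangement:
  assumes "finite R" "card R \<noteq> 1"
  shows "\<exists>\<rho>. \<rho> permutes R \<and> (\<forall>x\<in>R. \<rho> x \<noteq> x)"
  using assms
proof (induction R rule: finite_induct)
  case empty
  show ?case using permutes_id by blast
next
  case (insert a R)
  then have "R \<noteq> {}" by auto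
  then obtain b where b: "b \<in> R" by blast
  then have ab: "a \<noteq> b"
    using insert.hyps by blast
  show ?case
  proof (cases "card R = 1")
    case True
    then have "R = {b}"
      using b by (metis card_1_singletonE singletonD)
    then show ?thesis
      using ab by (intro exI[of _ "Transposition.transpose a b"]) (auto intro: permutes_swap_id)
  next
    case False
    then obtain \<rho> where \<rho>: "\<rho> permutes R" "\<forall>x\<in>R. \<rho> x \<noteq> x"
      using insert.IH by blast
    have "\<rho> permutes insert a R"
      using \<rho>(1) by (rule permutes_subset) auto
    then have perm: "Transposition.transpose a b \<circ> \<rho> permutes insert a R"
      by (rule permutes_compose[OF _ permutes_swap_id]) (use b in auto)
    have "(Transposition.transpose a b \<circ> \<rho>) x \<noteq> x" if x: "x \<in> insert a R" for x
    proof (cases "x = a")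
      case True
      then show ?thesis
        using permutes_not_in[OF \<rho>(1)] insert.hyps ab by simp
    next
      case False
      then have "\<rho> x \<in> R" "x \<in> R"
        using x permutes_in_image[OF \<rho>(1)] by auto
      then show ?thesis
        using False \<rho>(2) insert.hyps by (auto simp: Transposition.transpose_def)
    qed
    then show ?thesis
      using perm by blast
  qed
qed

text \<open>Take \<open>A\<close> maximal: a moved point outside \<open>A\<close>, its image and its
  preimage could be added. So three sets no larger than \<open>A\<close> cover all moved
  points.\<close>

lemma exists_displaced_subset:
  assumes V: "finite V" and p: "\<pi> permutes V"
  shows "\<exists>A\<subseteq>V. A \<inter> \<pi> ` A = {} \<and> card {x. \<pi> x \<noteq> x} \<le> 3 * card A"
proof -
  define C where "C = {A. A \<subseteq> V \<and> A \<inter> \<pi> ` A = {}}"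
  have "finite C"
    by (rule finite_subset[of _ "Pow V"]) (use V in \<open>auto simp: C_def\<close>)
  moreover have "C \<noteq> {}"
    unfolding C_def by blast
  ultimately obtain A where AC: "A \<in> C" and max: "\<forall>B\<in>C. A \<subseteq> B \<longrightarrow> A = B"
    using finite_has_maximal[of C] by blast
  have A: "A \<subseteq> V" "A \<inter> \<pi> ` A = {}"
    using AC by (auto simp: C_def)
  have finA: "finite A"
    by (rule finite_subset[OF A(1) V])
  have "{x. \<pi> x \<noteq> x} \<subseteq> A \<union> \<pi> ` A \<union> inv \<pi> ` A"
  proof
    fix x assume x: "x \<in> {x. \<pi> x \<noteq> x}"
    then have xV: "x \<in> V"
      using p by (auto simp: permutes_def)
    show "x \<in> A \<union> \<pi> ` A \<union> inv \<pi> ` A"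
    proof (rule ccontr)
      assume c: "x \<notin> A \<union> \<pi> ` A \<union> inv \<pi> ` A"
      have "\<pi> x \<notin> A"
        using c permutes_inverses(2)[OF p, of x] by (metis UnCI image_eqI)
      then have "insert x A \<in> C"
        using A c x xV unfolding C_def by auto
      then show False
        using max c by blast
    qed
  qed
  then have "card {x. \<pi> x \<noteq> x} \<le> card (A \<union> \<pi> ` A \<union> inv \<pi> ` A)"
    using finA by (intro card_mono) auto
  also have "\<dots> \<le> card A + card (\<pi> ` A) + card (inv \<pi> ` A)"
    using card_Un_le[of "A \<union> \<pi> ` A" "inv \<pi> ` A"] card_Un_le[of A "\<pi> ` A"] by linarith
  also have "\<dots> \<le> 3 * card A"
    using card_image_le[OF finA, of \<pi>] card_image_le[OF finA, of "inv \<pi>"] by linarith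
  finally show ?thesis
    using A by blast
qed

text \<open>As \<open>R\<close> is disjoint from its image under \<open>\<pi>\<close>, the
  commutator acts as \<open>inv \<rho>\<close> on \<open>R\<close> and as
  \<open>\<pi> \<circ> \<rho> \<circ> inv \<pi>\<close> on the image: two derangements with disjoint
  supports, whatever \<open>\<pi>\<close> does elsewhere.\<close>

lemma commutator_moved:
  assumes p: "\<pi> permutes V" and R: "finite R" "R \<inter> \<pi> ` R = {}"
    and r: "\<rho> permutes R" "\<forall>x\<in>R. \<rho> x \<noteq> x"
  shows "card {x. (\<pi> \<circ> \<rho> \<circ> inv \<pi> \<circ> inv \<rho>) x \<noteq> x} = 2 * card R"
proof -
  note pinv = permutes_inverses[OF p] and rinv = permutes_inverses[OF r(1)]
  have rR: "inv \<rho> x \<in> R" if "x \<in> R" for x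
    using permutes_in_image[OF permutes_inv[OF r(1)]] that by simp
  have rfix: "\<rho> x = x" "inv \<rho> x = x" if "x \<notin> R" for x
    using that permutes_not_in[OF r(1)] permutes_not_in[OF permutes_inv[OF r(1)]] by auto
  have "(\<pi> \<circ> \<rho> \<circ> inv \<pi> \<circ> inv \<rho>) x \<noteq> x \<longleftrightarrow> x \<in> R \<union> \<pi> ` R" for x
  proof (cases "x \<in> R")
    case True
    let ?y = "inv \<rho> x"
    have y: "?y \<in> R" "?y \<noteq> x"
      using True rR r(2) rinv(1)[of x] by metis+
    then have "inv \<pi> ?y \<notin> R"
      using R(2) pinv(1)[of ?y] by (metis IntI emptyE image_eqI)
    then have "(\<pi> \<circ> \<rho> \<circ> inv \<pi> \<circ> inv \<rho>) x = ?y"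
      using rfix(1) pinv(1) by simp
    then show ?thesis
      using y True by simp
  next
    case False
    show ?thesis
    proof (cases "x \<in> \<pi> ` R")
      case True
      then obtain y where y: "y \<in> R" "x = \<pi> y" by blast
      have "(\<pi> \<circ> \<rho> \<circ> inv \<pi> \<circ> inv \<rho>) x = \<pi> (\<rho> y)"
        using rfix(2)[OF False] pinv(2) y by simp
      then show ?thesis
        using y r(2) permutes_inj[OF p] by (auto simp: inj_eq)
    next
      case nxt: False
      then have "inv \<pi> x \<notin> R"
        using pinv(1)[of x] by (metis image_eqI)
      then show ?thesis
        using rfix False nxt pinv(1) by simp
    qed
  qed
  then have "{x. (\<pi> \<circ> \<rho> \<circ> inv \<pi> \<circ> inv \<rho>) x \<noteq> x} = R \<union> \<pi> ` R"
    by blast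
  moreover have "card (R \<union> \<pi> ` R) = card R + card (\<pi> ` R)"
    using R by (intro card_Un_disjoint) auto
  moreover have "card (\<pi> ` R) = card R"
    using permutes_inj_on[OF p] by (rule card_image)
  ultimately show ?thesis by simp
qed

text \<open>By invariance, \<open>\<rho> \<circ> inv \<pi> \<circ> inv \<rho>\<close> displaces a uniform configuration on average as much as
  \<open>\<pi>\<close> does.\<close>

lemma commutator_perm_dist:
  assumes V: "finite V" and p: "\<pi> permutes V" and r: "\<rho> permutes V"
  shows "cube_mean V (\<lambda>S. perm_dist V F S ((\<pi> \<circ> \<rho> \<circ> inv \<pi> \<circ> inv \<rho>) ` S))
    \<le> 2 * cube_mean V (\<lambda>S. perm_dist V F S (\<pi> ` S))"
proof -
  let ?d = "perm_dist V F"
  have pw: "?d S ((\<pi> \<circ> \<rho> \<circ> inv \<pi> \<circ> inv \<rho>) ` S)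
      \<le> ?d S (\<pi> ` S) + ?d (inv \<rho> ` S) (inv \<pi> ` inv \<rho> ` S)" for S
  proof -
    let ?T = "\<rho> ` inv \<pi> ` inv \<rho> ` S"
    have "?d S (\<pi> ` ?T) \<le> ?d S (\<pi> ` S) + ?d (\<pi> ` S) (\<pi> ` ?T)"
      by (rule perm_dist_triangle[OF V])
    also have "?d (\<pi> ` S) (\<pi> ` ?T) = ?d S ?T"
      by (rule perm_dist_image[OF p])
    also have "\<dots> = ?d (\<rho> ` inv \<rho> ` S) ?T"
      by (simp add: image_comp permutes_inv_o[OF r])
    also have "\<dots> = ?d (inv \<rho> ` S) (inv \<pi> ` inv \<rho> ` S)"
      by (rule perm_dist_image[OF r])
    finally show ?thesis
      by (simp add: image_comp comp_assoc)
  qed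
  have "cube_mean V (\<lambda>S. ?d S ((\<pi> \<circ> \<rho> \<circ> inv \<pi> \<circ> inv \<rho>) ` S))
      \<le> cube_mean V (\<lambda>S. ?d S (\<pi> ` S) + ?d (inv \<rho> ` S) (inv \<pi> ` inv \<rho> ` S))"
    by (intro cube_mean_mono pw)
  also have "\<dots> = cube_mean V (\<lambda>S. ?d S (\<pi> ` S)) + cube_mean V (\<lambda>S. ?d (inv \<rho> ` S) (inv \<pi> ` inv \<rho> ` S))"
    by (rule cube_mean_add)
  also have "cube_mean V (\<lambda>S. ?d (inv \<rho> ` S) (inv \<pi> ` inv \<rho> ` S)) = cube_mean V (\<lambda>S. ?d S (inv \<pi> ` S))"
    by (rule cube_mean_image[OF permutes_inv[OF r], of "\<lambda>S. ?d S (inv \<pi> ` S)"])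
  also have "\<dots> = cube_mean V (\<lambda>S. ?d (\<pi> ` S) (inv \<pi> ` \<pi> ` S))"
    by (rule cube_mean_image[OF p, of "\<lambda>S. ?d S (inv \<pi> ` S)", symmetric])
  also have "\<dots> = cube_mean V (\<lambda>S. ?d S (\<pi> ` S))"
    by (simp add: image_comp permutes_inv_o[OF p] perm_dist_commute)
  finally show ?thesis by simp
qed

text \<open>The size of the support becomes a free parameter. The factor 3 is that of the displaced
  subset, and \<open>r = 1\<close> is excluded because the chosen subset needs a
  derangement.\<close>

lemma exists_perm_with_few_moved:
  assumes V: "finite V" and p: "\<pi> permutes V" and r: "3 * r \<le> card {x. \<pi> x \<noteq> x}" "r \<noteq> 1"
  obtains \<kappa> where "\<kappa> permutes V" "card {x. \<kappa> x \<noteq> x} = 2 * r"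
    "cube_mean V (\<lambda>S. perm_dist V F S (\<kappa> ` S)) \<le> 2 * cube_mean V (\<lambda>S. perm_dist V F S (\<pi> ` S))"
proof -
  obtain A where A: "A \<subseteq> V" "A \<inter> \<pi> ` A = {}" "card {x. \<pi> x \<noteq> x} \<le> 3 * card A"
    using exists_displaced_subset[OF V p] by blast
  have "r \<le> card A"
    using A(3) r(1) by linarith
  then obtain R where R: "R \<subseteq> A" "card R = r" "finite R"
    by (rule obtain_subset_with_card_n)
  then obtain \<rho> where \<rho>: "\<rho> permutes R" "\<forall>x\<in>R. \<rho> x \<noteq> x"
    using exists_derangement[of R] r(2) by blast
  have rV: "\<rho> permutes V"
    by (rule permutes_subset[OF \<rho>(1)]) (use R A in blast)
  show ?thesis
  proof (rule that)
    show "\<pi> \<circ> \<rho> \<circ> inv \<pi> \<circ> inv \<rho> permutes V"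
      by (intro permutes_compose permutes_inv p rV)
    show "card {x. (\<pi> \<circ> \<rho> \<circ> inv \<pi> \<circ> inv \<rho>) x \<noteq> x} = 2 * r"
      using commutator_moved[OF p R(3) _ \<rho>] A(2) R(1,2) by blast
    show "cube_mean V (\<lambda>S. perm_dist V F S ((\<pi> \<circ> \<rho> \<circ> inv \<pi> \<circ> inv \<rho>) ` S))
        \<le> 2 * cube_mean V (\<lambda>S. perm_dist V F S (\<pi> ` S))"
      by (rule commutator_perm_dist[OF V p rV])
  qed
qed

section \<open>The exclusion process\<close>

lemma finite_pairs: "finite V \<Longrightarrow> finite (pairs V)"
  unfolding pairs_def by (rule finite_subset[of _ "Pow V"]) auto

lemma swap_pair_doubleton: "x \<noteq> y \<Longrightarrow> swap_pair {x, y} = Transposition.transpose x y"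
  by (rule ext) (auto simp: swap_pair_def Transposition.transpose_def insert_Diff_if)

lemma pairsE:
  assumes "e \<in> pairs V"
  obtains x y where "e = {x, y}" "x \<noteq> y" "x \<in> V" "y \<in> V"
  using assms unfolding pairs_def card_2_iff by blast

lemma swap_pair_permutes:
  assumes "e \<in> pairs V"
  shows "swap_pair e permutes V"
  using assms by (elim pairsE) (simp add: swap_pair_doubleton permutes_swap_id)

lemma ringing_pair_props:
  assumes "s \<in> ring_times_upto V w t"
  shows "ringing_pair V w s \<in> pairs V" "\<exists>k. s = ring_time w (ringing_pair V w s) k"
proof -
  have "\<exists>e. e \<in> pairs V \<and> (\<exists>k. s = ring_time w e k)"
    using assms by (auto simp: ring_times_upto_def)
  from someI_ex[OF this]
  show "ringing_pair V w s \<in> pairs V" "\<exists>k. s = ring_time w (ringing_pair V w s) k"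
    unfolding ringing_pair_def by auto
qed

lemma fold_swap_permutes:
  assumes "\<And>s. s \<in> set ss \<Longrightarrow> E s \<in> pairs V" "\<pi> permutes V"
  shows "fold (\<lambda>s \<pi>. swap_pair (E s) \<circ> \<pi>) ss \<pi> permutes V"
  using assms
proof (induction ss arbitrary: \<pi>)
  case (Cons s ss)
  have "swap_pair (E s) \<circ> \<pi> permutes V"
    using Cons.prems by (intro permutes_compose swap_pair_permutes) auto
  then show ?case
    unfolding fold_simps by (rule Cons.IH[rotated]) (simp add: Cons.prems(1))
qed simp

lemma set_sorted_list_of_set_subset: "set (sorted_list_of_set A) \<subseteq> A"
  by (cases "finite A") auto

lemma cgx_perm_permutes: "cgx_perm V w t permutes V"
  unfolding cgx_perm_def
  using ringing_pair_props(1) set_sorted_list_of_set_subset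
  by (intro fold_swap_permutes permutes_id) blast

section \<open>Measurability of the random permutation\<close>

definition waiting_law :: "'a set \<Rightarrow> real measure" where
  "waiting_law V = density lborel (exponential_density (1 / real (card V)))"

lemma clocks_eq: "clocks V = PiM (pairs V \<times> UNIV) (\<lambda>_. waiting_law V)"
  by (simp add: clocks_def waiting_law_def)

lemma sets_waiting_law [measurable_cong]: "sets (waiting_law V) = sets borel"
  by (simp add: waiting_law_def)

lemma space_waiting_law [simp]: "space (waiting_law V) = UNIV"
  by (simp add: waiting_law_def)

text \<open>For empty \<open>V\<close> the rate \<open>1 / card V\<close> is 0 by convention, and
  the waiting law would be the zero measure instead of a probability.\<close>

locale clock_system =
  fixes V :: "'a set"
  assumes finite_V: "finite V" and V_nonempty: "V \<noteq> {}"
begin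

abbreviation indices :: "('a set \<times> nat) set" where
  "indices \<equiv> pairs V \<times> UNIV"

lemma card_V_pos: "card V > 0"
  using finite_V V_nonempty by (simp add: card_gt_0_iff)

lemma finite_pairs_V: "finite (pairs V)"
  using finite_V by (rule finite_pairs)

lemma prob_space_waiting_law: "prob_space (waiting_law V)"
  unfolding waiting_law_def using card_V_pos by (intro prob_space_exponential_density) simp

sublocale product_prob_space "\<lambda>_. waiting_law V" indices
  using prob_space_waiting_law
  by (simp add: product_prob_space_def product_prob_space_axioms_def product_sigma_finite_def
      prob_space_imp_sigma_finite)

lemma prob_space_clocks: "prob_space (clocks V)"
  unfolding clocks_eq by (rule prob_space_PiM) (rule prob_space_waiting_law)

lemma countable_indices: "countable indices"
  by (intro countable_SIGMA countable_finite[OF finite_pairs_V]) simp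

lemma measurable_component [measurable]:
  assumes "i \<in> indices"
  shows "(\<lambda>w. w i) \<in> borel_measurable (clocks V)"
proof -
  have "(\<lambda>w. w i) \<in> measurable (clocks V) (waiting_law V)"
    unfolding clocks_eq by (rule measurable_component_singleton[OF assms])
  then show ?thesis
    by (simp cong: measurable_cong_sets add: sets_waiting_law)
qed

lemma measurable_ring_time:
  assumes "e \<in> pairs V"
  shows "(\<lambda>w. ring_time w e k) \<in> borel_measurable (clocks V)"
  unfolding ring_time_def using assms by (intro borel_measurable_sum measurable_component) auto

lemma sets_ring_time_eq:
  assumes "e \<in> pairs V" "e' \<in> pairs V"
  shows "{w \<in> space (clocks V). ring_time w e k = ring_time w e' k'} \<in> sets (clocks V)"
  using measurable_ring_time[OF assms(1)] measurable_ring_time[OF assms(2)]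
  by (rule borel_measurable_eq)

text \<open>The choice by \<open>SOME\<close> depends on \<open>w\<close> only through the set
  \<open>T\<close> of all pairs ringing at that moment, and there are finitely many candidates for
  \<open>T\<close>. This covers ties as well.\<close>

lemma sets_ringing_pair:
  assumes "e \<in> pairs V"
  shows "{w \<in> space (clocks V). ringing_pair V w (ring_time w e k) = e0} \<in> sets (clocks V)"
proof -
  let ?R = "\<lambda>w e'. \<exists>k'. ring_time w e k = ring_time w e' k'"
  let ?T = "{T. T \<subseteq> pairs V \<and> (SOME e. e \<in> T) = e0}"
  have R: "{w \<in> space (clocks V). ?R w e'} \<in> sets (clocks V)" if "e' \<in> pairs V" for e'
    by (intro sets.sets_Collect_countable_Ex sets_ring_time_eq assms that)
  have "{w \<in> space (clocks V). ringing_pair V w (ring_time w e k) = e0}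
      = (\<Union>T\<in>?T. {w \<in> space (clocks V). \<forall>e'\<in>pairs V. e' \<in> T \<longleftrightarrow> ?R w e'})" (is "?A = ?B")
  proof
    show "?A \<subseteq> ?B"
    proof
      fix w assume w: "w \<in> ?A"
      have "{e' \<in> pairs V. ?R w e'} \<in> ?T"
        using w by (simp add: ringing_pair_def)
      then show "w \<in> ?B"
        using w by blast
    qed
    show "?B \<subseteq> ?A"
    proof
      fix w assume "w \<in> ?B"
      then obtain T where T: "T \<subseteq> pairs V" "(SOME e. e \<in> T) = e0" "w \<in> space (clocks V)"
        "\<forall>e'\<in>pairs V. e' \<in> T \<longleftrightarrow> ?R w e'" by blast
      then have "T = {e' \<in> pairs V. ?R w e'}" by blast
      then show "w \<in> ?A"
        using T(2,3) by (simp add: ringing_pair_def)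
    qed
  qed
  moreover have "{w \<in> space (clocks V). e' \<in> T \<longleftrightarrow> ?R w e'} \<in> sets (clocks V)"
    if "e' \<in> pairs V" for e' T
    using R[OF that] sets.sets_Collect_neg[OF R[OF that]] by (cases "e' \<in> T") simp_all
  then have "{w \<in> space (clocks V). \<forall>e'\<in>pairs V. e' \<in> T \<longleftrightarrow> ?R w e'} \<in> sets (clocks V)" for T
    using finite_pairs_V by (intro sets.sets_Collect_finite_All) auto
  moreover have "finite ?T"
    by (rule finite_subset[of _ "Pow (pairs V)"]) (use finite_pairs_V in auto)
  ultimately show ?thesis
    by (simp add: sets.finite_UN)
qed

text \<open>Whether a list of clock indices enumerates the rings up to time \<open>t\<close> in order is decided by
  countably many comparisons of ring times. This makes the permutation measurable, although it is
  defined through a sorted list of reals.\<close>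

definition enumerates :: "('a set \<times> nat) list \<Rightarrow> ('a set \<times> nat \<Rightarrow> real) \<Rightarrow> real \<Rightarrow> bool" where
  "enumerates l w t \<longleftrightarrow>
     (\<forall>m<length l. \<forall>m'<m. ring_time w (fst (l ! m')) (snd (l ! m')) < ring_time w (fst (l ! m)) (snd (l ! m))) \<and>
     (\<forall>m<length l. ring_time w (fst (l ! m)) (snd (l ! m)) \<le> t) \<and>
     (\<forall>i\<in>indices. ring_time w (fst i) (snd i) \<le> t \<longrightarrow>
        (\<exists>m<length l. ring_time w (fst i) (snd i) = ring_time w (fst (l ! m)) (snd (l ! m))))"

lemma sets_enumerates:
  assumes l: "l \<in> lists indices"
  shows "{w \<in> space (clocks V). enumerates l w t} \<in> sets (clocks V)"
proof -
  have mem: "fst (l ! m) \<in> pairs V" if "m < length l" for m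
    using l that by (auto simp: in_lists_conv_set mem_Times_iff)
  have meas [measurable]: "(\<lambda>w. ring_time w (fst (l ! m)) (snd (l ! m))) \<in> borel_measurable (clocks V)"
    if "m < length l" for m
    by (rule measurable_ring_time[OF mem[OF that]])
  have all: "{w \<in> space (clocks V). \<forall>m<N. Q m w} \<in> sets (clocks V)"
    if "\<And>m. m < N \<Longrightarrow> {w \<in> space (clocks V). Q m w} \<in> sets (clocks V)" for N :: nat and Q
    using sets.sets_Collect_finite_All[of "{..<N}" "clocks V" Q] that by simp
  have ex: "{w \<in> space (clocks V). \<exists>m<N. Q m w} \<in> sets (clocks V)"
    if "\<And>m. m < N \<Longrightarrow> {w \<in> space (clocks V). Q m w} \<in> sets (clocks V)" for N :: nat and Q
    using sets.sets_Collect_finite_Ex[of "{..<N}" "clocks V" Q] that by (simp add: Bex_def)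
  have a: "{w \<in> space (clocks V). \<forall>m<length l. \<forall>m'<m. ring_time w (fst (l ! m')) (snd (l ! m'))
      < ring_time w (fst (l ! m)) (snd (l ! m))} \<in> sets (clocks V)"
    by (intro all borel_measurable_less meas) auto
  have b: "{w \<in> space (clocks V). \<forall>m<length l. ring_time w (fst (l ! m)) (snd (l ! m)) \<le> t} \<in> sets (clocks V)"
    by (intro all borel_measurable_le meas measurable_const) auto
  have c: "{w \<in> space (clocks V). \<forall>i\<in>indices. ring_time w (fst i) (snd i) \<le> t \<longrightarrow>
      (\<exists>m<length l. ring_time w (fst i) (snd i) = ring_time w (fst (l ! m)) (snd (l ! m)))} \<in> sets (clocks V)"
  proof (rule sets.sets_Collect_countable_All'[OF _ countable_indices])
    fix i assume "i \<in> indices"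
    then have "fst i \<in> pairs V" by auto
    then have mi: "(\<lambda>w. ring_time w (fst i) (snd i)) \<in> borel_measurable (clocks V)"
      by (rule measurable_ring_time)
    show "{w \<in> space (clocks V). ring_time w (fst i) (snd i) \<le> t \<longrightarrow>
      (\<exists>m<length l. ring_time w (fst i) (snd i) = ring_time w (fst (l ! m)) (snd (l ! m)))} \<in> sets (clocks V)"
      by (intro sets.sets_Collect_imp ex borel_measurable_le borel_measurable_eq mi meas) auto
  qed
  show ?thesis
    unfolding enumerates_def by (intro sets.sets_Collect_conj a b c)
qed

text \<open>A strictly increasing list is determined by its set of entries.\<close>

lemma enumerates_sorted_list:
  assumes "l \<in> lists indices" "enumerates l w t"
  shows "sorted_list_of_set (ring_times_upto V w t) = map (\<lambda>i. ring_time w (fst i) (snd i)) l"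
    "finite (ring_times_upto V w t)"
proof -
  let ?l = "map (\<lambda>i. ring_time w (fst i) (snd i)) l"
  have srt: "sorted_wrt (<) ?l"
    using assms(2) unfolding enumerates_def sorted_wrt_iff_nth_less by auto
  have set: "set ?l = ring_times_upto V w t"
  proof
    show "set ?l \<subseteq> ring_times_upto V w t"
    proof
      fix s assume "s \<in> set ?l"
      then obtain m where m: "m < length l" "s = ring_time w (fst (l ! m)) (snd (l ! m))"
        by (auto simp: in_set_conv_nth)
      moreover have "l ! m \<in> indices"
        using assms(1) m(1) by (simp add: in_lists_conv_set)
      ultimately show "s \<in> ring_times_upto V w t"
        using assms(2) unfolding enumerates_def ring_times_upto_def by auto
    qed
    show "ring_times_upto V w t \<subseteq> set ?l"
    proof
      fix s assume "s \<in> ring_times_upto V w t"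
      then obtain e k where e: "e \<in> pairs V" "s = ring_time w e k" "s \<le> t"
        by (auto simp: ring_times_upto_def)
      then have "(e, k) \<in> indices" "ring_time w (fst (e, k)) (snd (e, k)) \<le> t"
        by auto
      then obtain m where "m < length l" "s = ring_time w (fst (l ! m)) (snd (l ! m))"
        using assms(2) e(2) unfolding enumerates_def by (metis fst_conv snd_conv)
      then show "s \<in> set ?l"
        by (simp add: image_iff) (metis nth_mem)
    qed
  qed
  show fin: "finite (ring_times_upto V w t)"
    unfolding set[symmetric] by simp
  show "sorted_list_of_set (ring_times_upto V w t) = ?l"
    by (rule strict_sorted_equal[OF srt]) (use set fin in auto)
qed

lemma exists_enumerates:
  assumes "finite (ring_times_upto V w t)"
  shows "\<exists>l\<in>lists indices. enumerates l w t"
proof -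
  let ?L = "sorted_list_of_set (ring_times_upto V w t)"
  have "\<forall>s\<in>ring_times_upto V w t. \<exists>i\<in>indices. s = ring_time w (fst i) (snd i)"
    by (force simp: ring_times_upto_def)
  then obtain g where g: "\<And>s. s \<in> ring_times_upto V w t \<Longrightarrow> g s \<in> indices \<and> s = ring_time w (fst (g s)) (snd (g s))"
    by metis
  have set: "set ?L = ring_times_upto V w t"
    using assms by simp
  define l where "l = map g ?L"
  have len: "length l = length ?L"
    by (simp add: l_def)
  have nth: "ring_time w (fst (l ! m)) (snd (l ! m)) = ?L ! m" if "m < length l" for m
    using g[of "?L ! m"] that set nth_mem[of m ?L] by (simp add: l_def)
  have inset: "?L ! m \<in> ring_times_upto V w t" if "m < length l" for m
    using that set nth_mem[of m ?L] by (simp add: len)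
  have "l \<in> lists indices"
    using g set by (auto simp: l_def in_lists_conv_set)
  moreover have "enumerates l w t"
    unfolding enumerates_def
  proof (intro conjI allI impI ballI)
    fix m m' assume m: "m < length l" "m' < m"
    have "sorted_wrt (<) ?L"
      by (rule strict_sorted_list_of_set)
    then have "?L ! m' < ?L ! m"
      using m len by (auto simp: sorted_wrt_iff_nth_less)
    then show "ring_time w (fst (l ! m')) (snd (l ! m')) < ring_time w (fst (l ! m)) (snd (l ! m))"
      using nth m by simp
  next
    fix m assume "m < length l"
    then show "ring_time w (fst (l ! m)) (snd (l ! m)) \<le> t"
      using nth inset[of m] by (simp add: ring_times_upto_def)
  next
    fix i assume i: "i \<in> indices" "ring_time w (fst i) (snd i) \<le> t"
    then have "ring_time w (fst i) (snd i) \<in> ring_times_upto V w t"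
      unfolding ring_times_upto_def by auto
    then have "ring_time w (fst i) (snd i) \<in> set ?L"
      unfolding set .
    then show "\<exists>m<length l. ring_time w (fst i) (snd i) = ring_time w (fst (l ! m)) (snd (l ! m))"
      using nth len by (metis in_set_conv_nth)
  qed
  ultimately show ?thesis by blast
qed

text \<open>Apart from the case of no enumeration, the event is a countable union, indexed by the
  list of clock indices that ring and by the pairs chosen at these rings.\<close>

lemma sets_cgx_perm: "{w \<in> space (clocks V). cgx_perm V w t = p} \<in> sets (clocks V)"
proof -
  let ?F = "\<lambda>es. fold (\<lambda>e \<pi>. swap_pair e \<circ> \<pi>) es id"
  let ?E = "\<lambda>w i. ringing_pair V w (ring_time w (fst i) (snd i))"
  have fold_eq: "cgx_perm V w t = ?F (map (?E w) l)"
    if "l \<in> lists indices" "enumerates l w t" for l w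
    unfolding cgx_perm_def enumerates_sorted_list(1)[OF that] fold_map
    by (rule arg_cong[of _ _ "\<lambda>g. fold g l id"]) (simp add: fun_eq_iff)
  \<comment> \<open>With infinitely many rings, \<open>sorted_list_of_set\<close> returns the empty
    list and the fold leaves \<open>id\<close>.\<close>
  have none: "cgx_perm V w t = id" if "\<forall>l\<in>lists indices. \<not> enumerates l w t" for w
  proof -
    have "infinite (ring_times_upto V w t)"
      using exists_enumerates[of w t] that by blast
    then show ?thesis
      by (simp add: cgx_perm_def)
  qed
  have "cgx_perm V w t = p \<longleftrightarrow>
      (\<exists>l\<in>lists indices. \<exists>es\<in>lists (pairs V). enumerates l w t \<and> map (?E w) l = es \<and> ?F es = p)
      \<or> (\<forall>l\<in>lists indices. \<not> enumerates l w t) \<and> id = p" for w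
  proof (cases "\<exists>l\<in>lists indices. enumerates l w t")
    case True
    then obtain l where l: "l \<in> lists indices" "enumerates l w t" by blast
    have "map (?E w) l \<in> lists (pairs V)"
    proof -
      have "?E w i \<in> pairs V" if "i \<in> set l" for i
      proof -
        have "ring_time w (fst i) (snd i) \<in> set (sorted_list_of_set (ring_times_upto V w t))"
          unfolding enumerates_sorted_list(1)[OF l] using that by auto
        then have "ring_time w (fst i) (snd i) \<in> ring_times_upto V w t"
          using enumerates_sorted_list(2)[OF l] by simp
        then show ?thesis by (rule ringing_pair_props)
      qed
      then show ?thesis by (auto simp: in_lists_conv_set)
    qed
    then have "cgx_perm V w t = p \<Longrightarrow> \<exists>l\<in>lists indices. \<exists>es\<in>lists (pairs V).
        enumerates l w t \<and> map (?E w) l = es \<and> ?F es = p"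
      using l fold_eq[OF l]
      by (intro bexI[of _ l] bexI[of _ "map (?E w) l"] conjI) simp_all
    moreover have "cgx_perm V w t = p"
      if "l' \<in> lists indices" "enumerates l' w t" "map (?E w) l' = es" "?F es = p" for l' es
      using fold_eq[OF that(1,2)] that(3,4) by simp
    ultimately show ?thesis
      using True by (metis (no_types, lifting))
  next
    case False
    then show ?thesis using none by auto
  qed
  note eq = this
  have E: "{w \<in> space (clocks V). map (?E w) l = es} \<in> sets (clocks V)"
    if l: "l \<in> lists indices" for l es
    using l
  proof (induction l arbitrary: es)
    case Nil
    then show ?case by simp
  next
    case (Cons i l)
    show ?case
    proof (cases es)
      case Nil
      then show ?thesis by simp
    next
      case (Cons e es')
      have "{w \<in> space (clocks V). ?E w i = e} \<in> sets (clocks V)"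
        using Cons.hyps by (intro sets_ringing_pair) auto
      then have "{w \<in> space (clocks V). ?E w i = e \<and> map (?E w) l = es'} \<in> sets (clocks V)"
        by (intro sets.sets_Collect_conj Cons.IH)
      then show ?thesis
        using Cons by simp
    qed
  qed
  have cl: "countable (lists indices)" "countable (lists (pairs V))"
    using countable_indices finite_pairs_V by (auto intro: countable_lists countable_finite)
  show ?thesis
    unfolding eq
    by (intro sets.sets_Collect_disj sets.sets_Collect_conj sets.sets_Collect_countable_Ex'
        sets.sets_Collect_countable_All' sets.sets_Collect_neg sets_enumerates E cl sets.sets_Collect_const)
qed

section \<open>Almost sure behaviour of the clocks\<close>

lemma AE_nonneg: "AE w in clocks V. \<forall>i\<in>indices. 0 \<le> w i"
proof (rule AE_ball_countable'[OF _ countable_indices])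
  fix i assume "i \<in> indices"
  have "AE x in waiting_law V. 0 \<le> x"
    unfolding waiting_law_def by (subst AE_density) (auto simp: exponential_density_def)
  then show "AE w in clocks V. 0 \<le> w i"
    unfolding clocks_eq using \<open>i \<in> indices\<close> by (intro AE_component) auto
qed

lemma AE_waiting_law_neq: "AE x in waiting_law V. x \<noteq> c"
  unfolding waiting_law_def using AE_lborel_singleton[of c] by (subst AE_density) auto

lemma AE_ring_time_neq:
  assumes e: "e \<in> pairs V" "e' \<in> pairs V" "e \<noteq> e'"
  shows "AE w in clocks V. ring_time w e k \<noteq> ring_time w e' k'"
proof -
  \<comment> \<open>Conditionally on all other waiting times, a tie prescribes the value of \<open>w (e, 0)\<close>.\<close>
  let ?i = "(e, 0::nat)" and ?M = "waiting_law V"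
  let ?J = "indices - {?i}"
  let ?P = "\<lambda>w. ring_time w e k \<noteq> ring_time w e' k'"
  let ?g = "\<lambda>(x, X). X(?i := x)"
  have ins: "insert ?i ?J = indices"
    using e(1) by auto
  have distr: "distr (?M \<Otimes>\<^sub>M PiM ?J (\<lambda>_. ?M)) (clocks V) ?g = clocks V"
    using distr_pair_PiM_eq_PiM[of ?J "\<lambda>_. ?M" ?i] prob_space_waiting_law
    unfolding ins clocks_eq by simp
  have g: "?g \<in> measurable (?M \<Otimes>\<^sub>M PiM ?J (\<lambda>_. ?M)) (clocks V)"
  proof -
    have "(\<lambda>(x, X). X(?i := x)) \<in> measurable (?M \<Otimes>\<^sub>M PiM ?J (\<lambda>_. ?M)) (PiM (insert ?i ?J) (\<lambda>_. ?M))"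
      by measurable
    then show ?thesis
      unfolding ins clocks_eq .
  qed
  have P: "{w \<in> space (clocks V). ?P w} \<in> sets (clocks V)"
    by (intro sets.sets_Collect_neg sets_ring_time_eq e)
  interpret J: prob_space "PiM ?J (\<lambda>_. ?M)"
    by (intro prob_space_PiM prob_space_waiting_law)
  interpret W: prob_space ?M
    by (rule prob_space_waiting_law)
  interpret pair_sigma_finite ?M "PiM ?J (\<lambda>_. ?M)" ..
  have S: "{z \<in> space (?M \<Otimes>\<^sub>M PiM ?J (\<lambda>_. ?M)). ?P (?g z)} \<in> sets (?M \<Otimes>\<^sub>M PiM ?J (\<lambda>_. ?M))"
    using measurable_sets[OF g P] measurable_space[OF g]
    by (auto simp: vimage_def Int_def conj_commute elim!: back_subst[of "\<lambda>A. A \<in> _"])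
  have slice: "AE x in ?M. ?P (?g (x, X))" for X
  proof -
    let ?c = "ring_time X e' k' - (\<Sum>j=1..k. X (e, j))"
    have "ring_time (X(?i := x)) e k = x + (\<Sum>j=1..k. X (e, j))" for x
      unfolding ring_time_def atMost_atLeast0 by (subst sum.atLeast_Suc_atMost) auto
    moreover have "ring_time (X(?i := x)) e' k' = ring_time X e' k'" for x
      using e(3) by (simp add: ring_time_def)
    ultimately have "?P (?g (x, X)) \<longleftrightarrow> x \<noteq> ?c" for x
      by auto
    then show ?thesis
      using AE_waiting_law_neq[of ?c] by simp
  qed
  have "AE X in PiM ?J (\<lambda>_. ?M). AE x in ?M. ?P (?g (x, X))"
    by (rule AE_I2) (rule slice)
  \<comment> \<open>The slices are null for every fixed \<open>X\<close>, but the first factor of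
    the product is the single waiting time; Fubini exchanges the two quantifiers.\<close>
  then have "AE x in ?M. AE X in PiM ?J (\<lambda>_. ?M). ?P (?g (x, X))"
    by (subst AE_commute) (use S in \<open>simp_all add: case_prod_beta\<close>)
  then have "AE z in ?M \<Otimes>\<^sub>M PiM ?J (\<lambda>_. ?M). ?P (?g z)"
    by (rule AE_pair_measure[OF S])
  then have "AE w in distr (?M \<Otimes>\<^sub>M PiM ?J (\<lambda>_. ?M)) (clocks V) ?g. ?P w"
    by (subst AE_distr_iff[OF g P])
  then show ?thesis
    unfolding distr .
qed

text \<open>Only distinct pairs are compared: coinciding rings of one pair leave
  \<open>ringing_pair\<close> unambiguous.\<close>

definition tie_free :: "('a set \<times> nat \<Rightarrow> real) \<Rightarrow> bool" where
  "tie_free w \<longleftrightarrow> (\<forall>e\<in>pairs V. \<forall>e'\<in>pairs V. e \<noteq> e' \<longrightarrow> (\<forall>k k'. ring_time w e k \<noteq> ring_time w e' k'))"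

lemma AE_tie_free: "AE w in clocks V. tie_free w"
  unfolding tie_free_def
  by (intro AE_ball_countable' countable_finite[OF finite_pairs_V] AE_impI AE_all_countable[THEN iffD2] allI
      AE_ring_time_neq)

lemma ringing_pair_unique:
  assumes "tie_free w" "e \<in> pairs V"
  shows "ringing_pair V w (ring_time w e k) = e"
  unfolding ringing_pair_def using assms unfolding tie_free_def by (intro some_equality) blast+

end

section \<open>Invariance under relabelling\<close>

lemma swap_pair_conj:
  assumes "q permutes V" "e \<in> pairs V"
  shows "swap_pair e = inv q \<circ> swap_pair (q ` e) \<circ> q"
proof -
  obtain x y where e: "e = {x, y}" "x \<noteq> y"
    using assms(2) by (rule pairsE)
  have inj: "inj q"
    by (rule permutes_inj[OF assms(1)])
  then have "q x \<noteq> q y"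
    using e by (simp add: inj_eq)
  then show ?thesis
    using e inj permutes_inverses[OF assms(1)]
    by (auto simp: fun_eq_iff swap_pair_doubleton Transposition.transpose_def inj_eq)
qed

lemma fold_swap_conj:
  assumes q: "q permutes V"
    and E: "\<And>s. s \<in> set ss \<Longrightarrow> E' s \<in> pairs V \<and> E s = q ` E' s"
  shows "fold (\<lambda>s \<pi>. swap_pair (E' s) \<circ> \<pi>) ss (inv q \<circ> \<pi> \<circ> q)
    = inv q \<circ> fold (\<lambda>s \<pi>. swap_pair (E s) \<circ> \<pi>) ss \<pi> \<circ> q"
  using E
proof (induction ss arbitrary: \<pi>)
  case Nil
  then show ?case by simp
next
  case (Cons s ss)
  have "swap_pair (E' s) = inv q \<circ> swap_pair (E s) \<circ> q"
    using Cons.prems[of s] swap_pair_conj[OF q, of "E' s"] by simp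
  then have "swap_pair (E' s) \<circ> (inv q \<circ> \<pi> \<circ> q) = inv q \<circ> (swap_pair (E s) \<circ> \<pi>) \<circ> q"
    using permutes_inverses[OF q] by (simp add: fun_eq_iff)
  then have "fold (\<lambda>s \<pi>. swap_pair (E' s) \<circ> \<pi>) (s # ss) (inv q \<circ> \<pi> \<circ> q)
      = fold (\<lambda>s \<pi>. swap_pair (E' s) \<circ> \<pi>) ss (inv q \<circ> (swap_pair (E s) \<circ> \<pi>) \<circ> q)"
    by (simp only: fold_simps)
  also have "\<dots> = inv q \<circ> fold (\<lambda>s \<pi>. swap_pair (E s) \<circ> \<pi>) ss (swap_pair (E s) \<circ> \<pi>) \<circ> q"
    by (rule Cons.IH) (simp add: Cons.prems)
  finally show ?case
    by (simp only: fold_simps)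
qed

lemma image_pairs_bij:
  assumes "q permutes V"
  shows "bij_betw ((`) q) (pairs V) (pairs V)"
proof -
  have sub: "p ` e \<in> pairs V" if "p permutes V" "e \<in> pairs V" for p e
    using that permutes_image[OF that(1)] card_image[OF permutes_inj_on[OF that(1)], of e]
    unfolding pairs_def by auto
  show ?thesis
    by (rule bij_betwI[of _ _ _ "(`) (inv q)"])
       (use sub assms permutes_inv[OF assms] in
        \<open>auto simp: image_comp permutes_inv_o[OF assms]\<close>)
qed

context clock_system
begin

text \<open>The new clock of a pair is the old clock of its image under \<open>q\<close>.
  Restriction to \<open>indices\<close> keeps the family extensional, hence in the product
  space.\<close>

definition relabel :: "('a \<Rightarrow> 'a) \<Rightarrow> ('a set \<times> nat \<Rightarrow> real) \<Rightarrow> 'a set \<times> nat \<Rightarrow> real" where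
  "relabel q w = (\<lambda>i\<in>indices. w (q ` fst i, snd i))"

lemma distr_relabel:
  assumes "q permutes V"
  shows "distr (clocks V) (clocks V) (relabel q) = clocks V"
proof -
  let ?f = "\<lambda>i. (q ` fst i, snd i)"
  have "inj_on ((`) q) (pairs V)" "(`) q \<in> pairs V \<rightarrow> pairs V"
    using image_pairs_bij[OF assms] by (auto simp: bij_betw_def)
  then have "inj_on ?f indices" "?f \<in> indices \<rightarrow> indices"
    by (auto simp: inj_on_def)
  from distr_PiM_reindex[of indices "\<lambda>_. waiting_law V" ?f indices, OF prob_space_waiting_law this]
  show ?thesis
    by (simp add: clocks_eq relabel_def[abs_def])
qed

lemma measurable_relabel:
  assumes "q permutes V"
  shows "relabel q \<in> measurable (clocks V) (clocks V)"
  unfolding clocks_eq relabel_def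
  using image_pairs_bij[OF assms]
  by (intro measurable_restrict measurable_component_singleton) (auto simp: bij_betw_def)

text \<open>The ring times stay the same and only the pair attached to each is renamed, so every
  transposition of the product is conjugated. At a tie the choice by \<open>SOME\<close> need not
  respect the renaming, hence \<open>tie_free\<close>.\<close>

lemma cgx_perm_relabel:
  assumes q: "q permutes V" and w: "tie_free w"
  shows "cgx_perm V (relabel q w) t = inv q \<circ> cgx_perm V w t \<circ> q"
proof -
  have bij: "bij_betw ((`) q) (pairs V) (pairs V)"
    by (rule image_pairs_bij[OF q])
  have im: "q ` e \<in> pairs V" if "e \<in> pairs V" for e
    using bij that by (auto simp: bij_betw_def)
  have rt: "ring_time (relabel q w) e k = ring_time w (q ` e) k" if "e \<in> pairs V" for e k
    using that by (simp add: ring_time_def relabel_def)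
  have "(\<exists>e\<in>pairs V. \<exists>k. s = ring_time (relabel q w) e k) \<longleftrightarrow> (\<exists>e\<in>(`) q ` pairs V. \<exists>k. s = ring_time w e k)" for s
    using rt by auto
  then have times: "ring_times_upto V (relabel q w) t = ring_times_upto V w t"
    unfolding ring_times_upto_def bij_betw_imp_surj_on[OF bij] by simp
  have E: "ringing_pair V (relabel q w) s \<in> pairs V \<and> ringing_pair V w s = q ` ringing_pair V (relabel q w) s"
    if "s \<in> set (sorted_list_of_set (ring_times_upto V w t))" for s
  proof -
    have s: "s \<in> ring_times_upto V w t"
      using that set_sorted_list_of_set_subset by blast
    let ?e = "ringing_pair V (relabel q w) s"
    have e: "?e \<in> pairs V" "\<exists>k. s = ring_time (relabel q w) ?e k"
      using ringing_pair_props[of s V "relabel q w" t] s times by auto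
    then obtain k where "s = ring_time w (q ` ?e) k"
      using rt by auto
    then show ?thesis
      using ringing_pair_unique[OF w im[OF e(1)], of k] e(1) by simp
  qed
  have "cgx_perm V (relabel q w) t
      = fold (\<lambda>s \<pi>. swap_pair (ringing_pair V (relabel q w) s) \<circ> \<pi>)
        (sorted_list_of_set (ring_times_upto V w t)) (inv q \<circ> id \<circ> q)"
    unfolding cgx_perm_def times using permutes_inv_o[OF q] by simp
  also have "\<dots> = inv q \<circ> cgx_perm V w t \<circ> q"
    unfolding cgx_perm_def by (rule fold_swap_conj[OF q E])
  finally show ?thesis .
qed

definition perm_law :: "real \<Rightarrow> ('a \<Rightarrow> 'a) \<Rightarrow> real" where
  "perm_law t p = measure (clocks V) {w \<in> space (clocks V). cgx_perm V w t = p}"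

text \<open>Relabelling preserves the law of the clocks and conjugates the permutation off a null
  set.\<close>

lemma perm_law_conj:
  assumes q: "q permutes V"
  shows "perm_law t (inv q \<circ> p \<circ> q) = perm_law t p"
proof -
  let ?A = "\<lambda>p. {w \<in> space (clocks V). cgx_perm V w t = p}"
  have inj: "inv q \<circ> a \<circ> q = inv q \<circ> b \<circ> q \<longleftrightarrow> a = b" for a b
  proof
    assume "inv q \<circ> a \<circ> q = inv q \<circ> b \<circ> q"
    then have "q \<circ> (inv q \<circ> a \<circ> q) \<circ> inv q = q \<circ> (inv q \<circ> b \<circ> q) \<circ> inv q"
      by simp
    then show "a = b"
      using permutes_inverses[OF q] by (simp add: fun_eq_iff)
  qed simp
  have "perm_law t (inv q \<circ> p \<circ> q)
      = measure (distr (clocks V) (clocks V) (relabel q)) (?A (inv q \<circ> p \<circ> q))"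
    by (simp add: distr_relabel[OF q] perm_law_def)
  also have "\<dots> = measure (clocks V) (relabel q -` ?A (inv q \<circ> p \<circ> q) \<inter> space (clocks V))"
    by (rule measure_distr[OF measurable_relabel[OF q] sets_cgx_perm])
  also have "\<dots> = measure (clocks V) (?A p)"
  proof (rule measure_eq_AE)
    show "AE w in clocks V. w \<in> relabel q -` ?A (inv q \<circ> p \<circ> q) \<inter> space (clocks V) \<longleftrightarrow> w \<in> ?A p"
      using AE_tie_free
    proof eventually_elim
      case (elim w)
      then show ?case
        using cgx_perm_relabel[OF q elim] measurable_space[OF measurable_relabel[OF q]]
        by (auto simp: inj)
    qed
    show "relabel q -` ?A (inv q \<circ> p \<circ> q) \<inter> space (clocks V) \<in> sets (clocks V)"
      by (rule measurable_sets[OF measurable_relabel[OF q] sets_cgx_perm])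
    show "?A p \<in> sets (clocks V)"
      by (rule sets_cgx_perm)
  qed
  finally show ?thesis
    by (simp add: perm_law_def)
qed

section \<open>Isolated pairs\<close>

lemma measure_waiting_law_greaterThan:
  assumes "t \<ge> 0"
  shows "measure (waiting_law V) {t<..} = exp (- t / card V)"
    "measure (waiting_law V) {..t} = 1 - exp (- t / card V)"
proof -
  have D: "distributed (waiting_law V) lborel (\<lambda>x. x) (exponential_density (1 / card V))"
    unfolding distributed_def
    by (simp add: waiting_law_def distr_id2)
  show 1: "measure (waiting_law V) {t<..} = exp (- t / card V)"
    using prob_space.exponential_distributedD_gt[OF prob_space_waiting_law D assms] card_V_pos by (simp add: greaterThan_def)
  show "measure (waiting_law V) {..t} = 1 - exp (- t / card V)"
    using prob_space.exponential_distributedD_le[OF prob_space_waiting_law D assms] card_V_pos by (simp add: atMost_def)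
qed

text \<open>A crude substitute for the growth of ring times: with nonnegative waiting times, a
  single one above \<open>t\<close> leaves finitely many rings of that clock up to \<open>t\<close>.
  The first \<open>N\<close> waiting times all stay below \<open>t\<close> with a probability that
  decays geometrically.\<close>

lemma AE_unbounded:
  assumes t: "t \<ge> 0"
  shows "AE w in clocks V. \<forall>e\<in>pairs V. \<exists>k. t < w (e, k)"
proof (intro AE_ball_countable' countable_finite[OF finite_pairs_V])
  fix e assume e: "e \<in> pairs V"
  interpret C: prob_space "clocks V"
    by (rule prob_space_clocks)
  let ?q = "1 - exp (- t / card V)"
  let ?A = "{w \<in> space (clocks V). \<forall>k. w (e, k) \<le> t}"
  have meas: "?A \<in> sets (clocks V)"
    using e by (intro sets.sets_Collect_countable_All borel_measurable_le measurable_component measurable_const) auto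
  have "measure (clocks V) ?A \<le> ?q ^ N" for N
  proof -
    let ?B = "{w \<in> space (clocks V). \<forall>i\<in>{e} \<times> {..<N}. w i \<in> {..t}}"
    have "emeasure (clocks V) ?B = (\<Prod>i\<in>{e} \<times> {..<N}. emeasure (waiting_law V) {..t})"
      unfolding clocks_eq using e by (intro emeasure_PiM_Collect) (auto simp: sets_waiting_law)
    then have "measure (clocks V) ?B = measure (waiting_law V) {..t} ^ N"
      unfolding C.emeasure_eq_measure M.emeasure_eq_measure
      by (simp add: card_cartesian_product prod_ennreal ennreal_power)
    moreover have "?B \<in> sets (clocks V)"
      using e by (intro sets.sets_Collect_finite_All)
        (auto intro!: borel_measurable_le measurable_component)
    then have "measure (clocks V) ?A \<le> measure (clocks V) ?B"
      by (intro C.finite_measure_mono) auto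
    ultimately show ?thesis
      by (simp add: measure_waiting_law_greaterThan(2)[OF t])
  qed
  moreover have "(\<lambda>N. ?q ^ N) \<longlonglongrightarrow> 0"
    using t by (intro LIMSEQ_realpow_zero) simp_all
  ultimately have "measure (clocks V) ?A \<le> 0"
    by (intro LIMSEQ_le_const) auto
  then have "emeasure (clocks V) ?A = 0"
    by (simp add: C.emeasure_eq_measure measure_le_0_iff)
  then show "AE w in clocks V. \<exists>k. t < w (e, k)"
    by (intro AE_I[of _ _ ?A] meas) (auto simp: not_less)
qed

text \<open>Ringing exactly once would mean \<open>w (e, 0) + w (e, 1) > t\<close>. The stronger
  condition on \<open>w (e, 1)\<close> alone makes the event a product of conditions on single
  coordinates, so its probability is explicit.\<close>

definition isolated :: "real \<Rightarrow> 'a set \<Rightarrow> ('a set \<times> nat \<Rightarrow> real) \<Rightarrow> bool" where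
  "isolated t e w \<longleftrightarrow> w (e, 0) \<le> t \<and> t < w (e, 1) \<and>
     (\<forall>e'\<in>pairs V. e' \<noteq> e \<longrightarrow> e' \<inter> e \<noteq> {} \<longrightarrow> t < w (e', 0))"

lemma ring_time_ge:
  assumes "\<forall>i\<in>indices. 0 \<le> w i" "e \<in> pairs V" "j \<le> k"
  shows "w (e, j) \<le> ring_time w e k"
  unfolding ring_time_def using assms by (intro member_le_sum) auto

lemma finite_ring_times_upto:
  assumes nn: "\<forall>i\<in>indices. 0 \<le> w i" and ub: "\<forall>e\<in>pairs V. \<exists>k. t < w (e, k)"
  shows "finite (ring_times_upto V w t)"
proof -
  from ub obtain K where K: "\<And>e. e \<in> pairs V \<Longrightarrow> t < w (e, K e)"
    by metis
  have "ring_times_upto V w t \<subseteq> (\<lambda>(e, k). ring_time w e k) ` (SIGMA e:pairs V. {..<K e})"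
  proof
    fix s assume "s \<in> ring_times_upto V w t"
    then obtain e k where s: "e \<in> pairs V" "s = ring_time w e k" "s \<le> t"
      by (auto simp: ring_times_upto_def)
    have "k < K e"
    proof (rule ccontr)
      assume "\<not> k < K e"
      then have "w (e, K e) \<le> ring_time w e k"
        by (intro ring_time_ge[OF nn s(1)]) simp
      then show False
        using K[OF s(1)] s by simp
    qed
    then show "s \<in> (\<lambda>(e, k). ring_time w e k) ` (SIGMA e:pairs V. {..<K e})"
      using s by force
  qed
  then show ?thesis
    by (rule finite_subset) (use finite_pairs_V in auto)
qed

lemma fold_swap_disjoint:
  assumes "\<And>s. s \<in> set ss \<Longrightarrow> \<pi> x \<notin> E s"
  shows "fold (\<lambda>s \<pi>. swap_pair (E s) \<circ> \<pi>) ss \<pi> x = \<pi> x"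
  using assms
proof (induction ss arbitrary: \<pi>)
  case Nil
  then show ?case by simp
next
  case (Cons s ss)
  have eq: "(swap_pair (E s) \<circ> \<pi>) x = \<pi> x"
    using Cons.prems[of s] by (simp add: swap_pair_def)
  have "fold (\<lambda>s \<pi>. swap_pair (E s) \<circ> \<pi>) ss (swap_pair (E s) \<circ> \<pi>) x = (swap_pair (E s) \<circ> \<pi>) x"
    by (rule Cons.IH) (use Cons.prems eq in simp)
  then show ?case
    unfolding fold_simps eq .
qed

lemma isolated_moved:
  assumes tf: "tie_free w" and nn: "\<forall>i\<in>indices. 0 \<le> w i"
    and ub: "\<forall>e\<in>pairs V. \<exists>k. t < w (e, k)"
    and e: "e \<in> pairs V" "isolated t e w" and x: "x \<in> e"
  shows "cgx_perm V w t x \<noteq> x"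
proof -
  let ?ss = "sorted_list_of_set (ring_times_upto V w t)"
  let ?E = "ringing_pair V w"
  define s0 where "s0 = w (e, 0)"
  have s0: "s0 = ring_time w e 0"
    by (simp add: s0_def ring_time_def)
  have set: "set ?ss = ring_times_upto V w t" and dist: "distinct ?ss"
    using finite_ring_times_upto[OF nn ub] by auto
  have "s0 \<le> t"
    using e(2) by (simp add: isolated_def s0_def)
  then have "s0 \<in> ring_times_upto V w t"
    unfolding ring_times_upto_def using e(1) s0 by blast
  then have "s0 \<in> set ?ss"
    unfolding set .
  then obtain as bs where ss: "?ss = as @ s0 # bs"
    by (meson split_list)
  \<comment> \<open>A further ring of \<open>e\<close> comes no earlier than
    \<open>w (e, 1)\<close>, hence after \<open>t\<close>, and no other pair touching
    \<open>e\<close> has rung by time \<open>t\<close>.\<close>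
  have disj: "?E s \<inter> e = {}" if s: "s \<in> set ?ss" "s \<noteq> s0" for s
  proof (rule ccontr)
    assume inter: "?E s \<inter> e \<noteq> {}"
    have st: "s \<in> ring_times_upto V w t"
      using s(1) set by simp
    then obtain k where k: "?E s \<in> pairs V" "s = ring_time w (?E s) k" "s \<le> t"
      using ringing_pair_props[OF st] by (auto simp: ring_times_upto_def)
    show False
    proof (cases "?E s = e")
      case True
      then have "k \<noteq> 0"
        using k(2) s(2) s0 by metis
      then have "w (e, 1) \<le> s"
        using ring_time_ge[OF nn e(1), of 1 k] True k(2) by simp
      then show False
        using e(2) k(3) by (simp add: isolated_def)
    next
      case False
      then have "t < w (?E s, 0)"
        using e(2) k(1) inter by (simp add: isolated_def)
      moreover have "w (?E s, 0) \<le> s"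
        using ring_time_ge[OF nn k(1), of 0 k] k(2) by simp
      ultimately show False
        using k(3) by simp
    qed
  qed
  have E0: "?E s0 = e"
    unfolding s0 by (rule ringing_pair_unique[OF tf e(1)])
  have ab: "?E s \<inter> e = {}" if "s \<in> set as \<union> set bs" for s
    using that dist disj[of s] unfolding ss by auto
  obtain a b where e2: "e = {a, b}" "a \<noteq> b"
    using e(1) by (rule pairsE)
  let ?f = "\<lambda>s \<pi>. swap_pair (?E s) \<circ> \<pi>"
  have sx: "swap_pair e x \<in> e" "swap_pair e x \<noteq> x"
    using x e2 by (auto simp: swap_pair_doubleton)
  have as: "fold ?f as id x = x"
    using fold_swap_disjoint[of as id x ?E] ab x by auto
  then have mid: "(swap_pair e \<circ> fold ?f as id) x = swap_pair e x"
    by simp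
  have "cgx_perm V w t x = fold ?f bs (swap_pair e \<circ> fold ?f as id) x"
    unfolding cgx_perm_def ss fold_append o_apply fold_simps E0 ..
  \<comment> \<open>After its only swap the point sits at the other end of \<open>e\<close>, which
    no later ring touches.\<close>
  also have "\<dots> = (swap_pair e \<circ> fold ?f as id) x"
    by (rule fold_swap_disjoint) (use ab sx mid in auto)
  finally show ?thesis
    using mid sx by simp
qed

text \<open>For touching pairs the first ring of \<open>e'\<close> would have to come both after
  \<open>t\<close> and by \<open>t\<close>.\<close>

lemma isolated_disjoint:
  assumes "e \<in> pairs V" "e' \<in> pairs V" "e \<noteq> e'" "isolated t e w" "isolated t e' w"
  shows "e \<inter> e' = {}"
  using assms unfolding isolated_def by (metis inf_commute not_less)

lemma card_moved_ge:
  assumes "tie_free w" "\<forall>i\<in>indices. 0 \<le> w i" "\<forall>e\<in>pairs V. \<exists>k. t < w (e, k)"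
  shows "2 * card {e \<in> pairs V. isolated t e w} \<le> card {x. cgx_perm V w t x \<noteq> x}"
proof -
  let ?I = "{e \<in> pairs V. isolated t e w}"
  have "card (\<Union>?I) = (\<Sum>e\<in>?I. card e)"
  proof (rule card_Union_disjoint)
    show "pairwise disjnt ?I"
      unfolding pairwise_def disjnt_def using isolated_disjoint[of _ _ t w] by blast
    show "finite e" if "e \<in> ?I" for e
      using that finite_V finite_subset unfolding pairs_def by blast
  qed
  also have "\<dots> = 2 * card ?I"
    by (simp add: pairs_def)
  finally have "2 * card ?I = card (\<Union>?I)" ..
  also have "\<dots> \<le> card {x. cgx_perm V w t x \<noteq> x}"
  proof (rule card_mono)
    have "{x. cgx_perm V w t x \<noteq> x} \<subseteq> V"
      using cgx_perm_permutes[of V w t] by (auto simp: permutes_def)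
    then show "finite {x. cgx_perm V w t x \<noteq> x}"
      using finite_V by (rule finite_subset)
    show "\<Union>?I \<subseteq> {x. cgx_perm V w t x \<noteq> x}"
      using isolated_moved[OF assms] by auto
  qed
  finally show ?thesis .
qed

end

lemma card_pairs: "finite W \<Longrightarrow> card (pairs W) = card W choose 2"
  unfolding pairs_def by (rule n_subsets)

lemma two_times_choose_two: "2 * (n choose 2) = n * (n - 1)"
proof -
  have "even (n * (n - 1))"
    by (cases n) auto
  then show ?thesis
    by (simp add: choose_two)
qed

context clock_system
begin

section \<open>Moments of the number of isolated pairs\<close>

definition adjacent_pairs :: "'a set set \<Rightarrow> 'a set set" where
  "adjacent_pairs E = {e' \<in> pairs V. e' \<notin> E \<and> (\<exists>e\<in>E. e' \<inter> e \<noteq> {})}"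

text \<open>The pairs split into \<open>E\<close>, the pairs touching \<open>E\<close>, and the
  pairs within the uncovered sites. The additive form avoids truncated subtraction.\<close>

lemma card_adjacent_pairs:
  assumes E: "E \<subseteq> pairs V" "pairwise disjnt E"
  shows "card (adjacent_pairs E) + card E + ((card V - 2 * card E) choose 2) = card V choose 2"
    "2 * card E \<le> card V"
proof -
  have fin: "finite E" "finite (adjacent_pairs E)" "finite (pairs (V - \<Union>E))"
    using finite_subset[OF E(1) finite_pairs_V] finite_pairs_V finite_V finite_pairs[of "V - \<Union>E"]
    by (auto simp: adjacent_pairs_def)
  have sub: "\<Union>E \<subseteq> V"
    using E(1) by (auto simp: pairs_def)
  have "card (\<Union>E) = (\<Sum>e\<in>E. card e)"
  proof (rule card_Union_disjoint[OF E(2)])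
    show "finite e" if "e \<in> E" for e
      using that E(1) finite_V finite_subset unfolding pairs_def by blast
  qed
  also have "\<dots> = (\<Sum>e\<in>E. 2)"
    using E(1) by (intro sum.cong) (auto simp: pairs_def)
  finally have cU: "card (\<Union>E) = 2 * card E"
    by simp
  show "2 * card E \<le> card V"
    using card_mono[OF finite_V sub] cU by simp
  have "pairs V = adjacent_pairs E \<union> E \<union> pairs (V - \<Union>E)"
    using E(1) unfolding adjacent_pairs_def pairs_def by blast
  moreover have "(adjacent_pairs E \<union> E) \<inter> pairs (V - \<Union>E) = {}"
  proof -
    have "e \<noteq> {}" if "e \<in> pairs W" for e :: "'a set" and W
      using that by (auto simp: pairs_def)
    then show ?thesis
      unfolding adjacent_pairs_def pairs_def by blast
  qed
  moreover have "adjacent_pairs E \<inter> E = {}"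
    by (auto simp: adjacent_pairs_def)
  ultimately have "card (pairs V) = card (adjacent_pairs E) + card E + card (pairs (V - \<Union>E))"
    using fin by (simp add: card_Un_disjoint)
  moreover have "card (V - \<Union>E) = card V - 2 * card E"
    using cU finite_subset[OF sub finite_V] sub by (simp add: card_Diff_subset)
  ultimately show "card (adjacent_pairs E) + card E + ((card V - 2 * card E) choose 2) = card V choose 2"
    using finite_V by (simp add: card_pairs)
qed

lemma sets_isolated:
  assumes "e \<in> pairs V"
  shows "{w \<in> space (clocks V). isolated t e w} \<in> sets (clocks V)"
  unfolding isolated_def
proof (intro sets.sets_Collect_conj sets.sets_Collect_finite_All[OF _ finite_pairs_V])
  fix e' assume "e' \<in> pairs V"
  then show "{w \<in> space (clocks V). e' \<noteq> e \<longrightarrow> e' \<inter> e \<noteq> {} \<longrightarrow> t < w (e', 0)} \<in> sets (clocks V)"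
    by (intro sets.sets_Collect_imp sets.sets_Collect_const borel_measurable_less measurable_component) auto
qed (use assms in \<open>auto intro!: borel_measurable_le borel_measurable_less measurable_component\<close>)

text \<open>The event is a box. A clock adjacent to several members of \<open>E\<close> enters it
  only once, which is the sole source of correlation between disjoint pairs.\<close>

lemma measure_isolated:
  assumes t: "t \<ge> 0" and E: "E \<subseteq> pairs V" "pairwise disjnt E"
  shows "measure (clocks V) {w \<in> space (clocks V). \<forall>e\<in>E. isolated t e w}
    = (1 - exp (- t / card V)) ^ card E * exp (- t / card V) ^ (card E + card (adjacent_pairs E))"
proof -
  interpret C: prob_space "clocks V"
    by (rule prob_space_clocks)
  let ?q = "exp (- t / card V)"
  let ?A = "adjacent_pairs E"
  let ?J0 = "E \<times> {0::nat}" and ?J1 = "E \<times> {1::nat} \<union> ?A \<times> {0}"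
  define X where "X i = (if i \<in> ?J0 then {..t} else {t<..})" for i
  have fin: "finite E" "finite ?A"
    using finite_subset[OF E(1) finite_pairs_V] finite_pairs_V by (auto simp: adjacent_pairs_def)
  have AE: "?A \<inter> E = {}" and AV: "?A \<subseteq> pairs V"
    by (auto simp: adjacent_pairs_def)
  have iff: "(\<forall>e\<in>E. isolated t e w) \<longleftrightarrow> (\<forall>i\<in>?J0 \<union> ?J1. w i \<in> X i)" for w
  proof
    assume iso: "\<forall>e\<in>E. isolated t e w"
    show "\<forall>i\<in>?J0 \<union> ?J1. w i \<in> X i"
    proof
      fix i assume "i \<in> ?J0 \<union> ?J1"
      then consider e where "e \<in> E" "i = (e, 0)" | e where "e \<in> E" "i = (e, 1)" | e where "e \<in> ?A" "i = (e, 0)"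
        by blast
      then show "w i \<in> X i"
      proof cases
        case 1
        then show ?thesis using iso by (auto simp: X_def isolated_def)
      next
        case 2
        then show ?thesis using iso by (auto simp: X_def isolated_def)
      next
        case (3 e')
        then obtain e where "e \<in> E" "e' \<in> pairs V" "e' \<noteq> e" "e' \<inter> e \<noteq> {}" "e' \<notin> E"
          by (auto simp: adjacent_pairs_def)
        then show ?thesis using iso 3 by (auto simp: X_def isolated_def)
      qed
    qed
  next
    assume w: "\<forall>i\<in>?J0 \<union> ?J1. w i \<in> X i"
    show "\<forall>e\<in>E. isolated t e w"
    proof
      fix e assume e: "e \<in> E"
      have "w (e, 0) \<le> t" "t < w (e, 1)"
        using bspec[OF w, of "(e, 0)"] bspec[OF w, of "(e, 1)"] e by (auto simp: X_def)
      moreover have "t < w (e', 0)" if "e' \<in> pairs V" "e' \<noteq> e" "e' \<inter> e \<noteq> {}" for e'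
      proof -
        have "e' \<notin> E"
          using E(2) e that(2,3) unfolding pairwise_def disjnt_def by blast
        then have "e' \<in> ?A"
          using that e by (auto simp: adjacent_pairs_def)
        then show ?thesis
          using bspec[OF w, of "(e', 0)"] \<open>e' \<notin> E\<close> by (auto simp: X_def)
      qed
      ultimately show "isolated t e w"
        by (simp add: isolated_def)
    qed
  qed
  have "emeasure (clocks V) {w \<in> space (clocks V). \<forall>i\<in>?J0 \<union> ?J1. w i \<in> X i}
      = (\<Prod>i\<in>?J0 \<union> ?J1. emeasure (waiting_law V) (X i))"
    unfolding clocks_eq using fin E(1) AV
    by (intro emeasure_PiM_Collect) (auto simp: X_def sets_waiting_law)
  then have "measure (clocks V) {w \<in> space (clocks V). \<forall>i\<in>?J0 \<union> ?J1. w i \<in> X i}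
      = (\<Prod>i\<in>?J0 \<union> ?J1. measure (waiting_law V) (X i))"
    unfolding C.emeasure_eq_measure M.emeasure_eq_measure
    by (simp add: prod_ennreal prod_nonneg)
  also have "\<dots> = (\<Prod>i\<in>?J0. measure (waiting_law V) (X i)) * (\<Prod>i\<in>?J1. measure (waiting_law V) (X i))"
    using fin AE by (intro prod.union_disjoint) auto
  also have "(\<Prod>i\<in>?J0. measure (waiting_law V) (X i)) = (\<Prod>i\<in>?J0. 1 - ?q)"
    by (intro prod.cong) (auto simp: X_def measure_waiting_law_greaterThan[OF t])
  also have "(\<Prod>i\<in>?J1. measure (waiting_law V) (X i)) = (\<Prod>i\<in>?J1. ?q)"
    using AE by (intro prod.cong) (auto simp: X_def measure_waiting_law_greaterThan[OF t])
  also have "card ?J1 = card E + card ?A"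
    using fin AE by (subst card_Un_disjoint) (auto simp: card_cartesian_product)
  then have "(\<Prod>i\<in>?J1. ?q) = ?q ^ (card E + card ?A)"
    by simp
  also have "(\<Prod>i\<in>?J0. 1 - ?q) = (1 - ?q) ^ card E"
    by (simp add: card_cartesian_product)
  finally show ?thesis
    unfolding iff .
qed

text \<open>The exponent counts the second waiting time of the pair itself and the first ones of the
  \<open>2 * (card V - 2)\<close> pairs touching it.\<close>

definition iso_prob :: "real \<Rightarrow> real" where
  "iso_prob t = (1 - exp (- t / card V)) * exp (- t / card V) ^ (2 * card V - 3)"

lemma measure_isolated_single:
  assumes t: "t \<ge> 0" and e: "e \<in> pairs V"
  shows "measure (clocks V) {w \<in> space (clocks V). isolated t e w} = iso_prob t"
proof -
  have E: "{e} \<subseteq> pairs V" "pairwise disjnt {e}"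
    using e by (auto simp: pairwise_def)
  have n2: "2 \<le> card V"
    using card_adjacent_pairs(2)[OF E] by simp
  then obtain m where m: "card V = m + 2"
    using le_Suc_ex by (metis add.commute)
  have "2 * ((m + 2) choose 2) = (m + 2) * (m + 1)" "2 * (m choose 2) = m * (m - 1)"
    by (simp_all add: two_times_choose_two)
  then have "2 * (card (adjacent_pairs {e}) + 1) + m * (m - 1) = (m + 2) * (m + 1)"
    using card_adjacent_pairs(1)[OF E] m by simp
  then have "card (adjacent_pairs {e}) = 2 * m"
    by (cases m) (auto simp: algebra_simps)
  then have "1 + card (adjacent_pairs {e}) = 2 * card V - 3"
    using m by simp
  then show ?thesis
    using measure_isolated[OF t E] by (simp add: iso_prob_def)
qed

text \<open>Touching pairs are never both isolated. For disjoint ones, the four clocks joining them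
  count twice in the square but once in the joint event, which leaves four surplus factors
  \<open>exp (- t / card V)\<close> to be compensated.\<close>

lemma measure_isolated_both:
  assumes t: "t \<ge> 0" and e: "e \<in> pairs V" "e' \<in> pairs V" "e \<noteq> e'"
  shows "measure (clocks V) {w \<in> space (clocks V). isolated t e w \<and> isolated t e' w}
    \<le> (iso_prob t)\<^sup>2 * exp (4 * t / card V)"
proof (cases "e \<inter> e' = {}")
  case False
  then have "{w \<in> space (clocks V). isolated t e w \<and> isolated t e' w} = {}"
    using isolated_disjoint[OF e] by blast
  then have "measure (clocks V) {w \<in> space (clocks V). isolated t e w \<and> isolated t e' w} = 0"
    by (simp only: measure_empty)
  then show ?thesis by simp
next
  case True
  let ?q = "exp (- t / card V)"
  have E: "{e, e'} \<subseteq> pairs V" "pairwise disjnt {e, e'}"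
    using e True by (auto simp: pairwise_def disjnt_def)
  have c: "card {e, e'} = 2"
    using e(3) by simp
  have "4 \<le> card V"
    using card_adjacent_pairs(2)[OF E] c by simp
  then obtain m where m: "card V = m + 4"
    using le_Suc_ex by (metis add.commute)
  have "2 * ((m + 4) choose 2) = (m + 4) * (m + 3)" "2 * (m choose 2) = m * (m - 1)"
    by (simp_all add: two_times_choose_two)
  then have "2 * (card (adjacent_pairs {e, e'}) + 2) + m * (m - 1) = (m + 4) * (m + 3)"
    using card_adjacent_pairs(1)[OF E] m c by simp
  then have "card (adjacent_pairs {e, e'}) = 4 * m + 4"
    by (cases m) (auto simp: algebra_simps)
  then have k: "2 * (2 * card V - 3) = 4 + (2 + card (adjacent_pairs {e, e'}))"
    using m by simp
  have "(iso_prob t)\<^sup>2 = (1 - ?q)\<^sup>2 * ?q ^ (2 * (2 * card V - 3))"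
    unfolding iso_prob_def power_mult_distrib power_mult[symmetric] by (simp only: mult.commute[of 2])
  also have "\<dots> = (1 - ?q)\<^sup>2 * ?q ^ (2 + card (adjacent_pairs {e, e'})) * ?q ^ 4"
    unfolding k power_add[of _ 4] by simp
  also have "(1 - ?q)\<^sup>2 * ?q ^ (2 + card (adjacent_pairs {e, e'}))
      = measure (clocks V) {w \<in> space (clocks V). isolated t e w \<and> isolated t e' w}"
    using measure_isolated[OF t E] by (simp only: c) simp
  finally have "(iso_prob t)\<^sup>2 * exp (4 * t / card V)
      = measure (clocks V) {w \<in> space (clocks V). isolated t e w \<and> isolated t e' w} * (?q ^ 4 * exp (4 * t / card V))"
    by simp
  also have "?q ^ 4 * exp (4 * t / card V) = 1"
    by (simp add: exp_of_nat_mult[symmetric] exp_add[symmetric])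
  finally show ?thesis by simp
qed

text \<open>Chebyshev at distance \<open>\<mu> / 2\<close>. The variance is at most
  \<open>\<mu>\<close>, from the diagonal, plus
  \<open>\<mu>\<^sup>2 * (exp (4 * t / card V) - 1)\<close>, from the weak correlation.\<close>

lemma isolated_count_lower_tail:
  fixes t :: real
  assumes t: "t > 0" and n: "2 \<le> card V"
  defines "\<mu> \<equiv> (card V choose 2) * iso_prob t"
  shows "measure (clocks V) {w \<in> space (clocks V). \<mu> / 2 \<le> \<bar>real (card {e \<in> pairs V. isolated t e w}) - \<mu>\<bar>}
    \<le> 4 / \<mu> + 4 * (exp (4 * t / card V) - 1)"
proof -
  interpret C: prob_space "clocks V"
    by (rule prob_space_clocks)
  let ?I = "\<lambda>e. {w \<in> space (clocks V). isolated t e w}"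
  let ?x = "exp (4 * t / card V)"
  let ?a = "iso_prob t"
  define N where "N w = (\<Sum>e\<in>pairs V. indicator (?I e) w :: real)" for w
  have N: "N w = real (card {e \<in> pairs V. isolated t e w})" if "w \<in> space (clocks V)" for w
    using that finite_pairs_V by (simp add: N_def indicator_def Int_def)
  have I [measurable]: "?I e \<in> sets (clocks V)" if "e \<in> pairs V" for e
    using sets_isolated[OF that] .
  have card: "real (card (pairs V)) = real (card V choose 2)"
    using card_pairs[OF finite_V] by simp
  have "exp (- t / card V) < 1"
    using t n by simp
  then have a: "?a > 0"
    by (simp add: iso_prob_def)
  have mu: "\<mu> > 0"
    using a n by (simp add: \<mu>_def)
  have N_sq: "(N w)\<^sup>2 = (\<Sum>e\<in>pairs V. \<Sum>e'\<in>pairs V. indicator (?I e \<inter> ?I e') w)" for w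
    by (simp add: N_def power2_eq_square sum_product indicator_inter_arith)
  have meas: "N \<in> borel_measurable (clocks V)"
    unfolding N_def by (intro borel_measurable_sum borel_measurable_indicator I)
  have int_sq: "integrable (clocks V) (\<lambda>w. (N w)\<^sup>2)"
    unfolding N_sq
    by (intro Bochner_Integration.integrable_sum integrable_real_indicator sets.Int I)
      (auto simp: C.emeasure_eq_measure)
  have EN: "C.expectation N = \<mu>"
  proof -
    have "C.expectation N = (\<Sum>e\<in>pairs V. C.prob (?I e))"
      unfolding N_def
      by (subst Bochner_Integration.integral_sum) (auto simp: C.emeasure_eq_measure intro!: sum.cong)
    also have "\<dots> = (\<Sum>e\<in>pairs V. ?a)"
      using t by (intro sum.cong measure_isolated_single) auto
    finally show ?thesis
      by (simp add: \<mu>_def card)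
  qed
  have "C.expectation (\<lambda>w. (N w)\<^sup>2) = (\<Sum>e\<in>pairs V. \<Sum>e'\<in>pairs V. C.prob (?I e \<inter> ?I e'))"
    unfolding N_sq
    by (subst Bochner_Integration.integral_sum)
      (auto simp: C.emeasure_eq_measure intro!: sum.cong Bochner_Integration.integrable_sum
        integrable_real_indicator sets.Int I trans[OF Bochner_Integration.integral_sum])
  also have "\<dots> \<le> (\<Sum>e\<in>pairs V. \<Sum>e'\<in>pairs V. (if e = e' then ?a else 0) + ?a\<^sup>2 * ?x)"
  proof (intro sum_mono)
    fix e e' assume e: "e \<in> pairs V" "e' \<in> pairs V"
    show "C.prob (?I e \<inter> ?I e') \<le> (if e = e' then ?a else 0) + ?a\<^sup>2 * ?x"
    proof (cases "e = e'")
      case True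
      then show ?thesis
        using measure_isolated_single[of t e] t e by simp
    next
      case False
      have "?I e \<inter> ?I e' = {w \<in> space (clocks V). isolated t e w \<and> isolated t e' w}"
        by blast
      then show ?thesis
        using measure_isolated_both[of t e e'] t e False by simp
    qed
  qed
  also have "\<dots> = \<mu> + \<mu>\<^sup>2 * ?x"
    using finite_pairs_V by (simp add: sum.distrib card \<mu>_def power2_eq_square algebra_simps)
  finally have ENsq: "C.expectation (\<lambda>w. (N w)\<^sup>2) \<le> \<mu> + \<mu>\<^sup>2 * ?x" .
  have "C.prob {w \<in> space (clocks V). \<mu> / 2 \<le> \<bar>N w - C.expectation N\<bar>} \<le> C.variance N / (\<mu> / 2)\<^sup>2"
    using mu by (intro C.Chebyshev_inequality meas int_sq) simp
  also have "C.variance N = C.expectation (\<lambda>w. (N w)\<^sup>2) - \<mu>\<^sup>2"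
    using C.variance_eq[OF C.square_integrable_imp_integrable[OF meas int_sq] int_sq] by (simp only: EN)
  also have "(C.expectation (\<lambda>w. (N w)\<^sup>2) - \<mu>\<^sup>2) / (\<mu> / 2)\<^sup>2 \<le> (\<mu> + \<mu>\<^sup>2 * ?x - \<mu>\<^sup>2) / (\<mu> / 2)\<^sup>2"
    using ENsq by (intro divide_right_mono) auto
  also have "\<dots> = 4 / \<mu> + 4 * (?x - 1)"
    using mu by (simp add: field_simps power2_eq_square)
  finally have "C.prob {w \<in> space (clocks V). \<mu> / 2 \<le> \<bar>N w - \<mu>\<bar>} \<le> 4 / \<mu> + 4 * (?x - 1)"
    by (simp only: EN)
  moreover have "{w \<in> space (clocks V). \<mu> / 2 \<le> \<bar>N w - \<mu>\<bar>}
      = {w \<in> space (clocks V). \<mu> / 2 \<le> \<bar>real (card {e \<in> pairs V. isolated t e w}) - \<mu>\<bar>}"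
    using N by auto
  ultimately show ?thesis by simp
qed

text \<open>With \<open>n = card V\<close>, the factor 1/8 is 1/4 from
  \<open>n choose 2 \<ge> n\<^sup>2 / 4\<close> times 1/2 from
  \<open>1 - exp (- t / n) \<ge> t / (2 * n)\<close>. Fewer than \<open>2 * n\<close> silent waiting
  times cost at most the factor \<open>exp (- 2 * t)\<close>.\<close>

lemma expected_isolated_ge:
  fixes t :: real
  assumes t: "t > 0" "t \<le> card V" and n: "2 \<le> card V"
  shows "card V * (t * exp (- 2 * t) / 8) \<le> (card V choose 2) * iso_prob t"
proof -
  let ?n = "real (card V)"
  let ?q = "exp (- t / ?n)"
  have n0: "?n > 0"
    using n by simp
  have "1 + t / ?n \<le> exp (t / ?n)"
    by (rule exp_ge_add_one_self)
  then have "?q \<le> 1 / (1 + t / ?n)"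
    using t n0 by (simp add: exp_minus inverse_eq_divide frac_le add_pos_nonneg)
  also have "\<dots> \<le> 1 - t / (2 * ?n)"
  proof -
    define x where "x = t / ?n"
    have x: "0 < x" "x \<le> 1"
      using t n0 by (simp_all add: x_def)
    then have "x * x \<le> x * 1"
      by (intro mult_left_mono) auto
    then have "1 \<le> (1 - x / 2) * (1 + x)"
      by (simp add: algebra_simps)
    then have "1 / (1 + x) \<le> 1 - x / 2"
      using x by (simp add: divide_le_eq)
    then show ?thesis
      by (simp add: x_def mult.commute)
  qed
  finally have q1: "t / (2 * ?n) \<le> 1 - ?q"
    by simp
  have "?q ^ (2 * card V - 3) = exp (real (2 * card V - 3) * (- t / ?n))"
    by (rule exp_of_nat_mult[symmetric])
  moreover have "- 2 * t \<le> real (2 * card V - 3) * (- t / ?n)"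
  proof -
    have "real (2 * card V - 3) * (t / ?n) \<le> (2 * ?n) * (t / ?n)"
      using t n0 by (intro mult_right_mono) auto
    then show ?thesis
      using n0 by simp
  qed
  ultimately have q2: "exp (- 2 * t) \<le> ?q ^ (2 * card V - 3)"
    by simp
  have "2 * (card V choose 2) = card V * (card V - 1)"
    by (rule two_times_choose_two)
  then have "real (2 * (card V choose 2)) = real (card V * (card V - 1))"
    by (simp only:)
  then have "2 * real (card V choose 2) = ?n * (?n - 1)"
    using n by (simp add: of_nat_diff)
  moreover have "?n * (?n / 2) \<le> ?n * (?n - 1)"
    using n by (intro mult_left_mono) auto
  ultimately have c: "?n * ?n / 4 \<le> real (card V choose 2)"
    by simp
  have "?n * (t * exp (- 2 * t) / 8) = (?n * ?n / 4) * (t / (2 * ?n) * exp (- 2 * t))"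
    using n0 by (simp add: field_simps)
  also have "\<dots> \<le> (card V choose 2) * ((1 - ?q) * ?q ^ (2 * card V - 3))"
    using t n0 q1 by (intro mult_mono c q1 q2) auto
  finally show ?thesis
    by (simp add: iso_prob_def)
qed

section \<open>From the random permutation to a fixed one\<close>

lemma sum_perm_law:
  "(\<Sum>p\<in>{p. p permutes V \<and> Q p}. perm_law t p)
    = measure (clocks V) {w \<in> space (clocks V). Q (cgx_perm V w t)}"
proof -
  interpret C: prob_space "clocks V"
    by (rule prob_space_clocks)
  let ?A = "\<lambda>p. {w \<in> space (clocks V). cgx_perm V w t = p}"
  have "(\<Sum>p\<in>{p. p permutes V \<and> Q p}. perm_law t p) = C.prob (\<Union>p\<in>{p. p permutes V \<and> Q p}. ?A p)"
    unfolding perm_law_def using finite_perms[OF finite_V] sets_cgx_perm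
    by (intro C.finite_measure_finite_Union[symmetric]) (auto simp: disjoint_family_on_def)
  also have "(\<Union>p\<in>{p. p permutes V \<and> Q p}. ?A p) = {w \<in> space (clocks V). Q (cgx_perm V w t)}"
    using cgx_perm_permutes[of V _ t] by auto
  finally show ?thesis .
qed

lemma perm_law_nonneg: "0 \<le> perm_law t p"
  by (simp add: perm_law_def)

text \<open>Off the tail event more than \<open>\<mu> / 2\<close> pairs are isolated, and each moves
  two points, which regains the half lost to Chebyshev. The two smallness hypotheses contribute 1/4
  each to the exceptional probability.\<close>

lemma perm_law_moved:
  fixes t :: real
  assumes t: "t > 0" "t \<le> card V" and n: "2 \<le> card V"
    and small: "4 / (card V * (t * exp (- 2 * t) / 8)) \<le> 1 / 4" "4 * (exp (4 * t / card V) - 1) \<le> 1 / 4"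
  shows "1 / 2 \<le> (\<Sum>p\<in>{p. p permutes V \<and> card V * (t * exp (- 2 * t) / 8) \<le> card {x. p x \<noteq> x}}. perm_law t p)"
proof -
  interpret C: prob_space "clocks V"
    by (rule prob_space_clocks)
  let ?m = "card V * (t * exp (- 2 * t) / 8)"
  let ?N = "\<lambda>w. real (card {e \<in> pairs V. isolated t e w})"
  define \<mu> where "\<mu> = (card V choose 2) * iso_prob t"
  have m: "0 < ?m" "?m \<le> \<mu>"
    using expected_isolated_ge[OF t n] t n by (auto simp: \<mu>_def)
  let ?bad = "{w \<in> space (clocks V). \<mu> / 2 \<le> \<bar>?N w - \<mu>\<bar>}"
  let ?good = "{w \<in> space (clocks V). ?m \<le> card {x. cgx_perm V w t x \<noteq> x}}"
  have "C.prob ?bad \<le> 4 / \<mu> + 4 * (exp (4 * t / card V) - 1)"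
    unfolding \<mu>_def by (rule isolated_count_lower_tail[OF t(1) n])
  also have "4 / \<mu> \<le> 4 / ?m"
    using m by (intro divide_left_mono) auto
  finally have bad: "C.prob ?bad \<le> 1 / 2"
    using small by linarith
  have sets_good: "?good \<in> sets (clocks V)"
  proof -
    have "?good = (\<Union>p\<in>{p. p permutes V \<and> ?m \<le> card {x. p x \<noteq> x}}. {w \<in> space (clocks V). cgx_perm V w t = p})"
      using cgx_perm_permutes[of V _ t] by auto
    then show ?thesis
      using finite_perms[OF finite_V] sets_cgx_perm by (auto intro!: sets.finite_UN)
  qed
  have sets_bad: "?bad \<in> sets (clocks V)"
  proof -
    have eq: "?N w = (\<Sum>e\<in>pairs V. indicator {w \<in> space (clocks V). isolated t e w} w)"
      if "w \<in> space (clocks V)" for w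
      using that finite_pairs_V by (simp add: indicator_def Int_def)
    let ?S = "\<lambda>w. \<Sum>e\<in>pairs V. indicator {w \<in> space (clocks V). isolated t e w} w :: real"
    have "?N \<in> borel_measurable (clocks V) \<longleftrightarrow> ?S \<in> borel_measurable (clocks V)"
      by (rule measurable_cong) (rule eq)
    moreover have "?S \<in> borel_measurable (clocks V)"
      by (intro borel_measurable_sum borel_measurable_indicator sets_isolated)
    ultimately have "?N \<in> borel_measurable (clocks V)"
      by (simp only:)
    then show ?thesis
      by (intro borel_measurable_le borel_measurable_const borel_measurable_abs borel_measurable_diff)
  qed
  have "AE w in clocks V. w \<in> ?good \<union> ?bad"
    using AE_tie_free AE_nonneg AE_unbounded[OF less_imp_le[OF t(1)]] AE_space
  proof eventually_elim
    case (elim w)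
    have "2 * ?N w \<le> card {x. cgx_perm V w t x \<noteq> x}"
      using card_moved_ge[OF elim(1-3)] by linarith
    then show ?case
      using elim(4) m by (auto simp: abs_if split: if_splits)
  qed
  then have "C.prob (?good \<union> ?bad) = 1"
    using sets_good sets_bad by (subst C.prob_eq_1) auto
  moreover have "C.prob (?good \<union> ?bad) \<le> C.prob ?good + C.prob ?bad"
    by (rule measure_Un_le[OF sets_good sets_bad])
  ultimately show ?thesis
    using bad by (subst sum_perm_law) linarith
qed

text \<open>Conjugating the random permutation by every \<open>r\<close> and averaging produces the average over \<open>r\<close>
  in \<^const>\<open>perm_dist\<close>.\<close>

lemma sum_perm_law_perm_dist:
  "(\<Sum>p\<in>{p. p permutes V}. perm_law t p * cube_mean V (\<lambda>S. of_bool (F S \<noteq> F (p ` S))))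
    = (\<Sum>p\<in>{p. p permutes V}. perm_law t p * cube_mean V (\<lambda>S. perm_dist V F S (p ` S)))"
proof -
  let ?P = "{p. p permutes V}"
  let ?h = "\<lambda>p. cube_mean V (\<lambda>S. of_bool (F S \<noteq> F (p ` S)))"
  have finP: "finite ?P"
    by (rule finite_permutations[OF finite_V])
  \<comment> \<open>As the law is constant on conjugacy classes, \<open>p\<close> may be replaced by
    its conjugate, and the uniform \<open>S\<close> by its image under \<open>r\<close>.\<close>
  have conj: "(\<Sum>p\<in>?P. perm_law t p * ?h p)
      = (\<Sum>p\<in>?P. perm_law t p * cube_mean V (\<lambda>S. of_bool (F (r ` S) \<noteq> F (r ` p ` S))))"
    if r: "r permutes V" for r
  proof -
    let ?c = "\<lambda>p. r \<circ> p \<circ> inv r"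
    have ii: "inv (inv r) = r"
      by (rule inv_inv_eq[OF permutes_bij[OF r]])
    have bij: "bij_betw ?c ?P ?P"
      by (rule bij_betwI[of _ _ _ "\<lambda>p. inv r \<circ> p \<circ> r"])
        (use r permutes_inverses[OF r] in
          \<open>auto simp: fun_eq_iff Pi_iff intro!: permutes_compose permutes_inv\<close>)
    have "(\<Sum>p\<in>?P. perm_law t p * ?h p) = (\<Sum>p\<in>?P. perm_law t (?c p) * ?h (?c p))"
      by (rule sum.reindex_bij_betw[OF bij, symmetric])
    also have "\<dots> = (\<Sum>p\<in>?P. perm_law t p * cube_mean V (\<lambda>S. of_bool (F (r ` S) \<noteq> F (r ` p ` S))))"
    proof (intro sum.cong refl arg_cong2[of _ _ _ _ "(*)"])
      fix p
      show "perm_law t (?c p) = perm_law t p"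
        using perm_law_conj[OF permutes_inv[OF r], of t p] by (simp add: ii)
      have "?h (?c p) = cube_mean V (\<lambda>S. of_bool (F (r ` S) \<noteq> F (?c p ` r ` S)))"
        by (rule cube_mean_image[OF r, of "\<lambda>S. of_bool (F S \<noteq> F (?c p ` S))", symmetric])
      moreover have "?c p ` r ` S = r ` p ` S" for S
        by (simp add: image_image permutes_inverses[OF r])
      ultimately show "?h (?c p) = cube_mean V (\<lambda>S. of_bool (F (r ` S) \<noteq> F (r ` p ` S)))"
        by (simp only:)
    qed
    finally show ?thesis .
  qed
  have dist: "(\<Sum>r\<in>?P. cube_mean V (\<lambda>S. of_bool (F (r ` S) \<noteq> F (r ` p ` S))))
      = fact (card V) * cube_mean V (\<lambda>S. perm_dist V F S (p ` S))" for p
  proof -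
    have "(\<Sum>r\<in>?P. cube_mean V (\<lambda>S. of_bool (F (r ` S) \<noteq> F (r ` p ` S))))
        = cube_mean V (\<lambda>S. \<Sum>r\<in>?P. of_bool (F (r ` S) \<noteq> F (r ` p ` S)))"
      by (rule cube_mean_sum[symmetric])
    also have "\<dots> = cube_mean V (\<lambda>S. fact (card V) * perm_dist V F S (p ` S))"
      using finP by (simp add: perm_dist_def Collect_conj_eq)
    also have "\<dots> = fact (card V) * cube_mean V (\<lambda>S. perm_dist V F S (p ` S))"
      by (simp add: cube_mean_def sum_distrib_left)
    finally show ?thesis .
  qed
  have "fact (card V) * (\<Sum>p\<in>?P. perm_law t p * ?h p) = (\<Sum>r\<in>?P. \<Sum>p\<in>?P. perm_law t p * ?h p)"
    using card_permutations[OF refl finite_V] by simp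
  also have "\<dots> = (\<Sum>r\<in>?P. \<Sum>p\<in>?P. perm_law t p * cube_mean V (\<lambda>S. of_bool (F (r ` S) \<noteq> F (r ` p ` S))))"
    by (intro sum.cong refl conj) simp
  also have "\<dots> = (\<Sum>p\<in>?P. perm_law t p * (\<Sum>r\<in>?P. cube_mean V (\<lambda>S. of_bool (F (r ` S) \<noteq> F (r ` p ` S)))))"
    by (subst sum.swap) (simp add: sum_distrib_left)
  also have "\<dots> = fact (card V) * (\<Sum>p\<in>?P. perm_law t p * cube_mean V (\<lambda>S. perm_dist V F S (p ` S)))"
    unfolding dist by (simp add: sum_distrib_left ac_simps)
  finally show ?thesis
    by simp
qed

text \<open>Permutations moving many points carry mass at least 1/2; if all of them had mean above
  \<open>2 * \<delta>\<close>, the total would exceed \<open>\<delta>\<close>.\<close>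

lemma exists_stable_perm:
  fixes t :: real
  assumes t: "t > 0" "t \<le> card V" and n: "2 \<le> card V"
    and small: "4 / (card V * (t * exp (- 2 * t) / 8)) \<le> 1 / 4" "4 * (exp (4 * t / card V) - 1) \<le> 1 / 4"
    and stable: "(\<Sum>p\<in>{p. p permutes V}. perm_law t p * cube_mean V (\<lambda>S. of_bool (F S \<noteq> F (p ` S)))) \<le> \<delta>"
  obtains \<pi> where "\<pi> permutes V" "card V * (t * exp (- 2 * t) / 8) \<le> card {x. \<pi> x \<noteq> x}"
    "cube_mean V (\<lambda>S. perm_dist V F S (\<pi> ` S)) \<le> 2 * \<delta>"
proof -
  let ?Q = "\<lambda>p. card V * (t * exp (- 2 * t) / 8) \<le> card {x. p x \<noteq> x}"
  let ?P = "{p. p permutes V}" and ?PQ = "{p. p permutes V \<and> ?Q p}"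
  let ?h = "\<lambda>p. cube_mean V (\<lambda>S. perm_dist V F S (p ` S))"
  have h: "0 \<le> ?h p" for p
    unfolding cube_mean_def using perm_dist_nonneg by (intro divide_nonneg_nonneg sum_nonneg) auto
  have "\<exists>p\<in>?PQ. ?h p \<le> 2 * \<delta>"
  proof (rule ccontr)
    assume "\<not> (\<exists>p\<in>?PQ. ?h p \<le> 2 * \<delta>)"
    then have gt: "2 * \<delta> < ?h p" if "p \<in> ?PQ" for p
      using that by force
    have d: "(\<Sum>p\<in>?PQ. perm_law t p * ?h p) \<le> \<delta>"
    proof -
      have "(\<Sum>p\<in>?PQ. perm_law t p * ?h p) \<le> (\<Sum>p\<in>?P. perm_law t p * ?h p)"
        using finite_permutations[OF finite_V] h perm_law_nonneg by (intro sum_mono2) auto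
      then show ?thesis
        using stable[unfolded sum_perm_law_perm_dist] by (rule order_trans)
    qed
    have half: "1 / 2 \<le> (\<Sum>p\<in>?PQ. perm_law t p)"
      by (rule perm_law_moved[OF t n small])
    \<comment> \<open>Strictness of the final inequality takes a permutation of positive
      mass.\<close>
    have "\<exists>p0\<in>?PQ. perm_law t p0 \<noteq> 0"
    proof (rule ccontr)
      assume "\<not> (\<exists>p0\<in>?PQ. perm_law t p0 \<noteq> 0)"
      then have "(\<Sum>p\<in>?PQ. perm_law t p) = 0"
        by (intro sum.neutral) blast
      then show False
        using half by simp
    qed
    then obtain p0 where p0: "p0 \<in> ?PQ" "perm_law t p0 > 0"
      using perm_law_nonneg[of t] by (auto simp: less_le)
    have "0 \<le> (\<Sum>p\<in>?PQ. perm_law t p * ?h p)"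
      using h perm_law_nonneg by (intro sum_nonneg) auto
    then have "0 \<le> \<delta>"
      using d by linarith
    then have "\<delta> \<le> (\<Sum>p\<in>?PQ. perm_law t p) * (2 * \<delta>)"
      using mult_right_mono[OF half, of "2 * \<delta>"] by simp
    also have "\<dots> = (\<Sum>p\<in>?PQ. perm_law t p * (2 * \<delta>))"
      by (rule sum_distrib_right)
    also have "\<dots> < (\<Sum>p\<in>?PQ. perm_law t p * ?h p)"
    proof (rule sum_strict_mono_ex1)
      show "finite ?PQ"
        by (rule finite_perms[OF finite_V])
      show "\<forall>p\<in>?PQ. perm_law t p * (2 * \<delta>) \<le> perm_law t p * ?h p"
        by (intro ballI mult_left_mono less_imp_le[OF gt] perm_law_nonneg)
      show "\<exists>p\<in>?PQ. perm_law t p * (2 * \<delta>) < perm_law t p * ?h p"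
        by (intro bexI[of _ p0] mult_strict_left_mono gt p0)
    qed
    finally show False
      using d by linarith
  qed
  then show ?thesis
    using that by blast
qed

end

section \<open>Configurations as sets\<close>

definition config :: "'a set \<Rightarrow> 'a set \<Rightarrow> 'a \<Rightarrow> nat" where
  "config V S = (\<lambda>x\<in>V. of_bool (x \<in> S))"

lemma bij_config: "bij_betw (config V) (Pow V) (cube V)"
proof (rule bij_betwI[of _ _ _ "\<lambda>\<omega>. {x\<in>V. \<omega> x = 1}"])
  show "config V {x\<in>V. \<omega> x = 1} = \<omega>" if "\<omega> \<in> cube V" for \<omega>
  proof
    fix x
    show "config V {x\<in>V. \<omega> x = 1} x = \<omega> x"
      using that PiE_mem[of \<omega> V "\<lambda>_. {0, 1}" x] PiE_arb[of \<omega> V "\<lambda>_. {0, 1}" x]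
      by (cases "x \<in> V") (auto simp: config_def cube_def)
  qed
qed (auto simp: config_def cube_def)

lemma config_in_cube: "S \<subseteq> V \<Longrightarrow> config V S \<in> cube V"
  using bij_betwE[OF bij_config] by blast

lemma finite_cube: "finite V \<Longrightarrow> finite (cube V)"
  using bij_betw_finite[OF bij_config, of V] by simp

lemma cube_nonempty: "cube V \<noteq> {}"
  using config_in_cube[of "{}" V] by blast

lemma card_cube: "finite V \<Longrightarrow> card (cube V) = 2 ^ card V"
  using bij_betw_same_card[OF bij_config, of V] by (simp add: card_Pow)

lemma sum_cube: "(\<Sum>\<omega>\<in>cube V. h \<omega>) = (\<Sum>S\<in>Pow V. h (config V S))"
  by (rule sum.reindex_bij_betw[OF bij_config, symmetric])

lemma mono_on_subsets_config:
  assumes "f \<in> cube V \<rightarrow> {-1, 1 :: real}" "monotone_on_cube V f"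
  shows "mono_on_subsets V (\<lambda>S. f (config V S) = 1)"
  unfolding mono_on_subsets_def
proof (intro allI impI)
  fix S T assume ST: "S \<subseteq> T" "T \<subseteq> V" "f (config V S) = 1"
  then have c: "config V S \<in> cube V" "config V T \<in> cube V"
    by (auto intro: config_in_cube)
  have "\<forall>i\<in>V. config V S i \<le> config V T i"
    using ST(1) by (auto simp: config_def)
  then have "f (config V S) \<le> f (config V T)"
    using assms(2) c unfolding monotone_on_cube_def by blast
  moreover have "f (config V T) \<in> {-1, 1}"
    using assms(1) c(2) by blast
  ultimately show "f (config V T) = 1"
    using ST(3) by auto
qed

lemma config_neq_iff:
  assumes "f \<in> cube V \<rightarrow> {-1, 1 :: real}" "S \<subseteq> V" "T \<subseteq> V"
  shows "f (config V S) \<noteq> f (config V T) \<longleftrightarrow> (f (config V S) = 1) \<noteq> (f (config V T) = 1)"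
  using funcset_mem[OF assms(1) config_in_cube[OF assms(2)]]
    funcset_mem[OF assms(1) config_in_cube[OF assms(3)]] by auto

section \<open>Noise and exclusion laws in terms of subsets\<close>

lemma measure_uniform_cube:
  assumes "finite V"
  shows "measure_pmf.prob (pmf_of_set (cube V)) B = cube_mean V (\<lambda>S. of_bool (config V S \<in> B))"
proof -
  have "real (card (cube V \<inter> B)) = (\<Sum>\<omega>\<in>cube V. of_bool (\<omega> \<in> B))"
    using finite_cube[OF assms] by simp
  then show ?thesis
    using measure_pmf_of_set[OF cube_nonempty finite_cube[OF assms], of B]
    by (simp only: sum_cube cube_mean_def card_cube[OF assms]) simp
qed

lemma expectation_Pi_bernoulli:
  assumes V: "finite V" and e: "0 \<le> \<epsilon>" "\<epsilon> \<le> 1"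
  shows "measure_pmf.expectation (Pi_pmf V False (\<lambda>_. bernoulli_pmf \<epsilon>)) g
    = (\<Sum>R\<in>Pow V. bern_weight V \<epsilon> R * g (\<lambda>x. x \<in> R))"
proof -
  let ?c = "\<lambda>R x. x \<in> (R :: 'a set)"
  let ?M = "Pi_pmf V False (\<lambda>_. bernoulli_pmf \<epsilon>)"
  have pmf: "pmf ?M (?c R) = bern_weight V \<epsilon> R" if "R \<subseteq> V" for R
  proof -
    have "pmf ?M (?c R) = (\<Prod>x\<in>V. pmf (bernoulli_pmf \<epsilon>) (x \<in> R))"
      using that by (intro pmf_Pi' V) auto
    also have "\<dots> = (\<Prod>x\<in>V. if x \<in> R then \<epsilon> else 1 - \<epsilon>)"
      using e by (intro prod.cong) auto
    also have "\<dots> = bern_weight V \<epsilon> R"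
    proof -
      have "V \<inter> {x. x \<in> R} = R" "V \<inter> - {x. x \<in> R} = V - R"
        using that by auto
      then show ?thesis
        by (simp add: prod.If_cases[OF V] bern_weight_def)
    qed
    finally show ?thesis .
  qed
  have "measure_pmf.expectation ?M g = (\<Sum>r\<in>?c ` Pow V. pmf ?M r *\<^sub>R g r)"
  proof (rule integral_measure_pmf)
    show "finite (?c ` Pow V)"
      using V by simp
    fix r assume "r \<in> set_pmf ?M"
    then have "\<forall>x. x \<notin> V \<longrightarrow> r x = False"
      using set_Pi_pmf_subset[OF V, of False "\<lambda>_. bernoulli_pmf \<epsilon>"] by auto
    then have "r = ?c {x. r x}" "{x. r x} \<subseteq> V"
      by auto
    then show "r \<in> ?c ` Pow V"
      by blast
  qed
  also have "\<dots> = (\<Sum>R\<in>Pow V. pmf ?M (?c R) *\<^sub>R g (?c R))"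
    by (subst sum.reindex) (auto simp: inj_on_def fun_eq_iff)
  also have "\<dots> = (\<Sum>R\<in>Pow V. bern_weight V \<epsilon> R * g (?c R))"
    by (intro sum.cong) (auto simp: pmf)
  finally show ?thesis .
qed

lemma expectation_bind_pmf_finite:
  fixes h :: "'b \<Rightarrow> real"
  assumes "finite (set_pmf p)" "\<And>x. finite (set_pmf (g x))"
  shows "measure_pmf.expectation (bind_pmf p g) h
    = measure_pmf.expectation p (\<lambda>x. measure_pmf.expectation (g x) h)"
proof -
  have "measure_pmf.expectation (bind_pmf p g) h
      = (\<Sum>a\<in>set_pmf p. pmf p a *\<^sub>R measure_pmf.expectation (g a) h)"
    using assms by (intro pmf_expectation_bind) auto
  also have "\<dots> = measure_pmf.expectation p (\<lambda>x. measure_pmf.expectation (g x) h)"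
    by (rule integral_measure_pmf[symmetric]) (use assms in auto)
  finally show ?thesis .
qed

lemma expectation_uniform_cube:
  assumes "finite V"
  shows "measure_pmf.expectation (pmf_of_set (cube V)) h
    = (\<Sum>S\<in>Pow V. bern_weight V (1/2) S * h (config V S))"
  using integral_pmf_of_set[OF cube_nonempty finite_cube[OF assms], of h]
  by (simp add: sum_cube card_cube[OF assms] cube_mean_eq_bern[OF assms, symmetric] cube_mean_def)

lemma expectation_noise_pair:
  fixes h :: "('a \<Rightarrow> nat) \<times> ('a \<Rightarrow> nat) \<Rightarrow> real"
  assumes V: "finite V" and e: "0 \<le> \<epsilon>" "\<epsilon> \<le> 1"
  shows "measure_pmf.expectation (noise_pair V \<epsilon>) h
    = (\<Sum>S\<in>Pow V. bern_weight V (1/2) S * (\<Sum>R\<in>Pow V. bern_weight V \<epsilon> R *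
        (\<Sum>U\<in>Pow V. bern_weight V (1/2) U * h (config V S, config V (noisy (S, R, U))))))"
proof -
  have fin: "finite (set_pmf (pmf_of_set (cube V)))"
    using set_pmf_of_set[OF cube_nonempty finite_cube[OF V]] finite_cube[OF V] by simp
  have fin': "finite (set_pmf (Pi_pmf V False (\<lambda>_. bernoulli_pmf \<epsilon>)))"
    by (rule finite_subset[OF set_Pi_pmf_subset'[OF V] finite_PiE_dflt[OF V]]) simp
  have res: "(\<lambda>x\<in>V. if x \<in> R then config V U x else config V S x) = config V (noisy (S, R, U))" for S R U
    by (auto simp: config_def noisy_def fun_eq_iff restrict_def)
  show ?thesis
    unfolding noise_pair_def
    by (simp add: expectation_bind_pmf_finite fin fin' expectation_uniform_cube[OF V]
        expectation_Pi_bernoulli[OF V e] res)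
qed

lemma prob_noise_pair:
  assumes V: "finite V" and e: "0 \<le> \<epsilon>" "\<epsilon> \<le> 1" and f: "f \<in> cube V \<rightarrow> {-1, 1 :: real}"
  shows "measure_pmf.prob (noise_pair V \<epsilon>) {(\<omega>, \<omega>'). f \<omega> \<noteq> f \<omega>'}
    = noise_disagree V \<epsilon> (\<lambda>S. f (config V S) = 1)"
proof -
  let ?h = "indicator {(\<omega>, \<omega>'). f \<omega> \<noteq> f \<omega>'} :: _ \<Rightarrow> real"
  let ?F = "\<lambda>S. f (config V S) = 1"
  have "measure_pmf.prob (noise_pair V \<epsilon>) {(\<omega>, \<omega>'). f \<omega> \<noteq> f \<omega>'}
      = measure_pmf.expectation (noise_pair V \<epsilon>) ?h"
    by simp
  also have "\<dots> = (\<Sum>S\<in>Pow V. bern_weight V (1/2) S * (\<Sum>R\<in>Pow V. bern_weight V \<epsilon> R *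
      (\<Sum>U\<in>Pow V. bern_weight V (1/2) U * ?h (config V S, config V (noisy (S, R, U))))))"
    by (rule expectation_noise_pair[OF V e])
  also have "\<dots> = (\<Sum>S\<in>Pow V. \<Sum>R\<in>Pow V. \<Sum>U\<in>Pow V.
      noise_weight V \<epsilon> (S, R, U) * of_bool (?F S \<noteq> ?F (noisy (S, R, U))))"
    unfolding sum_distrib_left
  proof (intro sum.cong refl)
    fix S R U assume s: "S \<in> Pow V" "R \<in> Pow V" "U \<in> Pow V"
    then have "noisy (S, R, U) \<subseteq> V"
      by (auto simp: noisy_def)
    then have "?h (config V S, config V (noisy (S, R, U))) = of_bool (?F S \<noteq> ?F (noisy (S, R, U)))"
      using config_neq_iff[OF f, of S "noisy (S, R, U)"] s by (simp add: indicator_def)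
    then show "bern_weight V (1/2) S * (bern_weight V \<epsilon> R * (bern_weight V (1/2) U
        * ?h (config V S, config V (noisy (S, R, U)))))
      = noise_weight V \<epsilon> (S, R, U) * of_bool (?F S \<noteq> ?F (noisy (S, R, U)))"
      by (simp add: noise_weight_def)
  qed
  also have "\<dots> = noise_disagree V \<epsilon> ?F"
    unfolding noise_disagree_def noise_space_def sum.cartesian_product
    by (intro sum.cong) auto
  finally show ?thesis .
qed

text \<open>A union bound, since nothing changes unless some site is resampled. It serves the sets
  \<open>V\<close> too small for the asymptotic estimates.\<close>

lemma noise_disagree_le_card:
  fixes \<epsilon> :: real
  assumes V: "finite V" and e: "0 \<le> \<epsilon>" "\<epsilon> \<le> 1"
  shows "noise_disagree V \<epsilon> F \<le> card V * \<epsilon>"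
proof -
  have "noise_disagree V \<epsilon> F \<le> (\<Sum>\<omega>\<in>noise_space V. noise_weight V \<epsilon> \<omega> * (\<Sum>i\<in>V. of_bool (i \<in> fst (snd \<omega>))))"
    unfolding noise_disagree_def
  proof (intro sum_mono mult_left_mono noise_weight_nonneg[OF e])
    fix \<omega> :: "'a set \<times> 'a set \<times> 'a set"
    assume w: "\<omega> \<in> noise_space V"
    obtain S R U where S: "\<omega> = (S, R, U)" by (cases \<omega>)
    show "of_bool (F (fst \<omega>) \<noteq> F (noisy \<omega>)) \<le> (\<Sum>i\<in>V. of_bool (i \<in> fst (snd \<omega>)) :: real)"
    proof (cases "R = {}")
      case True
      then show ?thesis
        by (simp add: S noisy_def)
    next
      case False
      then obtain i where i: "i \<in> R" by blast
      then have "i \<in> V"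
        using w by (auto simp: S noise_space_def)
      then have "of_bool (i \<in> R) \<le> (\<Sum>i\<in>V. of_bool (i \<in> R) :: real)"
        using V by (intro member_le_sum) auto
      then show ?thesis
        using i by (auto simp: S of_bool_def)
    qed
  qed
  also have "\<dots> = (\<Sum>i\<in>V. \<Sum>\<omega>\<in>noise_space V. noise_weight V \<epsilon> \<omega> * of_bool (i \<in> fst (snd \<omega>)))"
    by (simp only: sum_distrib_left sum.swap[of _ V])
  also have "\<dots> = (\<Sum>i\<in>V. \<epsilon>)"
  proof (rule sum.cong[OF refl])
    fix i assume "i \<in> V"
    then show "(\<Sum>\<omega>\<in>noise_space V. noise_weight V \<epsilon> \<omega> * of_bool (i \<in> fst (snd \<omega>))) = \<epsilon>"
      using sum_noise_factor[of V \<epsilon> "\<lambda>_. 1" "\<lambda>R. of_bool (i \<in> R)" "\<lambda>_. 1"]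
        sum_bern_weight_superset[OF V, of "{i}" \<epsilon>]
      by (simp add: case_prod_beta sum_bern_weight[OF V])
  qed
  finally show ?thesis by simp
qed

text \<open>The permutation takes finitely many values and is independent of the start, so the event
  is a disjoint union of rectangles. Composing a configuration with \<open>inv p\<close> takes the
  image of its set under \<open>p\<close>.\<close>

lemma (in clock_system) measure_cgx_unstable:
  assumes f: "f \<in> cube V \<rightarrow> {-1, 1 :: real}"
  defines "F \<equiv> \<lambda>S. f (config V S) = 1"
  shows "measure (cgx_space V) {(\<eta>, w) \<in> space (cgx_space V). f \<eta> \<noteq> f (cgx_config V \<eta> w t)}
    = (\<Sum>p\<in>{p. p permutes V}. perm_law t p * cube_mean V (\<lambda>S. of_bool (F S \<noteq> F (p ` S))))"
proof -
  interpret C: prob_space "clocks V"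
    by (rule prob_space_clocks)
  let ?U = "measure_pmf (pmf_of_set (cube V))"
  interpret UC: prob_space "?U \<Otimes>\<^sub>M clocks V"
    by (rule prob_space_pair[OF measure_pmf.prob_space_axioms prob_space_clocks])
  let ?P = "{p. p permutes V}"
  define B where "B p = {\<eta>. f \<eta> \<noteq> f (\<lambda>x\<in>V. \<eta> (inv p x))}" for p
  define W where "W p = {w \<in> space (clocks V). cgx_perm V w t = p}" for p
  have W: "W p \<in> sets (clocks V)" for p
    unfolding W_def by (rule sets_cgx_perm)
  have "{(\<eta>, w) \<in> space (cgx_space V). f \<eta> \<noteq> f (cgx_config V \<eta> w t)} = (\<Union>p\<in>?P. B p \<times> W p)"
    using cgx_perm_permutes[of V _ t]
    by (auto simp: cgx_space_def space_pair_measure B_def W_def cgx_config_def)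
  then have "measure (cgx_space V) {(\<eta>, w) \<in> space (cgx_space V). f \<eta> \<noteq> f (cgx_config V \<eta> w t)}
      = measure (?U \<Otimes>\<^sub>M clocks V) (\<Union>p\<in>?P. B p \<times> W p)"
    by (simp add: cgx_space_def)
  also have "\<dots> = (\<Sum>p\<in>?P. measure (?U \<Otimes>\<^sub>M clocks V) (B p \<times> W p))"
  proof (rule UC.finite_measure_finite_Union)
    show "finite ?P"
      by (rule finite_permutations[OF finite_V])
    show "(\<lambda>p. B p \<times> W p) ` ?P \<subseteq> sets (?U \<Otimes>\<^sub>M clocks V)"
      using W by auto
    show "disjoint_family_on (\<lambda>p. B p \<times> W p) ?P"
      by (auto simp: disjoint_family_on_def W_def)
  qed
  also have "\<dots> = (\<Sum>p\<in>?P. perm_law t p * cube_mean V (\<lambda>S. of_bool (F S \<noteq> F (p ` S))))"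
  proof (rule sum.cong[OF refl])
    fix p assume "p \<in> ?P"
    then have p: "p permutes V" by simp
    have conf: "(\<lambda>x\<in>V. config V S (inv p x)) = config V (p ` S)" for S
    proof
      fix x
      have "x \<in> p ` S \<longleftrightarrow> inv p x \<in> S"
        using permutes_inverses[OF p] by (metis image_iff)
      then show "(\<lambda>x\<in>V. config V S (inv p x)) x = config V (p ` S) x"
        using permutes_in_image[OF permutes_inv[OF p]] by (simp add: config_def)
    qed
    have "emeasure (?U \<Otimes>\<^sub>M clocks V) (B p \<times> W p) = emeasure ?U (B p) * emeasure (clocks V) (W p)"
      using W by (intro C.emeasure_pair_measure_Times) auto
    then have "measure (?U \<Otimes>\<^sub>M clocks V) (B p \<times> W p) = measure ?U (B p) * measure (clocks V) (W p)"
      by (simp add: measure_def enn2real_mult)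
    also have "measure (clocks V) (W p) = perm_law t p"
      by (simp add: W_def perm_law_def)
    also have "measure ?U (B p) = cube_mean V (\<lambda>S. of_bool (config V S \<in> B p))"
      by (rule measure_uniform_cube[OF finite_V])
    also have "\<dots> = cube_mean V (\<lambda>S. of_bool (F S \<noteq> F (p ` S)))"
      unfolding cube_mean_def
    proof (intro arg_cong2[of _ _ _ _ "(/)"] sum.cong refl)
      fix S assume S: "S \<in> Pow V"
      then have "p ` S \<subseteq> V"
        using permutes_image[OF p] by blast
      then show "of_bool (config V S \<in> B p) = (of_bool (F S \<noteq> F (p ` S)) :: real)"
        using config_neq_iff[OF f, of S "p ` S"] S by (simp add: B_def conf F_def)
    qed
    finally show "measure (?U \<Otimes>\<^sub>M clocks V) (B p \<times> W p)
        = perm_law t p * cube_mean V (\<lambda>S. of_bool (F S \<noteq> F (p ` S)))"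
      by simp
  qed
  finally show ?thesis .
qed

section \<open>Choice of the parameters\<close>

lemma noise_disagree_small:
  fixes \<theta> \<delta> \<epsilon> :: real
  assumes V: "finite V" "card V > 0" and F: "mono_on_subsets V F"
    and p: "\<pi> permutes V" "card V * \<theta> \<le> card {x. \<pi> x \<noteq> x}"
    and stable: "cube_mean V (\<lambda>S. perm_dist V F S (\<pi> ` S)) \<le> \<delta> / 8" and d: "\<delta> > 0"
    and e: "0 \<le> \<epsilon>" "\<epsilon> \<le> 1" "\<epsilon> \<le> \<theta> / 2" "\<epsilon> \<le> \<delta> * (\<delta> / 64)\<^sup>2 / 4"
    and large: "64 / \<delta> \<le> sqrt (card V)"
  shows "noise_disagree V \<epsilon> F \<le> \<delta>"
proof -
  let ?n = "real (card V)"
  \<comment> \<open>Moving \<open>2 * r\<close> points switches off about \<open>r / 2\<close>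
    sites, noise about \<open>\<epsilon> * n / 4\<close>; so \<open>r\<close> should be close to
    this \<open>x\<close>.\<close>
  define x where "x = \<epsilon> * ?n / 2"
  have x0: "0 \<le> x"
    using e by (simp add: x_def)
  have "real (nat \<lfloor>x\<rfloor>) \<le> x" "x < real (nat \<lfloor>x\<rfloor>) + 1"
    using x0 by linarith+
  then obtain k where fl: "real k \<le> x" "x < real k + 1"
    by blast
  \<comment> \<open>A single point has no derangement, so \<open>r = 1\<close> must be avoided. Allowing \<open>r = 0\<close> makes the bound
    hold for arbitrarily small \<open>\<epsilon>\<close> at a fixed \<open>V\<close>; the final choice of \<open>\<epsilon>\<close> needs this.\<close>
  define r where "r = (if x < 2 then 0 else k)"
  have r: "real r \<le> x" "x - 2 \<le> real r" "r \<noteq> 1"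
    using fl x0 unfolding r_def by auto
  have "3 * real r \<le> 3 * x"
    using r by simp
  also have "\<dots> \<le> ?n * \<theta>"
  proof -
    have "3 / 2 * \<epsilon> * ?n \<le> \<theta> * ?n"
      using e by (intro mult_right_mono) auto
    then show ?thesis by (simp add: x_def ac_simps)
  qed
  finally have "real (3 * r) \<le> real (card {x. \<pi> x \<noteq> x})"
    using p(2) by simp
  then have "3 * r \<le> card {x. \<pi> x \<noteq> x}"
    by (simp only: of_nat_le_iff)
  then obtain \<kappa> where k: "\<kappa> permutes V" "card {x. \<kappa> x \<noteq> x} = 2 * r"
    "cube_mean V (\<lambda>S. perm_dist V F S (\<kappa> ` S)) \<le> 2 * cube_mean V (\<lambda>S. perm_dist V F S (\<pi> ` S))"
    by (rule exists_perm_with_few_moved[OF V(1) p(1) _ r(3)])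
  \<comment> \<open>The level term is about \<open>8 * l / sqrt n\<close>, which this choice makes
    \<open>\<delta> / 8\<close>. Rounding up to the integer \<open>L\<close> costs at most
    \<open>8 / sqrt n\<close>, controlled by \<open>large\<close>.\<close>
  define l where "l = \<delta> / 64 * sqrt ?n"
  have l: "l > 0"
    using d V by (simp add: l_def)
  have l2: "l\<^sup>2 = (\<delta> / 64)\<^sup>2 * ?n"
    by (simp add: l_def power_mult_distrib power_divide)
  define L where "L = nat \<lceil>2 * l + 1\<rceil>"
  have L: "2 * l + 1 \<le> real L" "real L \<le> 2 * l + 2"
    using l unfolding L_def by linarith+
  \<comment> \<open>The centres are \<open>r / 2\<close> and \<open>x / 2\<close>, and
    \<open>x - r\<close> lies between 0 and 2.\<close>
  have close: "\<bar>real (card {x. \<kappa> x \<noteq> x}) / 4 - ?n * (\<epsilon> / 4)\<bar> \<le> 1"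
    using r by (simp add: k(2) x_def abs_le_iff field_simps)
  have sq: "sqrt ?n > 0"
    using V by simp
  have "noise_disagree V \<epsilon> F \<le> cube_mean V (\<lambda>S. perm_dist V F S (\<kappa> ` S))
      + 4 * real L / sqrt ?n + real (card {x. \<kappa> x \<noteq> x}) / (8 * l\<^sup>2) + ?n * \<epsilon> / (2 * l\<^sup>2)"
    by (rule noise_disagree_le[OF V F k(1) e(1,2) l L(1) close])
  also have "\<dots> \<le> \<delta> / 4 + (\<delta> / 8 + \<delta> / 8) + \<delta> / 16 + \<delta> / 4"
  proof (intro add_mono)
    show "cube_mean V (\<lambda>S. perm_dist V F S (\<kappa> ` S)) \<le> \<delta> / 4"
      using k(3) stable by simp
    have "4 * real L / sqrt ?n \<le> 4 * (2 * l + 2) / sqrt ?n"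
      using L sq by (intro divide_right_mono) auto
    also have "\<dots> = \<delta> / 8 + 8 / sqrt ?n"
      using sq by (simp add: l_def add_divide_distrib)
    also have "8 / sqrt ?n \<le> \<delta> / 8"
      using large d sq by (simp add: field_simps)
    finally show "4 * real L / sqrt ?n \<le> \<delta> / 8 + \<delta> / 8"
      by simp
    \<comment> \<open>Here \<epsilon> is small compared with the square of
      \<open>\<delta> / 64\<close>; this bounds all three Chebyshev terms.\<close>
    have ne: "?n * \<epsilon> \<le> \<delta> / 4 * l\<^sup>2"
      using mult_left_mono[OF e(4), of ?n] by (simp add: l2 ac_simps)
    have "real (card {x. \<kappa> x \<noteq> x}) \<le> \<delta> / 4 * l\<^sup>2"
      using ne r(1) by (simp add: k(2) x_def mult.commute)
    then have "real (card {x. \<kappa> x \<noteq> x}) / (8 * l\<^sup>2) \<le> \<delta> / 4 * l\<^sup>2 / (8 * l\<^sup>2)"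
      by (intro divide_right_mono) auto
    also have "\<dots> \<le> \<delta> / 16"
      using l d by simp
    finally show "real (card {x. \<kappa> x \<noteq> x}) / (8 * l\<^sup>2) \<le> \<delta> / 16" .
    have "?n * \<epsilon> / (2 * l\<^sup>2) \<le> \<delta> / 4 * l\<^sup>2 / (2 * l\<^sup>2)"
      using ne by (intro divide_right_mono) auto
    also have "\<dots> \<le> \<delta> / 4"
      using l d by simp
    finally show "?n * \<epsilon> / (2 * l\<^sup>2) \<le> \<delta> / 4" .
  qed
  also have "\<dots> \<le> \<delta>"
    using d by simp
  finally show ?thesis .
qed

theorem theorem1p16:
  fixes V :: "nat \<Rightarrow> 'a set"
    and f :: "nat \<Rightarrow> ('a \<Rightarrow> nat) \<Rightarrow> real"
  assumes "\<And>n. finite (V n)"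
    and "incseq V"
    and "\<And>n. f n \<in> cube (V n) \<rightarrow> {-1, 1}"
    and "\<And>n. monotone_on_cube (V n) (f n)"
    and "CGXStable V f"
  shows "NStable V f"
  unfolding NStable_def
proof (intro allI impI)
  fix \<delta> :: real assume d: "\<delta> > 0"
  \<comment> \<open>The selection of one permutation doubles the error and the commutator doubles it
    again, giving \<open>\<delta> / 4\<close>.\<close>
  then have "\<delta> / 16 > 0" by simp
  then obtain t where t: "t > 0" and stable: "\<And>n. measure (cgx_space (V n))
      {(\<eta>, w) \<in> space (cgx_space (V n)). f n \<eta> \<noteq> f n (cgx_config (V n) \<eta> w t)} \<le> \<delta> / 16"
    using assms(5) unfolding CGXStable_def by blast
  define \<theta> where "\<theta> = t * exp (- 2 * t) / 8"
  have th: "\<theta> > 0"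
    using t by (simp add: \<theta>_def)
  have "\<forall>\<^sub>F m in sequentially. 4 / (real m * \<theta>) < 1 / 4"
  proof (rule order_tendstoD)
    have "(\<lambda>m. (4 / \<theta>) / real m) \<longlonglongrightarrow> 0"
      by (rule lim_const_over_n)
    then show "(\<lambda>m. 4 / (real m * \<theta>)) \<longlonglongrightarrow> 0"
      by (simp add: mult.commute)
  qed simp
  moreover have "\<forall>\<^sub>F m in sequentially. 4 * (exp (4 * t / real m) - 1) < 1 / 4"
  proof (rule order_tendstoD)
    show "(\<lambda>m. 4 * (exp (4 * t / real m) - 1)) \<longlonglongrightarrow> 4 * (exp 0 - 1)"
      by (intro tendsto_intros lim_const_over_n)
  qed simp
  \<comment> \<open>The first two conditions bound the exceptional probability for isolated pairs,
    the next two serve the lower bound on their expected number, and the last makes the rounding of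
    \<open>L\<close> harmless.\<close>
  ultimately have "\<forall>\<^sub>F m in sequentially. 4 / (real m * \<theta>) \<le> 1 / 4 \<and> 4 * (exp (4 * t / real m) - 1) \<le> 1 / 4
      \<and> nat \<lceil>t\<rceil> \<le> m \<and> 2 \<le> m \<and> nat \<lceil>(64 / \<delta>)\<^sup>2\<rceil> \<le> m"
    using eventually_ge_at_top[of "nat \<lceil>t\<rceil>"] eventually_ge_at_top[of 2]
      eventually_ge_at_top[of "nat \<lceil>(64 / \<delta>)\<^sup>2\<rceil>"]
    by eventually_elim auto
  then obtain N where N: "\<And>m. N \<le> m \<Longrightarrow> 4 / (real m * \<theta>) \<le> 1 / 4 \<and> 4 * (exp (4 * t / real m) - 1) \<le> 1 / 4
      \<and> nat \<lceil>t\<rceil> \<le> m \<and> 2 \<le> m \<and> nat \<lceil>(64 / \<delta>)\<^sup>2\<rceil> \<le> m"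
    unfolding eventually_sequentially by blast
  \<comment> \<open>In order: \<epsilon> stays below 1; the permutation moves enough points for the
    support wanted; the counts concentrate; and sets with fewer than \<open>N\<close> elements are
    settled by the union bound.\<close>
  let ?bounds = "{1 / 2, \<theta> / 2, \<delta> * (\<delta> / 64)\<^sup>2 / 4, \<delta> / (real N + 1)}"
  define \<epsilon> where "\<epsilon> = Min ?bounds"
  have le: "\<epsilon> \<le> b" if "b \<in> ?bounds" for b
    unfolding \<epsilon>_def using that by (intro Min_le) auto
  have "0 < \<epsilon>"
    using d th unfolding \<epsilon>_def by (subst Min_gr_iff) auto
  have e: "0 < \<epsilon>" "\<epsilon> \<le> 1 / 2" "\<epsilon> \<le> \<theta> / 2" "\<epsilon> \<le> \<delta> * (\<delta> / 64)\<^sup>2 / 4" "\<epsilon> \<le> \<delta> / (real N + 1)"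
    by (fact, (rule le, simp)+)
  show "\<exists>\<epsilon>\<in>{0<..<1}. \<forall>n. measure_pmf.prob (noise_pair (V n) \<epsilon>) {(\<omega>, \<omega>'). f n \<omega> \<noteq> f n \<omega>'} \<le> \<delta>"
  proof (intro bexI[of _ \<epsilon>] allI)
    fix n
    let ?F = "\<lambda>S. f n (config (V n) S) = 1"
    have "noise_disagree (V n) \<epsilon> ?F \<le> \<delta>"
    proof (cases "N \<le> card (V n)")
      case False
      have "noise_disagree (V n) \<epsilon> ?F \<le> card (V n) * \<epsilon>"
        using e by (intro noise_disagree_le_card assms(1)) auto
      also have "\<dots> \<le> (real N + 1) * (\<delta> / (real N + 1))"
        using False e by (intro mult_mono) auto
      finally show ?thesis by simp
    next
      case True
      note N' = N[OF True]
      have tn: "t \<le> card (V n)"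
        using N' by linarith
      have "(64 / \<delta>)\<^sup>2 \<le> card (V n)"
        using N' by linarith
      then have large: "64 / \<delta> \<le> sqrt (card (V n))"
        by (rule real_le_rsqrt)
      have F: "mono_on_subsets (V n) ?F"
        by (intro mono_on_subsets_config assms)
      interpret clock_system "V n"
        using N' assms(1) by unfold_locales auto
      have small: "2 \<le> card (V n)" "4 / (card (V n) * (t * exp (- 2 * t) / 8)) \<le> 1 / 4"
        "4 * (exp (4 * t / card (V n)) - 1) \<le> 1 / 4"
        using N' unfolding \<theta>_def by blast+
      have avg: "(\<Sum>p\<in>{p. p permutes V n}. perm_law t p
          * cube_mean (V n) (\<lambda>S. of_bool (?F S \<noteq> ?F (p ` S)))) \<le> \<delta> / 16"
        using stable[of n] unfolding measure_cgx_unstable[OF assms(3)[of n], of t] .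
      obtain \<pi> where pi: "\<pi> permutes V n" "card (V n) * (t * exp (- 2 * t) / 8) \<le> card {x. \<pi> x \<noteq> x}"
        "cube_mean (V n) (\<lambda>S. perm_dist (V n) ?F S (\<pi> ` S)) \<le> 2 * (\<delta> / 16)"
        by (rule exists_stable_perm[OF t tn small avg])
      show ?thesis
        by (rule noise_disagree_small[OF assms(1) card_V_pos F pi(1) pi(2)[folded \<theta>_def] _ d _ _ e(3,4) large])
          (use pi(3) e in auto)
    qed
    then show "measure_pmf.prob (noise_pair (V n) \<epsilon>) {(\<omega>, \<omega>'). f n \<omega> \<noteq> f n \<omega>'} \<le> \<delta>"
      using e prob_noise_pair[OF assms(1) _ _ assms(3), of \<epsilon> n] by simp
  qed (use e in auto)
qed

end
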